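(* Let $k$ be a field of characteristic $p$. Then: (1) The radical $J(ZkN)$ of the centre $ZkN$ of the group algebra $kN$ has a $k$-basis consisting of the elements $D_x$ for $x\in(\mathbb F_{q^2}^\times/\Gamma)\setminus\{\Gamma\}$, $T_x$ for $x\in(\Psi/\Gamma)\setminus\{\Gamma\}$, $T_1+\mathrm{Id}$, and $U_x$ for $x\in\mathbb F_{q^2}^\times/\mathrm L$. In particular, $\dim_k J(ZkN)=\frac{q^2+q}{\gamma}+\gamma-1$. (2) The square $J^2(ZkN)$ of $J(ZkN)$ has a $k$-basis consisting of the elements $D_x+T_x$, for $x\in(\Psi/\Gamma)\setminus\{\Gamma\}$. In particular, $\dim_k J^2(ZkN)=\frac{q+1}{\gamma}-1$. (3) The cube $J^3(ZkN)$ of $J(ZkN)$ is equal to $0$.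
   Context: Let $p$ be a prime, $r\ge1$ an integer and $q=p^r$. For $x\in\mathbb F_{q^2}$ put $\overline{x}=x^q$. Put $\gamma=\gcd(3,q+1)$, $\Gamma=\{\lambda\in\mathbb F_{q^2}\mid\lambda^\gamma=1\}$, $\Psi=\{x\in\mathbb F_{q^2}^\times\mid x\overline{x}=1\}$ (so $\Gamma\le\Psi$), $\mathrm L=\{a^\gamma\mid a\in\mathbb F_{q^2}^\times\}$. Fix $\omega\in\mathbb F_{q^2}$, $\omega\neq0$, with $\omega+\overline{\omega}=0$, and $\tau\in\mathbb F_{q^2}$ with $\tau+\overline{\tau}=-1$. Let $PSU(3,q)$ be the projective special unitary group of the hermitian form on $\mathbb F_{q^2}^3$ with Gram matrix $\left(\begin{array}{ccc}0&0&1\\0&1&0\\1&0&0\end{array}\right)$. Let $\mathcal Q=\{(a,b,c)\in\mathbb F_{q^2}^\times\times(\mathbb F_{q^2})^2\mid b\overline{b}+a\overline{c}+c\overline{a}=0\}$ and, for $(a,b,c)\in\mathcal Q$, let $M(a,b,c)=\left(\begin{array}{ccc}a&b&c\\0&\overline{a}/a&-\overline{b}/a\\0&0&1/\overline{a}\end{array}\right)$. The normaliser $N$ in $PSU(3,q)$ of a Sylow $p$-subgroup $S$ is taken to be the image in $PSU(3,q)$ of the group of matrices $M(a,b,c)$, $(a,b,c)\in\mathcal Q$; $\hat M(a,b,c)$ denotes the image of $M(a,b,c)$ in $N$. For $g\in N$, $g^+\in ZkN$ denotes the sum of the $N$-conjugates of $g$. For $x\in\mathbb F_{q^2}^\times$: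 $d_x=\hat M(x,0,0)$, $D_x=d_x^+$. For $x\in\Psi$: $t_x=\hat M(x,0,x\omega)$, $T_x=t_x^+$. For $y\in\mathbb F_{q^2}^\times$: $u_y=\hat M(1,y,y\overline{y}\tau)$, $U_y=u_y^+$. The elements $D_x,T_x$ depend only on the coset $x\Gamma$, and $U_y$ only on the coset $y\mathrm L$, so one may index them by cosets. $\mathrm{Id}$ is the identity element of $N$. *)

theory Defs
  imports
    "HOL-Analysis.Determinants"
    "HOL-Algebra.Coset"
    "HOL-Algebra.Ideal_Product"
    "HOL-Library.Poly_Mapping"
    "HOL-Computational_Algebra.Primes"
begin

text \<open>The field is a type \<open>'f\<close> of class \<open>field\<close>; the requirement that it has \<open>q\<^sup>2\<close> elements is an
  explicit assumption \<open>CARD('f) = q ^ 2\<close> where these notions are used.\<close>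

definition qbar :: "nat \<Rightarrow> 'f::field \<Rightarrow> 'f"
  where "qbar q x = x ^ q"

definition gam :: "nat \<Rightarrow> nat"
  where "gam q = gcd 3 (q + 1)"

definition Gamma_set :: "nat \<Rightarrow> 'f::field set"
  where "Gamma_set q = {l. l ^ gam q = 1}"

definition Psi_set :: "nat \<Rightarrow> 'f::field set"
  where "Psi_set q = {x. x \<noteq> 0 \<and> x * qbar q x = 1}"

definition L_set :: "nat \<Rightarrow> 'f::field set"
  where "L_set q = {a ^ gam q | a. a \<noteq> 0}"

definition field_units :: "'f::field monoid"
  where "field_units = \<lparr>carrier = UNIV - {0}, mult = (*), one = 1\<rparr>"

definition units_mod_Gamma :: "nat \<Rightarrow> 'f::field set set"
  where "units_mod_Gamma q = carrier (field_units Mod Gamma_set q)"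

definition Psi_mod_Gamma :: "nat \<Rightarrow> 'f::field set set"
  where "Psi_mod_Gamma q = carrier (field_units\<lparr>carrier := Psi_set q\<rparr> Mod Gamma_set q)"

definition units_mod_L :: "nat \<Rightarrow> 'f::field set set"
  where "units_mod_L q = carrier (field_units Mod L_set q)"

text \<open>The value on a coset of a function that is constant on that coset.\<close>

definition on_coset :: "('f \<Rightarrow> 'b) \<Rightarrow> 'f set \<Rightarrow> 'b"
  where "on_coset f X = the_elem (f ` X)"

definition gram :: "'f::field^3^3"
  where "gram = vector [vector [0, 0, 1], vector [0, 1, 0], vector [1, 0, 0]]"

definition hform :: "nat \<Rightarrow> 'f::field^3 \<Rightarrow> 'f^3 \<Rightarrow> 'f"
  where "hform q v w = (\<Sum>i\<in>UNIV. \<Sum>j\<in>UNIV. v $ i * gram $ i $ j * qbar q (w $ j))"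

text \<open>Matrices act on columns here. As \<open>gram\<close> is symmetric, has entries in the prime field and squares
  to the identity, the same set of matrices is obtained from the action on rows.\<close>

definition SU3 :: "nat \<Rightarrow> ('f::field^3^3) monoid"
  where "SU3 q =
    \<lparr>carrier = {A. det A = 1 \<and> (\<forall>v w. hform q (A *v v) (A *v w) = hform q v w)},
     mult = (**), one = mat 1\<rparr>"

definition SU3_scalars :: "nat \<Rightarrow> ('f::field^3^3) set"
  where "SU3_scalars q = {A \<in> carrier (SU3 q). \<exists>c. A = mat c}"

definition PSU3 :: "nat \<Rightarrow> ('f::field^3^3) set monoid"
  where "PSU3 q = SU3 q Mod SU3_scalars q"

definition Q_set :: "nat \<Rightarrow> ('f::field \<times> 'f \<times> 'f) set"
  where "Q_set q = {(a, b, c). a \<noteq> 0 \<and> b * qbar q b + a * qbar q c + c * qbar q a = 0}"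

definition M_mat :: "nat \<Rightarrow> 'f::field \<Rightarrow> 'f \<Rightarrow> 'f \<Rightarrow> 'f^3^3"
  where "M_mat q a b c = vector
    [vector [a, b, c],
     vector [0, qbar q a / a, - qbar q b / a],
     vector [0, 0, 1 / qbar q a]]"

definition M_hat :: "nat \<Rightarrow> 'f::field \<Rightarrow> 'f \<Rightarrow> 'f \<Rightarrow> ('f^3^3) set"
  where "M_hat q a b c = SU3_scalars q #>\<^bsub>SU3 q\<^esub> M_mat q a b c"

definition N_grp :: "nat \<Rightarrow> ('f::field^3^3) set monoid"
  where "N_grp q = (PSU3 q)\<lparr>carrier := {M_hat q a b c | a b c. (a, b, c) \<in> Q_set q}\<rparr>"

text \<open>The group algebra of \<open>G\<close> over \<open>'k\<close> consists of the finitely supported functions on the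
  underlying type of \<open>G\<close> that are supported on the carrier, with convolution as product.\<close>

definition group_algebra :: "('g, 'm) monoid_scheme \<Rightarrow> ('g \<Rightarrow>\<^sub>0 'k::field) ring"
  where "group_algebra G =
    \<lparr>carrier = {f. Poly_Mapping.keys f \<subseteq> carrier G},
     mult = (\<lambda>f g. \<Sum>x\<in>Poly_Mapping.keys f. \<Sum>y\<in>Poly_Mapping.keys g.
       Poly_Mapping.single (x \<otimes>\<^bsub>G\<^esub> y) (Poly_Mapping.lookup f x * Poly_Mapping.lookup g y)),
     one = Poly_Mapping.single \<one>\<^bsub>G\<^esub> 1,
     zero = 0,
     add = (+)\<rparr>"

definition ring_centre :: "'a ring \<Rightarrow> 'a ring"
  where "ring_centre R =
    R\<lparr>carrier := {z \<in> carrier R. \<forall>a\<in>carrier R. z \<otimes>\<^bsub>R\<^esub> a = a \<otimes>\<^bsub>R\<^esub> z}\<rparr>"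

text \<open>The Jacobson radical, for commutative rings.\<close>

definition jacobson_radical :: "('a, 'm) ring_scheme \<Rightarrow> 'a set"
  where "jacobson_radical R = carrier R \<inter> \<Inter>{I. maximalideal I R}"

definition conj_class :: "('g, 'm) monoid_scheme \<Rightarrow> 'g \<Rightarrow> 'g set"
  where "conj_class G g = {x \<otimes>\<^bsub>G\<^esub> g \<otimes>\<^bsub>G\<^esub> inv\<^bsub>G\<^esub> x | x. x \<in> carrier G}"

definition class_sum :: "('g, 'm) monoid_scheme \<Rightarrow> 'g \<Rightarrow> ('g \<Rightarrow>\<^sub>0 'k::field)"
  where "class_sum G g = (\<Sum>h\<in>conj_class G g. Poly_Mapping.single h 1)"

definition ga_scale :: "'k::field \<Rightarrow> ('g \<Rightarrow>\<^sub>0 'k) \<Rightarrow> ('g \<Rightarrow>\<^sub>0 'k)"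
  where "ga_scale c f = Poly_Mapping.map ((*) c) f"

lemma lookup_ga_scale: "Poly_Mapping.lookup (ga_scale c f) x = c * Poly_Mapping.lookup f x"
  by (simp add: ga_scale_def Poly_Mapping.map.rep_eq when_def)

global_interpretation ga: vector_space ga_scale
  by unfold_locales
     (auto intro!: poly_mapping_eqI simp: lookup_ga_scale lookup_add algebra_simps)

definition is_basis_family ::
    "'i set \<Rightarrow> ('i \<Rightarrow> ('g \<Rightarrow>\<^sub>0 'k::field)) \<Rightarrow> ('g \<Rightarrow>\<^sub>0 'k) set \<Rightarrow> bool"
  where "is_basis_family I b V \<longleftrightarrow>
    inj_on b I \<and> \<not> ga.dependent (b ` I) \<and> ga.span (b ` I) = V"

definition ZkN :: "nat \<Rightarrow> (('f::field^3^3) set \<Rightarrow>\<^sub>0 'k::field) ring"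
  where "ZkN q = ring_centre (group_algebra (N_grp q))"

definition D_elt :: "nat \<Rightarrow> 'f::field \<Rightarrow> (('f^3^3) set \<Rightarrow>\<^sub>0 'k::field)"
  where "D_elt q x = class_sum (N_grp q) (M_hat q x 0 0)"

definition T_elt :: "nat \<Rightarrow> 'f::field \<Rightarrow> 'f \<Rightarrow> (('f^3^3) set \<Rightarrow>\<^sub>0 'k::field)"
  where "T_elt q \<omega> x = class_sum (N_grp q) (M_hat q x 0 (x * \<omega>))"

definition U_elt :: "nat \<Rightarrow> 'f::field \<Rightarrow> 'f \<Rightarrow> (('f^3^3) set \<Rightarrow>\<^sub>0 'k::field)"
  where "U_elt q \<tau> y = class_sum (N_grp q) (M_hat q 1 y (y * qbar q y * \<tau>))"

definition Id_elt :: "nat \<Rightarrow> (('f::field^3^3) set \<Rightarrow>\<^sub>0 'k::field)"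
  where "Id_elt q = Poly_Mapping.single \<one>\<^bsub>N_grp q\<^esub> 1"

datatype 'f J_index = D_ix "'f set" | T_ix "'f set" | T1_ix | U_ix "'f set"

definition J_indices :: "nat \<Rightarrow> 'f::field J_index set"
  where "J_indices q =
    D_ix ` (units_mod_Gamma q - {Gamma_set q}) \<union> T_ix ` (Psi_mod_Gamma q - {Gamma_set q}) \<union>
    {T1_ix} \<union> U_ix ` units_mod_L q"

primrec J_family ::
    "nat \<Rightarrow> 'f::field \<Rightarrow> 'f \<Rightarrow> 'f J_index \<Rightarrow> (('f^3^3) set \<Rightarrow>\<^sub>0 'k::field)"
  where
    "J_family q \<omega> \<tau> (D_ix X) = on_coset (D_elt q) X"
  | "J_family q \<omega> \<tau> (T_ix X) = on_coset (T_elt q \<omega>) X"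
  | "J_family q \<omega> \<tau> T1_ix = T_elt q \<omega> 1 + Id_elt q"
  | "J_family q \<omega> \<tau> (U_ix X) = on_coset (U_elt q \<tau>) X"

end

theory Submission
  imports Defs "HOL-Algebra.Subrings" "HOL-Algebra.Elementary_Groups"
    "HOL-Computational_Algebra.Polynomial" "HOL-Number_Theory.Residues"
begin

text \<open>
  The group \<open>N\<close> is \<open>P\<close> extended by a torus, where \<open>P\<close> has order \<open>q\<^sup>3\<close> and its centre \<open>C\<close> has
  order \<open>q\<close>. The elements of \<open>ZkN\<close> are the class functions, and the radical is the hyperplane of
  those with equal values at \<open>Id\<close> and \<open>t\<^sub>1\<close>. It is the sum of the space of \<open>C\<close>-invariant class
  functions, any two of which multiply to zero because \<open>q = 0\<close> in \<open>k\<close>, and of the span of the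
  \<open>D\<^sub>x\<close> with \<open>x \<in> \<Psi> - \<Gamma>\<close>. The class of such a \<open>d\<^sub>x\<close> consists of \<open>q\<^sup>2\<close> elements indexed by the
  field, and a coefficient of \<open>f D\<^sub>x\<close> is a sum over this index. At elements of \<open>P\<close> the sum is
  translation invariant, hence zero; over an element of norm different from one it is constant, hence
  zero; and at \<open>d\<^sub>a\<close> and \<open>t\<^sub>a\<close> with \<open>a \<in> \<Psi> - \<Gamma>\<close> the exceptional indices number \<open>1\<close> and \<open>q + 1\<close>
  (the solutions of a norm equation), so that both coefficients agree. Thus all products lie in the
  span of the \<open>D\<^sub>x + T\<^sub>x = (T\<^sub>1 + Id) D\<^sub>x\<close>, which is annihilated by the radical. So the radical is
  a nilpotent ideal of codimension one.
\<close>

section \<open>Finite fields and group algebras\<close>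

text \<open>The splitting of the radical reflects the list of classes. Over a diagonal entry
  \<open>a\<close> of norm different from one there is a single class; over \<open>a\<close> in
  \<Psi> - \<Gamma> there are two, those of \<open>\<d> a\<close> and \<open>\<t> a\<close>; over
  \<Gamma> there are the identity, the class of \<open>\<t> 1\<close> and the classes of the
  \<open>\<u> y\<close>. Multiplication by a central element of the unipotent part can mix at most
  the classes of \<open>\<d> a\<close> and \<open>\<t> a\<close>. Hence invariance under it means
  equal values at \<open>\<d> a\<close> and \<open>\<t> a\<close> for all \<open>a\<close> in
  \<Psi>, and an element of the radical misses this only by a combination of the \<open>D_x\<close>
  with \<open>x\<close> in \<Psi> - \<Gamma>. These are not invariant, so their products have to be
  computed coefficient by coefficient. \<open>T_1 + Id\<close> is the sum of all central elements of
  the unipotent part, which is why it spreads \<open>D_x\<close> over the class of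
  \<open>\<t> x\<close> as well. All subspaces are cut out by linear conditions on coefficients at
  class representatives, so bases and dimensions can be read off by evaluating at these
  points.\<close>

lemma finite_field_power_units:
  fixes x :: "'f::field"
  assumes fin: "finite (UNIV :: 'f set)" and x: "x \<noteq> 0"
  shows "x ^ (CARD('f) - 1) = 1"
proof -
  have "(\<Prod>y\<in>UNIV-{0}. y) = (\<Prod>y\<in>UNIV-{0}. x * y)"
    by (rule prod.reindex_bij_witness[of _ "\<lambda>y. x * y" "\<lambda>y. y / x"]) (use x in auto)
  also have "\<dots> = x ^ (CARD('f) - 1) * (\<Prod>y\<in>UNIV-{0}. y)"
    using fin by (simp add: prod.distrib)
  finally show ?thesis
    using fin by (simp add: prod_zero_iff)
qed

lemma card_nth_roots_le:
  fixes y :: "'f::field"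
  assumes "n > 0"
  shows "card {x. x ^ n = y} \<le> n"
proof -
  let ?P = "Polynomial.monom 1 n - Polynomial.monom y 0"
  have d: "degree ?P = n"
    using assms by (simp add: diff_conv_add_uminus monom_0 degree_add_eq_left degree_monom_eq del: add_uminus_conv_diff)
  hence "?P \<noteq> 0"
    using assms by (metis degree_0 less_irrefl)
  from card_poly_roots_bound[OF this] show ?thesis
    unfolding d by (simp add: poly_monom)
qed

text \<open>A counting argument in place of cyclicity of the unit group: the map to the
  \<open>n\<close>-th power distributes the \<open>n * m\<close> units over at most \<open>m\<close>
  values, with at most \<open>n\<close> units over each. The total is reached only if every fibre is
  full.\<close>

lemma card_power_fibre:
  fixes y :: "'f::field"
  assumes nm: "n * m = CARD('f) - 1" "CARD('f) > 1" and y: "y ^ m = 1"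
  shows "card {x. x ^ n = y} = n"
proof -
  have fin: "finite (UNIV :: 'f set)"
    using nm(2) card.infinite by fastforce
  have finS: "finite S" for S :: "'f set"
    using fin by (rule finite_subset[rotated]) auto
  have pos: "n > 0" "m > 0"
    using nm by (auto intro!: Nat.gr0I)
  let ?Y = "{y::'f. y ^ m = 1}"
  have "(\<Sum>y\<in>?Y. card {x. x ^ n = y}) = card (\<Union>y\<in>?Y. {x. x ^ n = y})"
    by (rule card_UN_disjoint[symmetric]) (auto intro: finS)
  also have "(\<Union>y\<in>?Y. {x. x ^ n = y}) = {x. x ^ (n * m) = 1}"
    by (auto simp: power_mult)
  also have "\<dots> = UNIV - {0}"
    using finite_field_power_units[OF fin] pos by (auto simp: power_0_left) (simp add: nm(1))
  also have "card \<dots> = n * m"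
    using fin by (simp add: nm(1))
  finally have s: "(\<Sum>y\<in>?Y. card {x. x ^ n = y}) = n * m" .
  show ?thesis
  proof (rule ccontr)
    assume "card {x. x ^ n = y} \<noteq> n"
    hence "card {x. x ^ n = y} < n"
      using card_nth_roots_le[OF pos(1), of y] by simp
    hence "(\<Sum>y\<in>?Y. card {x. x ^ n = y}) < (\<Sum>y\<in>?Y. n)"
      using y by (intro sum_strict_mono_ex1 finS) (auto intro: card_nth_roots_le pos)
    also have "\<dots> \<le> m * n"
      using card_nth_roots_le[OF pos(2), of "1::'f"] by simp
    finally show False
      using s by (simp add: mult.commute)
  qed
qed

text \<open>\<open>f\<close> is constant on the right cosets of the subgroup generated by
  \<open>z\<close>. This has order \<open>p\<close>, so each coset contributes \<open>p\<close>
  equal terms. Applied below to the additive group of the field and to \<open>N\<close>.\<close>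

lemma (in group) sum_left_invariant_eq_0:
  fixes f :: "'a \<Rightarrow> 'k::field"
  assumes fin: "finite (carrier G)" and z: "z \<in> carrier G" "z \<noteq> \<one>" "z [^] (p::nat) = \<one>"
    and p: "prime p" "CHAR('k) = p"
    and inv: "\<And>x. x \<in> carrier G \<Longrightarrow> f (z \<otimes> x) = f x"
  shows "(\<Sum>x\<in>carrier G. f x) = 0"
proof -
  let ?C = "generate G {z}"
  have sub: "subgroup ?C G"
    using z by (intro generate_is_subgroup) auto
  have "ord z dvd p"
    using z pow_eq_id by blast
  hence "ord z = p"
    using p(1) z ord_eq_1 by (metis prime_nat_iff)
  hence card: "card ?C = p"
    using generate_pow_card z(1) by metis
  have invC: "f (c \<otimes> x) = f x" if "c \<in> ?C" "x \<in> carrier G" for c x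
    using that
  proof (induction arbitrary: x rule: generate.induct)
    case (inv h)
    \<comment> \<open>The invariance is read backwards, at the point
      \<open>inv z \<otimes> x\<close>.\<close>
    hence "f (inv z \<otimes> x) = f (z \<otimes> (inv z \<otimes> x))"
      using z by (intro assms(7)[symmetric]) auto
    thus ?case using inv z by (simp add: m_assoc[symmetric])
  next
    case (eng h1 h2)
    have "h1 \<in> carrier G" "h2 \<in> carrier G"
      using eng.hyps sub subgroup.subset by blast+
    thus ?case using eng by (simp add: m_assoc)
  qed (use inv in auto)
  have "(\<Sum>x\<in>carrier G. f x) = (\<Sum>x\<in>\<Union>(rcosets ?C). f x)"
    using rcosets_part_G[OF sub] by simp
  also have "\<dots> = (\<Sum>R\<in>rcosets ?C. \<Sum>x\<in>R. f x)"
  proof (rule sum.Union_disjoint[unfolded comp_def])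
    show "\<forall>R\<in>rcosets ?C. finite R"
      using rcosets_subset_PowG[OF sub] fin finite_subset by blast
    show "\<forall>A\<in>rcosets ?C. \<forall>B\<in>rcosets ?C. A \<noteq> B \<longrightarrow> A \<inter> B = {}"
      using rcos_disjoint[OF sub] by (auto simp: pairwise_def disjnt_def)
  qed
  also have "\<dots> = 0"
  proof (rule sum.neutral, safe)
    fix R assume R: "R \<in> rcosets ?C"
    then obtain a where a: "a \<in> carrier G" "R = ?C #> a"
      by (auto simp: RCOSETS_def)
    have "(\<Sum>x\<in>R. f x) = (\<Sum>x\<in>R. f a)"
      using a invC by (intro sum.cong) (auto simp: r_coset_def)
    also have "\<dots> = of_nat p * f a"
      using card_rcosets_equal[OF R subgroup.subset[OF sub]] card by simp
    also have "\<dots> = 0"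
      using p(2) of_nat_CHAR[where 'a='k] by simp
    finally show "(\<Sum>x\<in>R. f x) = 0" .
  qed
  finally show ?thesis .
qed

lemma sum_translation_invariant_eq_0:
  fixes f :: "'f::field \<Rightarrow> 'k::field"
  assumes "finite (UNIV :: 'f set)" "CHAR('f) = p" "CHAR('k) = p" "prime p" "c \<noteq> 0"
    and inv: "\<And>x. f (c + x) = f x"
  shows "(\<Sum>x\<in>UNIV. f x) = 0"
proof -
  let ?A = "\<lparr>carrier = UNIV, mult = (+), one = 0\<rparr> :: 'f monoid"
  interpret A: group ?A
    by (rule groupI) (auto simp: algebra_simps intro: exI[of _ "- x" for x])
  have "c [^]\<^bsub>?A\<^esub> n = of_nat n * c" for n :: nat
    by (induction n) (simp_all add: algebra_simps)
  hence "c [^]\<^bsub>?A\<^esub> p = 0"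
    using assms(2) of_nat_CHAR[where 'a='f] by simp
  thus ?thesis
    using A.sum_left_invariant_eq_0[of c p f] assms by simp
qed

text \<open>The points \<open>e j\<close> act as coordinate functionals: \<open>dual\<close> makes
  the family independent, and \<open>sep\<close> says that an element of \<open>V\<close> is
  determined by its coordinates.\<close>

lemma is_basis_family_dualI:
  fixes V :: "('g \<Rightarrow>\<^sub>0 'k::field) set"
  assumes I: "finite I" and V: "ga.subspace V" and b: "\<And>i. i \<in> I \<Longrightarrow> b i \<in> V"
    and dual: "\<And>i j. i \<in> I \<Longrightarrow> j \<in> I \<Longrightarrow>
      Poly_Mapping.lookup (b i) (e j) = (if i = j then 1 else 0)"
    and sep: "\<And>f. f \<in> V \<Longrightarrow> (\<And>j. j \<in> I \<Longrightarrow> Poly_Mapping.lookup f (e j) = 0) \<Longrightarrow> f = 0"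
  shows "is_basis_family I b V" "ga.dim V = card I"
proof -
  have inj: "inj_on b I"
    by (rule inj_onI) (metis dual zero_neq_one)
  have val: "Poly_Mapping.lookup (\<Sum>i\<in>I. ga_scale (u i) (b i)) (e j) = u j" if "j \<in> I" for u j
  proof -
    have "Poly_Mapping.lookup (\<Sum>i\<in>I. ga_scale (u i) (b i)) (e j) = (\<Sum>i\<in>I. if i = j then u i else 0)"
      using that by (auto simp: lookup_sum lookup_ga_scale dual intro!: sum.cong)
    thus ?thesis using I that by simp
  qed
  have indep: "\<not> ga.dependent (b ` I)"
  proof
    assume "ga.dependent (b ` I)"
    then obtain u i where u: "i \<in> I" "u (b i) \<noteq> 0" "(\<Sum>v\<in>b ` I. ga_scale (u v) v) = 0"
      using I by (auto simp: ga.dependent_finite)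
    have "(\<Sum>i\<in>I. ga_scale (u (b i)) (b i)) = 0"
      using u(3) inj by (simp add: sum.reindex)
    with val[OF u(1), of "\<lambda>i. u (b i)"] u(2) show False by simp
  qed
  have span: "ga.span (b ` I) = V"
  proof
    show "ga.span (b ` I) \<subseteq> V"
      using b V by (intro ga.span_minimal) auto
    show "V \<subseteq> ga.span (b ` I)"
    proof
      fix f assume f: "f \<in> V"
      \<comment> \<open>\<open>g\<close> interpolates \<open>f\<close> at all the points
        \<open>e i\<close>, so \<open>sep\<close> applies to \<open>f - g\<close>.\<close>
      define g where "g = (\<Sum>i\<in>I. ga_scale (Poly_Mapping.lookup f (e i)) (b i))"
      have gs: "g \<in> ga.span (b ` I)"
        unfolding g_def by (intro ga.span_sum ga.span_scale ga.span_base) auto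
      have "g \<in> V"
        unfolding g_def using b V by (intro ga.subspace_sum ga.subspace_scale) auto
      hence "f - g = 0"
        using V f by (intro sep ga.subspace_diff) (auto simp: lookup_minus g_def val)
      thus "f \<in> ga.span (b ` I)" using gs by simp
    qed
  qed
  show "is_basis_family I b V"
    using inj indep span by (simp add: is_basis_family_def)
  show "ga.dim V = card I"
    using ga.dim_eq_card_independent[OF indep] span card_image[OF inj] by (metis ga.dim_span)
qed

section \<open>Convolution, centre and class sums in the group algebra of a finite group\<close>

lemma carrier_group_algebra: "f \<in> carrier (group_algebra G) \<longleftrightarrow> Poly_Mapping.keys f \<subseteq> carrier G"
  by (simp add: group_algebra_def)

lemma lookup_group_algebra_outside:
  "f \<in> carrier (group_algebra G) \<Longrightarrow> x \<notin> carrier G \<Longrightarrow> Poly_Mapping.lookup f x = 0"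
  by (auto simp: carrier_group_algebra in_keys_iff)

lemma add_group_algebra [simp]: "f \<oplus>\<^bsub>group_algebra G\<^esub> g = f + g"
  by (simp add: group_algebra_def)

lemma zero_group_algebra [simp]: "\<zero>\<^bsub>group_algebra G\<^esub> = 0"
  by (simp add: group_algebra_def)

lemma one_group_algebra: "\<one>\<^bsub>group_algebra G\<^esub> = Poly_Mapping.single \<one>\<^bsub>G\<^esub> 1"
  by (simp add: group_algebra_def)

context
  fixes G :: "('g, 'm) monoid_scheme" (structure)
  assumes G: "group G" and fin: "finite (carrier G)"
begin

interpretation group G by (fact G)

text \<open>The double sum over the supports is extended by zeros to the finite carrier, and the
  second factor is then solved for. All later coefficients of products are computed in this
  form.\<close>

lemma lookup_group_algebra_mult:
  fixes f g :: "'g \<Rightarrow>\<^sub>0 'k::field"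
  assumes f: "f \<in> carrier (group_algebra G)" and g: "g \<in> carrier (group_algebra G)"
  shows "Poly_Mapping.lookup (f \<otimes>\<^bsub>group_algebra G\<^esub> g) z =
    (if z \<in> carrier G then \<Sum>x\<in>carrier G. Poly_Mapping.lookup f x * Poly_Mapping.lookup g (inv x \<otimes> z) else 0)"
proof -
  have "Poly_Mapping.lookup (f \<otimes>\<^bsub>group_algebra G\<^esub> g) z =
    (\<Sum>x\<in>Poly_Mapping.keys f. \<Sum>y\<in>Poly_Mapping.keys g.
       if x \<otimes> y = z then Poly_Mapping.lookup f x * Poly_Mapping.lookup g y else 0)"
    by (simp add: group_algebra_def lookup_sum lookup_single when_def)
  also have "\<dots> = (\<Sum>x\<in>Poly_Mapping.keys f. \<Sum>y\<in>carrier G.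
       if x \<otimes> y = z then Poly_Mapping.lookup f x * Poly_Mapping.lookup g y else 0)"
    using fin g by (intro sum.cong refl sum.mono_neutral_left) (auto simp: carrier_group_algebra in_keys_iff)
  also have "\<dots> = (\<Sum>x\<in>carrier G. \<Sum>y\<in>carrier G.
       if x \<otimes> y = z then Poly_Mapping.lookup f x * Poly_Mapping.lookup g y else 0)"
    using fin f by (intro sum.mono_neutral_left) (auto simp: carrier_group_algebra in_keys_iff intro!: sum.neutral)
  also have "\<dots> = (\<Sum>x\<in>carrier G. if z \<in> carrier G then Poly_Mapping.lookup f x * Poly_Mapping.lookup g (inv x \<otimes> z) else 0)"
  proof (rule sum.cong[OF refl])
    fix x assume x: "x \<in> carrier G"
    show "(\<Sum>y\<in>carrier G. if x \<otimes> y = z then Poly_Mapping.lookup f x * Poly_Mapping.lookup g y else 0) =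
      (if z \<in> carrier G then Poly_Mapping.lookup f x * Poly_Mapping.lookup g (inv x \<otimes> z) else 0)"
    proof (cases "z \<in> carrier G")
      case True
      have "(\<Sum>y\<in>carrier G. if x \<otimes> y = z then Poly_Mapping.lookup f x * Poly_Mapping.lookup g y else 0) =
        (\<Sum>y\<in>carrier G. if y = inv x \<otimes> z then Poly_Mapping.lookup f x * Poly_Mapping.lookup g y else 0)"
        using x True by (intro sum.cong refl if_cong) (auto simp: m_assoc[symmetric] inv_solve_left)
      thus ?thesis using fin x True by simp
    next
      case False
      thus ?thesis using x by (auto intro!: sum.neutral)
    qed
  qed
  finally show ?thesis by (simp split: if_splits)
qed

lemma group_algebra_mult_closed:
  fixes f g :: "'g \<Rightarrow>\<^sub>0 'k::field"
  assumes "f \<in> carrier (group_algebra G)" and "g \<in> carrier (group_algebra G)"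
  shows "f \<otimes>\<^bsub>group_algebra G\<^esub> g \<in> carrier (group_algebra G)"
  unfolding carrier_group_algebra
  using lookup_group_algebra_mult[OF assms] by (auto simp: in_keys_iff split: if_splits)

lemma sum_left_translate:
  assumes "x \<in> carrier G"
  shows "(\<Sum>y\<in>carrier G. h (inv x \<otimes> y)) = (\<Sum>y\<in>carrier G. h y)"
  by (rule sum.reindex_bij_witness[of _ "\<lambda>y. x \<otimes> y" "\<lambda>y. inv x \<otimes> y"])
     (use assms in \<open>auto simp: m_assoc[symmetric]\<close>)

lemma group_algebra_mult_assoc:
  fixes f g h :: "'g \<Rightarrow>\<^sub>0 'k::field"
  assumes f: "f \<in> carrier (group_algebra G)" and g: "g \<in> carrier (group_algebra G)"
    and h: "h \<in> carrier (group_algebra G)"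
  shows "(f \<otimes>\<^bsub>group_algebra G\<^esub> g) \<otimes>\<^bsub>group_algebra G\<^esub> h = f \<otimes>\<^bsub>group_algebra G\<^esub> (g \<otimes>\<^bsub>group_algebra G\<^esub> h)"
proof (rule poly_mapping_eqI)
  fix z
  let ?L = "Poly_Mapping.lookup"
  note m = lookup_group_algebra_mult group_algebra_mult_closed assms
  show "?L ((f \<otimes>\<^bsub>group_algebra G\<^esub> g) \<otimes>\<^bsub>group_algebra G\<^esub> h) z = ?L (f \<otimes>\<^bsub>group_algebra G\<^esub> (g \<otimes>\<^bsub>group_algebra G\<^esub> h)) z"
  proof (cases "z \<in> carrier G")
    case z: True
    have "?L ((f \<otimes>\<^bsub>group_algebra G\<^esub> g) \<otimes>\<^bsub>group_algebra G\<^esub> h) z =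
      (\<Sum>y\<in>carrier G. \<Sum>x\<in>carrier G. ?L f x * ?L g (inv x \<otimes> y) * ?L h (inv y \<otimes> z))"
      using z by (simp add: m sum_distrib_right)
    also have "\<dots> = (\<Sum>x\<in>carrier G. \<Sum>y\<in>carrier G. ?L f x * ?L g (inv x \<otimes> y) * ?L h (inv y \<otimes> z))"
      by (rule sum.swap)
    also have "\<dots> = (\<Sum>x\<in>carrier G. \<Sum>y\<in>carrier G. ?L f x * (?L g y * ?L h (inv y \<otimes> (inv x \<otimes> z))))"
    proof (rule sum.cong[OF refl])
      fix x assume x: "x \<in> carrier G"
      have "(\<Sum>y\<in>carrier G. ?L f x * ?L g (inv x \<otimes> y) * ?L h (inv y \<otimes> z)) =
        (\<Sum>y\<in>carrier G. ?L f x * (?L g (inv x \<otimes> y) * ?L h (inv (inv x \<otimes> y) \<otimes> (inv x \<otimes> z))))"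
      proof (rule sum.cong[OF refl])
        fix y assume y: "y \<in> carrier G"
        \<comment> \<open>The inner sum is prepared for the substitution of
          \<open>inv x \<otimes> y\<close> for \<open>y\<close>, so the last argument has to be
          written in terms of the new variable.\<close>
        have "inv (inv x \<otimes> y) \<otimes> (inv x \<otimes> z) = inv y \<otimes> (x \<otimes> inv x) \<otimes> z"
          using x y z by (simp add: inv_mult_group m_assoc del: r_inv Units_r_inv)
        thus "?L f x * ?L g (inv x \<otimes> y) * ?L h (inv y \<otimes> z) =
          ?L f x * (?L g (inv x \<otimes> y) * ?L h (inv (inv x \<otimes> y) \<otimes> (inv x \<otimes> z)))"
          using x y z by (simp add: mult.assoc)
      qed
      also have "\<dots> = (\<Sum>y\<in>carrier G. ?L f x * (?L g y * ?L h (inv y \<otimes> (inv x \<otimes> z))))"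
        by (rule sum_left_translate[OF x])
      finally show "(\<Sum>y\<in>carrier G. ?L f x * ?L g (inv x \<otimes> y) * ?L h (inv y \<otimes> z)) =
        (\<Sum>y\<in>carrier G. ?L f x * (?L g y * ?L h (inv y \<otimes> (inv x \<otimes> z))))" .
    qed
    also have "\<dots> = ?L (f \<otimes>\<^bsub>group_algebra G\<^esub> (g \<otimes>\<^bsub>group_algebra G\<^esub> h)) z"
      using z by (simp add: m sum_distrib_left)
    finally show ?thesis .
  qed (simp add: m)
qed

lemma group_algebra_one_closed: "\<one>\<^bsub>group_algebra G\<^esub> \<in> carrier (group_algebra G)"
  by (auto simp: one_group_algebra carrier_group_algebra)

lemma group_algebra_single_mult:
  fixes f :: "'g \<Rightarrow>\<^sub>0 'k::field"
  assumes x: "x \<in> carrier G" and f: "f \<in> carrier (group_algebra G)" and z: "z \<in> carrier G"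
  shows "Poly_Mapping.lookup (Poly_Mapping.single x c \<otimes>\<^bsub>group_algebra G\<^esub> f) z
      = c * Poly_Mapping.lookup f (inv x \<otimes> z)"
    and "Poly_Mapping.lookup (f \<otimes>\<^bsub>group_algebra G\<^esub> Poly_Mapping.single x c) z
      = Poly_Mapping.lookup f (z \<otimes> inv x) * c"
proof -
  have s: "Poly_Mapping.single x c \<in> carrier (group_algebra G)"
    using x by (auto simp: carrier_group_algebra)
  show "Poly_Mapping.lookup (Poly_Mapping.single x c \<otimes>\<^bsub>group_algebra G\<^esub> f) z
      = c * Poly_Mapping.lookup f (inv x \<otimes> z)"
    using fin x z by (simp add: lookup_group_algebra_mult[OF s f] lookup_single when_def
        if_distrib[of "\<lambda>u. u * _"] cong: if_cong)
  have "(\<Sum>y\<in>carrier G. Poly_Mapping.lookup f y * Poly_Mapping.lookup (Poly_Mapping.single x c) (inv y \<otimes> z)) =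
      (\<Sum>y\<in>carrier G. if y = z \<otimes> inv x then Poly_Mapping.lookup f y * c else 0)"
  proof (rule sum.cong[OF refl])
    fix y assume y: "y \<in> carrier G"
    have "x = inv y \<otimes> z \<longleftrightarrow> y = z \<otimes> inv x"
      using x y z by (metis inv_closed inv_solve_left inv_solve_right m_closed)
    thus "Poly_Mapping.lookup f y * Poly_Mapping.lookup (Poly_Mapping.single x c) (inv y \<otimes> z) =
      (if y = z \<otimes> inv x then Poly_Mapping.lookup f y * c else 0)"
      by (auto simp: lookup_single when_def)
  qed
  thus "Poly_Mapping.lookup (f \<otimes>\<^bsub>group_algebra G\<^esub> Poly_Mapping.single x c) z
      = Poly_Mapping.lookup f (z \<otimes> inv x) * c"
    using fin x z by (simp add: lookup_group_algebra_mult[OF f s])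
qed

lemma ring_group_algebra: "ring (group_algebra G :: ('g \<Rightarrow>\<^sub>0 'k::field) ring)"
proof -
  let ?R = "group_algebra G :: ('g \<Rightarrow>\<^sub>0 'k) ring"
  have add_closed: "f + g \<in> carrier ?R" if "f \<in> carrier ?R" "g \<in> carrier ?R" for f g
    using that Poly_Mapping.keys_add[of f g] by (auto simp: carrier_group_algebra)
  note m = lookup_group_algebra_mult add_closed group_algebra_mult_closed
  show ?thesis
  proof (rule ringI)
    show "abelian_group ?R"
    proof (rule abelian_groupI)
      fix f assume "f \<in> carrier ?R"
      thus "\<exists>g\<in>carrier ?R. g \<oplus>\<^bsub>?R\<^esub> f = \<zero>\<^bsub>?R\<^esub>"
        by (intro bexI[of _ "- f"]) (auto simp: carrier_group_algebra in_keys_iff)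
    qed (auto simp: add_closed add_ac, auto simp: carrier_group_algebra)
    show "monoid ?R"
    proof (rule monoidI)
      fix f assume f: "f \<in> carrier ?R"
      note o = lookup_group_algebra_outside[OF group_algebra_mult_closed] group_algebra_one_closed
      show "\<one>\<^bsub>?R\<^esub> \<otimes>\<^bsub>?R\<^esub> f = f"
      proof (rule poly_mapping_eqI)
        fix z show "Poly_Mapping.lookup (\<one>\<^bsub>?R\<^esub> \<otimes>\<^bsub>?R\<^esub> f) z = Poly_Mapping.lookup f z"
          by (cases "z \<in> carrier G")
            (use f in \<open>simp_all add: o lookup_group_algebra_outside[OF f], simp_all add: one_group_algebra group_algebra_single_mult\<close>)
      qed
      show "f \<otimes>\<^bsub>?R\<^esub> \<one>\<^bsub>?R\<^esub> = f"
      proof (rule poly_mapping_eqI)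
        fix z show "Poly_Mapping.lookup (f \<otimes>\<^bsub>?R\<^esub> \<one>\<^bsub>?R\<^esub>) z = Poly_Mapping.lookup f z"
          by (cases "z \<in> carrier G")
            (use f in \<open>simp_all add: o lookup_group_algebra_outside[OF f], simp_all add: one_group_algebra group_algebra_single_mult\<close>)
      qed
    qed (auto simp: group_algebra_mult_closed group_algebra_one_closed group_algebra_mult_assoc)
  qed (auto intro!: poly_mapping_eqI simp: m lookup_add sum.distrib algebra_simps)
qed

lemma ga_scale_mult:
  fixes f g :: "'g \<Rightarrow>\<^sub>0 'k::field"
  assumes f: "f \<in> carrier (group_algebra G)" and g: "g \<in> carrier (group_algebra G)"
  shows "ga_scale c f \<in> carrier (group_algebra G)"
    and "ga_scale c f \<otimes>\<^bsub>group_algebra G\<^esub> g = ga_scale c (f \<otimes>\<^bsub>group_algebra G\<^esub> g)"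
    and "f \<otimes>\<^bsub>group_algebra G\<^esub> ga_scale c g = ga_scale c (f \<otimes>\<^bsub>group_algebra G\<^esub> g)"
proof -
  have s: "ga_scale c h \<in> carrier (group_algebra G)" if "h \<in> carrier (group_algebra G)" for h :: "'g \<Rightarrow>\<^sub>0 'k"
    using that by (auto simp: carrier_group_algebra in_keys_iff lookup_ga_scale)
  show "ga_scale c f \<in> carrier (group_algebra G)" using s f .
  show "ga_scale c f \<otimes>\<^bsub>group_algebra G\<^esub> g = ga_scale c (f \<otimes>\<^bsub>group_algebra G\<^esub> g)"
    and "f \<otimes>\<^bsub>group_algebra G\<^esub> ga_scale c g = ga_scale c (f \<otimes>\<^bsub>group_algebra G\<^esub> g)"
    using f g by (auto intro!: poly_mapping_eqI simp: s lookup_ga_scale lookup_group_algebra_mult sum_distrib_left mult_ac)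
qed

text \<open>Centrality is tested on single group elements: comparing the coefficients of
  \<open>f\<close> times \<open>x\<close> and \<open>x\<close> times \<open>f\<close> at
  \<open>x \<otimes> y\<close> gives invariance under conjugation by \<open>x\<close>.\<close>

lemma centre_group_algebra_iff:
  fixes f :: "'g \<Rightarrow>\<^sub>0 'k::field"
  shows "f \<in> carrier (ring_centre (group_algebra G)) \<longleftrightarrow>
    f \<in> carrier (group_algebra G) \<and>
    (\<forall>x\<in>carrier G. \<forall>y\<in>carrier G. Poly_Mapping.lookup f (x \<otimes> y \<otimes> inv x) = Poly_Mapping.lookup f y)"
    (is "?L \<longleftrightarrow> ?C \<and> ?R")
proof
  assume L: ?L
  hence f: ?C by (simp add: ring_centre_def)
  moreover have ?R
  proof (intro ballI)
    fix x y assume x: "x \<in> carrier G" and y: "y \<in> carrier G"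
    let ?s = "Poly_Mapping.single x (1::'k)"
    have "?s \<in> carrier (group_algebra G)"
      using x by (auto simp: carrier_group_algebra)
    hence "f \<otimes>\<^bsub>group_algebra G\<^esub> ?s = ?s \<otimes>\<^bsub>group_algebra G\<^esub> f"
      using L by (simp add: ring_centre_def)
    from arg_cong[OF this, of "\<lambda>h. Poly_Mapping.lookup h (x \<otimes> y)"]
    show "Poly_Mapping.lookup f (x \<otimes> y \<otimes> inv x) = Poly_Mapping.lookup f y"
      using x y f by (simp add: group_algebra_single_mult m_assoc[symmetric])
  qed
  ultimately show "?C \<and> ?R" by blast
next
  assume R: "?C \<and> ?R"
  have "f \<otimes>\<^bsub>group_algebra G\<^esub> g = g \<otimes>\<^bsub>group_algebra G\<^esub> f" if g: "g \<in> carrier (group_algebra G)" for g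
  proof (rule poly_mapping_eqI)
    fix z
    show "Poly_Mapping.lookup (f \<otimes>\<^bsub>group_algebra G\<^esub> g) z = Poly_Mapping.lookup (g \<otimes>\<^bsub>group_algebra G\<^esub> f) z"
    proof (cases "z \<in> carrier G")
      case z: True
      have "(\<Sum>x\<in>carrier G. Poly_Mapping.lookup f x * Poly_Mapping.lookup g (inv x \<otimes> z)) =
        (\<Sum>y\<in>carrier G. Poly_Mapping.lookup g y * Poly_Mapping.lookup f (inv y \<otimes> z))"
      \<comment> \<open>Put \<open>y = inv x \<otimes> z\<close>. Then
        \<open>x = z \<otimes> inv y\<close>, which is conjugate under \<open>z\<close> to
        \<open>inv y \<otimes> z\<close>, so a class function takes the same value at both.\<close>
      proof (rule sum.reindex_bij_witness[of _ "\<lambda>y. z \<otimes> inv y" "\<lambda>x. inv x \<otimes> z"])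
        fix x assume x: "x \<in> carrier G"
        have "Poly_Mapping.lookup f (inv (inv x \<otimes> z) \<otimes> z) = Poly_Mapping.lookup f (z \<otimes> (inv (inv x \<otimes> z) \<otimes> z) \<otimes> inv z)"
          using R x z by (metis inv_closed m_closed)
        also have "z \<otimes> (inv (inv x \<otimes> z) \<otimes> z) \<otimes> inv z = x"
          using x z by (simp add: inv_mult_group m_assoc) (simp add: m_assoc[symmetric])
        finally show "Poly_Mapping.lookup g (inv x \<otimes> z) * Poly_Mapping.lookup f (inv (inv x \<otimes> z) \<otimes> z) =
          Poly_Mapping.lookup f x * Poly_Mapping.lookup g (inv x \<otimes> z)"
          by simp
      qed (use z in \<open>auto simp: inv_mult_group m_assoc, auto simp: m_assoc[symmetric]\<close>)
      thus ?thesis using R g z by (simp add: lookup_group_algebra_mult)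
    qed (use R g in \<open>simp add: lookup_group_algebra_mult\<close>)
  qed
  thus ?L using R by (simp add: ring_centre_def)
qed

lemma conj_class_sym:
  assumes "g \<in> carrier G" "h \<in> conj_class G g"
  shows "g \<in> conj_class G h"
proof -
  obtain x where x: "x \<in> carrier G" "h = x \<otimes> g \<otimes> inv x"
    using assms(2) by (auto simp: conj_class_def)
  hence "g = inv x \<otimes> h \<otimes> inv (inv x)"
    using assms(1) by (simp add: m_assoc) (simp add: m_assoc[symmetric])
  thus ?thesis
    unfolding conj_class_def using inv_closed[OF x(1)] by blast
qed

lemma conj_class_self: "g \<in> carrier G \<Longrightarrow> g \<in> conj_class G g"
  by (auto simp: conj_class_def intro!: exI[of _ \<one>])

lemma conj_class_subset: "g \<in> carrier G \<Longrightarrow> conj_class G g \<subseteq> carrier G"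
  by (auto simp: conj_class_def)

lemma conj_class_conj:
  assumes g: "g \<in> carrier G" and x: "x \<in> carrier G" and h: "h \<in> carrier G"
  shows "x \<otimes> h \<otimes> inv x \<in> conj_class G g \<longleftrightarrow> h \<in> conj_class G g"
proof
  assume "x \<otimes> h \<otimes> inv x \<in> conj_class G g"
  then obtain y where y: "y \<in> carrier G" "x \<otimes> h \<otimes> inv x = y \<otimes> g \<otimes> inv y"
    by (auto simp: conj_class_def)
  have "h = inv x \<otimes> (x \<otimes> h \<otimes> inv x) \<otimes> x"
    using x h by (simp add: m_assoc) (simp add: m_assoc[symmetric])
  also have "\<dots> = (inv x \<otimes> y) \<otimes> g \<otimes> inv (inv x \<otimes> y)"
    unfolding y(2) using x y(1) g by (simp add: m_assoc inv_mult_group)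
  finally show "h \<in> conj_class G g"
    using x y(1) by (auto simp: conj_class_def)
next
  assume "h \<in> conj_class G g"
  then obtain y where y: "y \<in> carrier G" "h = y \<otimes> g \<otimes> inv y"
    by (auto simp: conj_class_def)
  have "x \<otimes> h \<otimes> inv x = (x \<otimes> y) \<otimes> g \<otimes> inv (x \<otimes> y)"
    unfolding y(2) using x y(1) g by (simp add: m_assoc inv_mult_group)
  thus "x \<otimes> h \<otimes> inv x \<in> conj_class G g"
    using x y(1) by (auto simp: conj_class_def)
qed

lemma lookup_class_sum:
  assumes "g \<in> carrier G"
  shows "Poly_Mapping.lookup (class_sum G g :: 'g \<Rightarrow>\<^sub>0 'k::field) h = (if h \<in> conj_class G g then 1 else 0)"
proof -
  have "finite (conj_class G g)"
    using conj_class_subset[OF assms] fin finite_subset by blast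
  thus ?thesis
    by (simp add: class_sum_def lookup_sum lookup_single when_def)
qed

lemma class_sum_centre:
  assumes "g \<in> carrier G"
  shows "(class_sum G g :: 'g \<Rightarrow>\<^sub>0 'k::field) \<in> carrier (ring_centre (group_algebra G))"
  unfolding centre_group_algebra_iff carrier_group_algebra
  using conj_class_subset[OF assms] conj_class_conj[OF assms]
  by (auto simp: lookup_class_sum[OF assms] in_keys_iff split: if_splits)

end

lemma cring_ring_centre:
  fixes R :: "'a ring" (structure)
  assumes "ring R"
  shows "cring (ring_centre R)"
proof -
  interpret ring R by fact
  let ?C = "carrier (ring_centre R)"
  have "subring ?C R"
  proof (rule subringI)
    fix h assume h: "h \<in> ?C"
    thus "\<ominus> h \<in> ?C" by (auto simp: ring_centre_def l_minus r_minus)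
  next
    fix h1 h2 assume h: "h1 \<in> ?C" "h2 \<in> ?C"
    have c: "h1 \<in> carrier R" "h2 \<in> carrier R"
      and comm: "\<And>a. a \<in> carrier R \<Longrightarrow> h1 \<otimes> a = a \<otimes> h1" "\<And>a. a \<in> carrier R \<Longrightarrow> h2 \<otimes> a = a \<otimes> h2"
      using h by (auto simp: ring_centre_def)
    have "h1 \<otimes> h2 \<otimes> a = a \<otimes> (h1 \<otimes> h2)" if a: "a \<in> carrier R" for a
    proof -
      have "h1 \<otimes> h2 \<otimes> a = h1 \<otimes> (a \<otimes> h2)"
        using c a comm(2)[OF a] by (simp add: m_assoc)
      also have "\<dots> = (h1 \<otimes> a) \<otimes> h2"
        using c a by (simp add: m_assoc)
      also have "\<dots> = a \<otimes> (h1 \<otimes> h2)"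
        unfolding comm(1)[OF a] using c a by (simp add: m_assoc)
      finally show ?thesis .
    qed
    thus "h1 \<otimes> h2 \<in> ?C"
      using c by (simp add: ring_centre_def)
    have "(h1 \<oplus> h2) \<otimes> a = a \<otimes> (h1 \<oplus> h2)" if a: "a \<in> carrier R" for a
      unfolding l_distr[OF c a] r_distr[OF c a] comm[OF a] ..
    thus "h1 \<oplus> h2 \<in> ?C"
      using c by (simp add: ring_centre_def)
  qed (auto simp: ring_centre_def)
  moreover have "h1 \<otimes> h2 = h2 \<otimes> h1" if "h1 \<in> ?C" "h2 \<in> ?C" for h1 h2
  proof -
    have "h2 \<in> carrier R" "\<forall>a\<in>carrier R. h1 \<otimes> a = a \<otimes> h1"
      using that by (simp_all add: ring_centre_def)
    thus ?thesis by blast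
  qed
  ultimately have "subcring ?C R"
    by (rule subcringI)
  hence "cring (R\<lparr>carrier := ?C\<rparr>)"
    using subcring_iff subcringE(1) by metis
  moreover have "R\<lparr>carrier := ?C\<rparr> = ring_centre R"
    by (simp add: ring_centre_def)
  ultimately show ?thesis by simp
qed

section \<open>The group \<open>N\<close>\<close>

locale hermitian_setup =
  fixes p r q :: nat and \<omega> \<tau> :: "'f::field"
  assumes p: "prime p" and r: "r \<ge> 1" and q: "q = p ^ r" and card_f: "CARD('f) = q ^ 2"
    and \<omega>0: "\<omega> \<noteq> 0" and \<omega>: "\<omega> + qbar q \<omega> = 0" and \<tau>: "\<tau> + qbar q \<tau> = -1"
begin

abbreviation cj :: "'f \<Rightarrow> 'f" where "cj \<equiv> qbar q"
abbreviation \<Gamma> :: "'f set" where "\<Gamma> \<equiv> Gamma_set q"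
abbreviation \<Psi> :: "'f set" where "\<Psi> \<equiv> Psi_set q"
abbreviation Q :: "'f \<Rightarrow> 'f \<Rightarrow> 'f \<Rightarrow> bool" where "Q a b c \<equiv> (a, b, c) \<in> Q_set q"
abbreviation N :: "('f^3^3) set monoid" where "N \<equiv> N_grp q"
abbreviation H :: "'f \<Rightarrow> 'f \<Rightarrow> 'f \<Rightarrow> ('f^3^3) set" where "H \<equiv> M_hat q"

lemma q_gt_1: "q > 1"
  using p r q prime_gt_1_nat one_less_power[of p r] by simp

lemma card_gt_1: "CARD('f) > 1"
  using one_less_power[OF q_gt_1, of 2] by (simp add: card_f)

lemma fin: "finite (S :: 'f set)"
  using card_gt_1 by (metis card.infinite finite_subset not_one_less_zero subset_UNIV)

lemma char_f: "CHAR('f) = p"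
proof -
  have "CHAR('f) dvd p ^ (r * 2)"
    using CHAR_dvd_CARD[where 'a='f] card_f by (simp add: q power_mult)
  moreover have "prime CHAR('f)"
    by (rule prime_CHAR_semidom[OF finite_imp_CHAR_pos[OF fin]])
  ultimately show ?thesis
    using p by (metis prime_dvd_power primes_dvd_imp_eq)
qed

text \<open>\<open>cj\<close> is the \<open>r\<close>-fold iterate of the Frobenius map.\<close>

lemma cj_add [simp]: "cj (x + y) = cj x + cj y"
  unfolding qbar_def using freshmans_dream'[of q r x y] p by (simp add: char_f q)

lemma cj_mult [simp]: "cj (x * y) = cj x * cj y"
  by (simp add: qbar_def power_mult_distrib)

lemma cj_divide [simp]: "cj (x / y) = cj x / cj y"
  by (simp add: qbar_def power_divide)

lemma cj_power [simp]: "cj (x ^ n) = cj x ^ n"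
  by (simp add: qbar_def mult.commute flip: power_mult)

lemma cj_0 [simp]: "cj 0 = 0"
  using q_gt_1 by (simp add: qbar_def power_0_left)

lemma cj_1 [simp]: "cj 1 = 1"
  by (simp add: qbar_def)

lemma cj_minus [simp]: "cj (- x) = - cj x"
  using cj_add[of x "- x"] by (metis cj_0 add.right_inverse minus_unique)

lemma cj_diff [simp]: "cj (x - y) = cj x - cj y"
  using cj_add[of x "- y"] by simp

lemma cj_eq_0_iff [simp]: "cj x = 0 \<longleftrightarrow> x = 0"
  using q_gt_1 by (simp add: qbar_def)

lemma power_units: "x \<noteq> 0 \<Longrightarrow> x ^ (q ^ 2 - 1) = (1 :: 'f)"
  using finite_field_power_units[OF fin, of x] by (simp add: card_f)

lemma cj_cj [simp]: "cj (cj x) = x"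
proof (cases "x = 0")
  case False
  have "q ^ 2 = Suc (q ^ 2 - 1)"
    using q_gt_1 by simp
  hence "x ^ (q ^ 2) = x * x ^ (q ^ 2 - 1)"
    by (metis power_Suc)
  thus ?thesis
    using power_units[OF False] by (simp add: qbar_def power2_eq_square flip: power_mult)
qed auto

lemma cj_\<omega> [simp]: "cj \<omega> = - \<omega>"
  using \<omega> by (simp add: eq_neg_iff_add_eq_0 add.commute)

lemma cj_\<tau> [simp]: "cj \<tau> = - 1 - \<tau>"
  using \<tau> by (simp add: algebra_simps)

lemma q2_factor: "q ^ 2 - 1 = (q + 1) * (q - 1)"
  using q_gt_1 by (simp add: power2_eq_square algebra_simps)

text \<open>The norm is the power with exponent \<open>q + 1\<close>, and a nonzero \<open>s\<close>
  fixed by \<open>cj\<close> satisfies \<open>s ^ (q - 1) = 1\<close>. So this is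
  \<open>card_power_fibre\<close> for the factorisation of \<open>q ^ 2 - 1\<close> into
  \<open>q + 1\<close> and \<open>q - 1\<close>.\<close>

lemma card_norm_fibre:
  assumes "s \<noteq> 0" "cj s = s"
  shows "card {a. a * cj a = s} = q + 1"
proof -
  have "s * s ^ (q - 1) = s * 1"
    using assms(2) q_gt_1 by (cases q) (auto simp: qbar_def)
  hence "s ^ (q - 1) = 1"
    using assms(1) by simp
  hence "card {a. a ^ (q + 1) = s} = q + 1"
    by (intro card_power_fibre[of "q + 1" "q - 1" s] card_gt_1) (simp only: card_f q2_factor)
  thus ?thesis
    by (simp add: qbar_def)
qed

lemma norm_surj:
  assumes "s \<noteq> 0" "cj s = s"
  obtains a where "a \<noteq> 0" "a * cj a = s"
proof -
  have "{a. a * cj a = s} \<noteq> {}"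
    using card_norm_fibre[OF assms] by (metis card.empty add_is_0 zero_neq_one)
  thus ?thesis using that assms(1) by fastforce
qed

lemma gam_pos: "gam q > 0"
  by (simp add: gam_def)

lemma gam_dvd: "gam q dvd q + 1" "gam q dvd 3"
  by (simp_all add: gam_def)

lemma Psi_iff: "x \<in> \<Psi> \<longleftrightarrow> x * cj x = 1"
  by (auto simp: Psi_set_def)

text \<open>A power with a gcd as exponent is trivial exactly when both powers are, here those with
  exponents 3 and \<open>q + 1\<close>. As 3 is prime, only \<open>gam q = 1\<close> needs a Bezout
  relation.\<close>

lemma Gamma_iff: "l \<in> \<Gamma> \<longleftrightarrow> l ^ 3 = 1 \<and> l * cj l = 1"
proof
  assume "l \<in> \<Gamma>"
  hence "l ^ gam q = 1" by (simp add: Gamma_set_def)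
  hence "l ^ n = 1" if "gam q dvd n" for n
    using that by (auto simp: power_mult)
  from this[OF gam_dvd(1)] this[OF gam_dvd(2)] show "l ^ 3 = 1 \<and> l * cj l = 1"
    by (simp add: qbar_def)
next
  assume l: "l ^ 3 = 1 \<and> l * cj l = 1"
  hence "l ^ (q + 1) = 1" by (simp add: qbar_def)
  consider "gam q = 3" | "gam q = 1"
    using gam_dvd(2) prime_nat_iff[of 3] by auto
  thus "l \<in> \<Gamma>"
  proof cases
    case 2
    have "coprime 3 (q + 1)"
      using 2 by (simp add: gam_def coprime_iff_gcd_eq_1)
    then obtain x y where xy: "3 * x = (q + 1) * y + 1"
      using bezout_nat[of 3 "q + 1"] by (auto simp: coprime_iff_gcd_eq_1)
    have "1 = (l ^ 3) ^ x" using l by simp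
    also have "\<dots> = l ^ Suc ((q + 1) * y)"
      unfolding power_mult[symmetric] xy by simp
    also have "\<dots> = (l ^ (q + 1)) ^ y * l"
      unfolding power_Suc2 power_mult ..
    also have "\<dots> = l" using \<open>l ^ (q + 1) = 1\<close> by simp
    finally show ?thesis using 2 by (simp add: Gamma_set_def)
  qed (use l in \<open>simp add: Gamma_set_def\<close>)
qed

lemma Gamma_nonzero: "l \<in> \<Gamma> \<Longrightarrow> l \<noteq> 0"
  by (auto simp: Gamma_iff)

lemma Gamma_cj: "l \<in> \<Gamma> \<Longrightarrow> cj l = l ^ 2"
proof -
  assume l: "l \<in> \<Gamma>"
  hence "l * cj l = l * l ^ 2"
    by (simp add: Gamma_iff power2_eq_square power3_eq_cube mult.assoc)
  thus ?thesis using Gamma_nonzero[OF l] by simp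
qed

lemma Gamma_subset_Psi: "\<Gamma> \<subseteq> \<Psi>"
  by (auto simp: Gamma_iff Psi_iff)

lemma Gamma_one: "1 \<in> \<Gamma>"
  by (simp add: Gamma_iff)

lemma Gamma_mult: "l \<in> \<Gamma> \<Longrightarrow> l' \<in> \<Gamma> \<Longrightarrow> l * l' \<in> \<Gamma>"
  by (auto simp: Gamma_set_def power_mult_distrib)

lemma Gamma_divide: "l \<in> \<Gamma> \<Longrightarrow> l' \<in> \<Gamma> \<Longrightarrow> l / l' \<in> \<Gamma>"
  by (auto simp: Gamma_set_def power_divide)

lemma Psi_mult: "l \<in> \<Psi> \<Longrightarrow> l' \<in> \<Psi> \<Longrightarrow> l * l' \<in> \<Psi>"
  by (auto simp: Psi_iff algebra_simps)

lemma Psi_divide: "l \<in> \<Psi> \<Longrightarrow> l' \<in> \<Psi> \<Longrightarrow> l / l' \<in> \<Psi>"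
  by (auto simp: Psi_iff)

text \<open>Applying \<open>cj\<close> to \<open>cj x = x ^ 2\<close> gives
  \<open>x = x ^ 4\<close>, hence \<open>x ^ 3 = 1\<close>. The point of the criterion is that the
  factor \<open>cj x / x - x\<close>, by which unipotent conjugation shifts the second entry,
  vanishes exactly on \<Gamma>.\<close>

lemma Gamma_iff_cj_eq_square: "x \<noteq> 0 \<Longrightarrow> x \<in> \<Gamma> \<longleftrightarrow> cj x = x ^ 2"
proof (rule iffI[OF Gamma_cj])
  assume x: "x \<noteq> 0" "cj x = x ^ 2"
  hence "x * (x ^ 3) = cj (cj x)"
    by (simp only: cj_power x(2)) (simp add: power_mult[symmetric] power_Suc[symmetric] del: power_Suc)
  hence "x ^ 3 = 1" using x(1) by simp
  thus "x \<in> \<Gamma>" using x by (simp add: Gamma_iff power2_eq_square power3_eq_cube mult.assoc)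
qed

lemma Psi_Gamma_iff_cube: "x \<in> \<Psi> \<Longrightarrow> x \<in> \<Gamma> \<longleftrightarrow> x ^ 3 = 1"
  by (simp add: Gamma_iff Psi_iff)

text \<open>The ratios \<open>a\<^sup>2 / a\<^sup>q\<close> are the factors by which the torus acts on the second entry.\<close>

lemma L_set_iff_ratio: "y \<in> L_set q \<longleftrightarrow> (\<exists>a. a \<noteq> 0 \<and> y = a ^ 2 / cj a)"
proof -
  let ?S = "{y. \<exists>a::'f. a \<noteq> 0 \<and> y = a ^ 2 / cj a}"
  have mult: "y * z \<in> ?S" if "y \<in> ?S" "z \<in> ?S" for y z
  proof -
    from that obtain a b where "a \<noteq> 0" "b \<noteq> 0" "y = a ^ 2 / cj a" "z = b ^ 2 / cj b" by blast
    thus ?thesis by (intro CollectI exI[of _ "a * b"]) (simp add: power_mult_distrib)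
  qed
  have quot: "y / z \<in> ?S" if "y \<in> ?S" "z \<in> ?S" for y z
  proof -
    from that obtain a b where "a \<noteq> 0" "b \<noteq> 0" "y = a ^ 2 / cj a" "z = b ^ 2 / cj b" by blast
    thus ?thesis by (intro CollectI exI[of _ "a / b"]) (simp add: power_divide)
  qed
  have one: "1 \<in> ?S" by (intro CollectI exI[of _ 1]) simp
  have pow: "y ^ n \<in> ?S" if "y \<in> ?S" for y n
    using that by (induction n) (use one mult in auto)
  \<comment> \<open>The ratio belonging to \<open>a ^ 2 * cj a\<close> is
    \<open>a ^ 4 * cj a ^ 2 / (a * cj a ^ 2)\<close>, that is \<open>a ^ 3\<close>.\<close>
  have cube: "a ^ 3 \<in> ?S" if "a \<noteq> 0" for a
    using that by (intro CollectI exI[of _ "a ^ 2 * cj a"])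
      (simp add: power2_eq_square power3_eq_cube field_simps)
  have ratio: "a ^ 2 / cj a \<in> ?S" if "a \<noteq> 0" for a
    using that by blast
  \<comment> \<open>The cases are the residues of \<open>q\<close> modulo 3. For residue 2 the
    ratios have to be the cubes; otherwise \<open>gam q = 1\<close>, and every unit must be produced
    from cubes and ratios.\<close>
  consider m where "gam q = 3" "q + 1 = 3 * m" | m where "gam q = 1" "q = 3 * m"
    | m where "gam q = 1" "q = 3 * m + 1"
  proof (cases "3 dvd q + 1")
    case True
    hence "gam q = 3" by (simp add: gam_def gcd_nat.absorb1)
    thus ?thesis using True that(1) by (auto elim: dvdE)
  next
    case False
    hence "gam q = 1"
      using gam_dvd prime_nat_iff[of 3] by auto
    moreover have "q mod 3 = 0 \<or> q mod 3 = 1"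
      using False by presburger
    ultimately show ?thesis
      using that(2)[of "q div 3"] that(3)[of "q div 3"] by (metis mult_div_mod_eq add.right_neutral)
  qed
  hence "L_set q = ?S"
  proof cases
    case 1
    have "a ^ 2 / cj a \<in> L_set q" if "a \<noteq> 0" for a
    proof -
      \<comment> \<open>\<open>a ^ 2 / cj a\<close> equals \<open>a ^ 3\<close> divided by the norm
        of \<open>a\<close>, and the norm \<open>a ^ (q + 1)\<close> is a cube.\<close>
      have "cj a * a = (a ^ m) ^ 3"
        using 1(2) by (simp add: qbar_def mult.commute flip: power_mult power_Suc)
      hence "a ^ 2 / cj a = (a / a ^ m) ^ 3"
        using that by (simp add: field_simps power2_eq_square power3_eq_cube)
      thus ?thesis using that 1(1) unfolding L_set_def by (intro CollectI exI[of _ "a / a ^ m"]) auto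
    qed
    thus ?thesis using cube 1(1) by (auto simp: L_set_def)
  next
    case 2
    have "a \<in> ?S" if a: "a \<noteq> 0" for a
    proof -
      have "cj a = (a ^ 3) ^ m" using 2(2) by (simp add: qbar_def power_mult)
      \<comment> \<open>Since \<open>cj a = (a ^ 3) ^ m\<close>, the denominator is just
        \<open>a ^ 2\<close>.\<close>
      hence "a ^ 3 / (a ^ 2 / cj a * (a ^ 3) ^ m) \<in> ?S"
        by (intro quot mult pow cube ratio a)
      also have "a ^ 3 / (a ^ 2 / cj a * (a ^ 3) ^ m) = a"
        unfolding \<open>cj a = (a ^ 3) ^ m\<close> using a by (simp add: field_simps power2_eq_square power3_eq_cube)
      finally show ?thesis .
    qed
    thus ?thesis using 2(1) by (auto simp: L_set_def)
  next
    case 3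
    have "a \<in> ?S" if a: "a \<noteq> 0" for a
    proof -
      have c: "cj a = a * (a ^ 3) ^ m" using 3(2) by (simp add: qbar_def power_mult)
      \<comment> \<open>Since \<open>cj a = a * (a ^ 3) ^ m\<close>, the cubic factor turns the
        ratio into \<open>a\<close> itself.\<close>
      hence "a ^ 2 / cj a * (a ^ 3) ^ m \<in> ?S"
        by (intro mult pow cube ratio a)
      also have "a ^ 2 / cj a * (a ^ 3) ^ m = a"
        unfolding c using a by (simp add: field_simps power2_eq_square power3_eq_cube)
      finally show ?thesis .
    qed
    thus ?thesis using 3(1) by (auto simp: L_set_def)
  qed
  thus ?thesis by blast
qed

lemma card_Gamma: "card \<Gamma> = gam q"
proof -
  have "gam q dvd q ^ 2 - 1"
    using gam_dvd(1) unfolding q2_factor by (rule dvd_mult2)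
  thus ?thesis
    using card_power_fibre[of "gam q" "(q ^ 2 - 1) div gam q" "1::'f"] card_gt_1
    by (simp add: card_f Gamma_set_def)
qed

lemma card_Psi: "card \<Psi> = q + 1"
proof -
  have "\<Psi> = {x. x * cj x = 1}"
    by (auto simp: Psi_iff)
  thus ?thesis using card_norm_fibre[of 1] by simp
qed

text \<open>The image of the power map with exponent \<open>gam q\<close> is the kernel of the power
  map with the complementary exponent, and that kernel is counted by
  \<open>card_power_fibre\<close>.\<close>

lemma card_L: "card (L_set q :: 'f set) * gam q = q ^ 2 - 1"
proof -
  let ?m = "(q ^ 2 - 1) div gam q"
  have d: "gam q * ?m = q ^ 2 - 1"
    using gam_dvd(1) unfolding q2_factor by (intro dvd_mult_div_cancel dvd_mult2)
  have pos: "?m > 0"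
    using d q_gt_1 by (metis One_nat_def gr0I mult_0_right one_less_power pos2 zero_less_diff less_irrefl)
  have "L_set q = {y::'f. y ^ ?m = 1}"
  proof
    show "L_set q \<subseteq> {y::'f. y ^ ?m = 1}"
      by (auto simp: L_set_def d power_units simp flip: power_mult simp del: One_nat_def)
    show "{y::'f. y ^ ?m = 1} \<subseteq> L_set q"
    proof
      fix y :: 'f assume "y \<in> {y. y ^ ?m = 1}"
      hence y: "y ^ ?m = 1" by simp
      hence "card {x. x ^ gam q = y} = gam q"
        using card_power_fibre[of "gam q" ?m y] d card_gt_1 by (simp add: card_f)
      then obtain x where x: "x ^ gam q = y"
        using gam_pos by (metis (mono_tags) Collect_empty_eq card.empty less_irrefl)
      moreover have "x \<noteq> 0"
        using x y pos gam_pos by (auto simp: power_0_left)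
      ultimately show "y \<in> L_set q" by (auto simp: L_set_def)
    qed
  qed
  moreover have "card {y::'f. y ^ ?m = 1} = ?m"
    using card_power_fibre[of ?m "gam q" "1::'f"] d card_gt_1 by (simp add: card_f mult.commute)
  ultimately show ?thesis using d by (simp add: mult.commute)
qed

section \<open>From matrices modulo scalars to triples\<close>

lemma hform_eq: "hform q v w = v $ 1 * cj (w $ 3) + v $ 2 * cj (w $ 2) + v $ 3 * cj (w $ 1)"
  by (simp add: hform_def gram_def sum_3)

lemma mat_mult_vec: "(mat l *v v) $ i = l * v $ i" for v :: "'f^3"
  using exhaust_3[of i] by (auto simp: matrix_vector_mult_def mat_def sum_3)

text \<open>The determinant gives \<open>l ^ 3 = 1\<close>, and the middle basis vector, which has
  norm 1, gives \<open>l * cj l = 1\<close>. By \<open>Gamma_iff\<close> these two conditions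
  describe \<Gamma>.\<close>

lemma SU3_scalars_eq: "SU3_scalars q = mat ` \<Gamma>"
proof -
  have hf: "hform q (mat l *v v) (mat l *v w) = l * cj l * hform q v w" for l v w
    by (simp add: hform_eq mat_mult_vec algebra_simps)
  have "mat l \<in> carrier (SU3 q) \<longleftrightarrow> l \<in> \<Gamma>" for l
  proof
    assume l: "mat l \<in> carrier (SU3 q)"
    hence "det (mat l :: 'f^3^3) = 1"
      and h: "\<And>v w. hform q (mat l *v v) (mat l *v w) = hform q v w"
      by (auto simp: SU3_def)
    moreover have "l * cj l = 1"
      using h[of "axis 2 1" "axis 2 1"] unfolding hf by (simp add: hform_eq axis_def)
    ultimately show "l \<in> \<Gamma>"
      by (simp add: Gamma_iff det_3 mat_def power3_eq_cube)
  next
    assume "l \<in> \<Gamma>"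
    thus "mat l \<in> carrier (SU3 q)"
      by (simp add: SU3_def hf Gamma_iff) (simp add: det_3 mat_def power3_eq_cube)
  qed
  thus ?thesis by (auto simp: SU3_scalars_def)
qed

lemma M_mat_inject: "M_mat q a b c = M_mat q a' b' c' \<longleftrightarrow> a = a' \<and> b = b' \<and> c = c'"
proof
  assume eq: "M_mat q a b c = M_mat q a' b' c'"
  have "M_mat q a b c $ 1 $ i = M_mat q a' b' c' $ 1 $ i" for i
    using eq by simp
  from this[of 1] this[of 2] this[of 3] show "a = a' \<and> b = b' \<and> c = c'"
    by (simp add: M_mat_def)
qed auto

lemma M_mat_mult:
  assumes "a \<noteq> 0" "a' \<noteq> 0"
  shows "M_mat q a b c ** M_mat q a' b' c' =
    M_mat q (a * a') (a * b' + b * (cj a' / a')) (a * c' - b * cj b' / a' + c / cj a')"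
  using assms by (simp add: vec_eq_iff forall_3 M_mat_def matrix_matrix_mult_def sum_3 field_simps)

text \<open>The first row scales by any \<open>l\<close>. That the other diagonal entries follow the
  pattern of \<open>M_mat\<close> rests on \<open>cj l = l ^ 2\<close> and
  \<open>l ^ 3 = 1\<close>.\<close>

lemma mat_M_mat: "l \<in> \<Gamma> \<Longrightarrow> mat l ** M_mat q a b c = M_mat q (l * a) (l * b) (l * c)"
proof -
  assume l: "l \<in> \<Gamma>"
  have cl: "cj l = l * l" and l3: "l * (l * l) = 1"
    using Gamma_cj[OF l] l by (auto simp: power2_eq_square Gamma_iff power3_eq_cube mult.assoc)
  have "l / cj a = l * (l * l) / (l * (l * cj a))"
    using Gamma_nonzero[OF l] by simp
  hence "l / cj a = 1 / (l * (l * cj a))" by (simp only: l3)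
  thus ?thesis
    using Gamma_nonzero[OF l] cl
    by (simp add: vec_eq_iff forall_3 M_mat_def matrix_matrix_mult_def sum_3 mat_def field_simps)
qed

lemma H_eq: "H a b c = (\<lambda>l. M_mat q (l * a) (l * b) (l * c)) ` \<Gamma>"
  unfolding M_hat_def r_coset_def SU3_scalars_eq by (auto simp: SU3_def mat_M_mat)

text \<open>Elements of \<open>N\<close> are triples up to scaling by \<Gamma>. From here on
  matrices hardly occur, and every statement about triples has to be compatible with this
  scaling.\<close>

lemma H_eq_iff:
  "H a b c = H a' b' c' \<longleftrightarrow> (\<exists>l\<in>\<Gamma>. a' = l * a \<and> b' = l * b \<and> c' = l * c)"
proof
  assume "H a b c = H a' b' c'"
  hence "M_mat q a' b' c' \<in> H a b c"
    unfolding H_eq[of a'] using Gamma_one by force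
  thus "\<exists>l\<in>\<Gamma>. a' = l * a \<and> b' = l * b \<and> c' = l * c"
    unfolding H_eq by (auto simp: M_mat_inject)
next
  assume "\<exists>l\<in>\<Gamma>. a' = l * a \<and> b' = l * b \<and> c' = l * c"
  then obtain l where l: "l \<in> \<Gamma>" "a' = l * a" "b' = l * b" "c' = l * c" by blast
  have "(\<lambda>m. m * l) ` \<Gamma> = \<Gamma>"
  proof
    show "(\<lambda>m. m * l) ` \<Gamma> \<subseteq> \<Gamma>" using l(1) Gamma_mult by auto
    show "\<Gamma> \<subseteq> (\<lambda>m. m * l) ` \<Gamma>"
    proof
      fix m assume "m \<in> \<Gamma>"
      thus "m \<in> (\<lambda>m. m * l) ` \<Gamma>"
        using l(1) Gamma_divide Gamma_nonzero by (intro image_eqI[of _ _ "m / l"]) auto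
    qed
  qed
  hence "H a b c = (\<lambda>l. M_mat q (l * a) (l * b) (l * c)) ` (\<lambda>m. m * l) ` \<Gamma>"
    by (simp add: H_eq)
  also have "\<dots> = H a' b' c'"
    by (simp add: H_eq image_image l mult.assoc)
  finally show "H a b c = H a' b' c'" .
qed

lemma H_mult:
  assumes "a \<noteq> 0" "a' \<noteq> 0"
  shows "H a b c \<otimes>\<^bsub>N\<^esub> H a' b' c' =
    H (a * a') (a * b' + b * (cj a' / a')) (a * c' - b * cj b' / a' + c / cj a')"
proof -
  let ?P = "M_mat q a b c" and ?P' = "M_mat q a' b' c'"
  have M: "H a b c = (\<lambda>l. mat l ** M_mat q a b c) ` \<Gamma>" for a b c
    by (simp add: H_eq mat_M_mat)
  \<comment> \<open>Scalar matrices are central, so in the product of two cosets the two scalars can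
    be collected in front.\<close>
  have comm: "mat l ** A = A ** mat l" for l :: 'f and A :: "'f^3^3"
    by (simp add: vec_eq_iff forall_3 matrix_matrix_mult_def sum_3 mat_def)
  have mat2: "mat l ** mat m = (mat (l * m) :: 'f^3^3)" for l m
    by (simp add: vec_eq_iff forall_3 matrix_matrix_mult_def sum_3 mat_def)
  have "(mat l ** ?P) ** (mat m ** ?P') = mat (l * m) ** (?P ** ?P')" for l m
  proof -
    have "(mat l ** ?P) ** (mat m ** ?P') = mat l ** (?P ** mat m) ** ?P'"
      by (simp only: matrix_mul_assoc)
    also have "\<dots> = mat l ** (mat m ** ?P) ** ?P'"
      unfolding comm[of m ?P] ..
    also have "\<dots> = (mat l ** mat m) ** (?P ** ?P')"
      by (simp only: matrix_mul_assoc)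
    finally show ?thesis unfolding mat2 .
  qed
  hence "H a b c \<otimes>\<^bsub>N\<^esub> H a' b' c' = (\<Union>l\<in>\<Gamma>. \<Union>m\<in>\<Gamma>. {mat (l * m) ** (?P ** ?P')})"
    unfolding M by (auto simp: N_grp_def PSU3_def FactGroup_def set_mult_def SU3_def)
  also have "\<dots> = (\<lambda>l. mat l ** (?P ** ?P')) ` \<Gamma>"
  proof safe
    fix l assume "l \<in> \<Gamma>"
    thus "mat l ** (?P ** ?P') \<in> (\<Union>l\<in>\<Gamma>. \<Union>m\<in>\<Gamma>. {mat (l * m) ** (?P ** ?P')})"
      using Gamma_one by (intro UN_I[of l] UN_I[of 1]) auto
  qed (use Gamma_mult in auto)
  also have "\<dots> = H (a * a') (a * b' + b * (cj a' / a')) (a * c' - b * cj b' / a' + c / cj a')"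
    unfolding M M_mat_mult[OF assms] ..
  finally show ?thesis .
qed

lemma N_carrier: "x \<in> carrier N \<longleftrightarrow> (\<exists>a b c. Q a b c \<and> x = H a b c)"
  by (auto simp: N_grp_def)

lemma H_in_N: "Q a b c \<Longrightarrow> H a b c \<in> carrier N"
  by (auto simp: N_carrier)

lemma Q_iff: "Q a b c \<longleftrightarrow> a \<noteq> 0 \<and> b * cj b + a * cj c + c * cj a = 0"
  by (simp add: Q_set_def)

lemma Q_nonzero: "Q a b c \<Longrightarrow> a \<noteq> 0"
  by (simp add: Q_iff)

lemma N_one: "\<one>\<^bsub>N\<^esub> = H 1 0 0"
proof -
  have "M_mat q l 0 0 = mat l" if "l \<in> \<Gamma>" for l
    using mat_M_mat[OF that, of 1 0 0] by (simp add: vec_eq_iff forall_3 M_mat_def mat_def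
        matrix_matrix_mult_def sum_3)
  hence "mat ` \<Gamma> = H 1 0 0"
    by (auto simp: H_eq)
  thus ?thesis
    by (simp add: N_grp_def PSU3_def FactGroup_def SU3_scalars_eq)
qed

lemma Q_mult:
  assumes "Q a b c" "Q a' b' c'"
  shows "Q (a * a') (a * b' + b * (cj a' / a')) (a * c' - b * cj b' / a' + c / cj a')"
proof -
  have nz: "a \<noteq> 0" "a' \<noteq> 0" "cj a' \<noteq> 0" and
    e: "b * cj b = - a * cj c - c * cj a" "b' * cj b' = - a' * cj c' - c' * cj a'"
    using assms by (auto simp: Q_iff algebra_simps eq_neg_iff_add_eq_0)
  \<comment> \<open>The expansion isolates the norms of \<open>b\<close> and \<open>b'\<close>,
    which are then replaced by means of the two hermitian conditions \<open>e\<close>.\<close>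
  have "(a * b' + b * (cj a' / a')) * cj (a * b' + b * (cj a' / a')) =
      a * cj a * (b' * cj b') + a * b' * cj b * (a' / cj a') + b * (cj a' / a') * cj a * cj b'
        + b * cj b"
    using nz by (simp add: field_simps)
  also have "\<dots> = - a * a' * cj (a * c' - b * cj b' / a' + c / cj a')
       - (a * c' - b * cj b' / a' + c / cj a') * cj (a * a')"
    unfolding e using nz by (simp add: field_simps)
  finally show ?thesis using nz by (simp add: Q_iff algebra_simps)
qed

lemma Q_inv: "Q a b c \<Longrightarrow> Q (1 / a) (- b / cj a) (cj c)"
  by (simp add: Q_iff field_simps)

lemma H_inv_mult: "Q a b c \<Longrightarrow> H (1 / a) (- b / cj a) (cj c) \<otimes>\<^bsub>N\<^esub> H a b c = \<one>\<^bsub>N\<^esub>"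
proof -
  assume Qa: "Q a b c"
  hence a: "a \<noteq> 0" and e: "b * cj b = - a * cj c - c * cj a"
    by (auto simp: Q_iff algebra_simps eq_neg_iff_add_eq_0)
  have "1 / a * c - (- b / cj a) * cj b / a + cj c / cj a = (c * cj a + b * cj b + a * cj c) / (a * cj a)"
    using a by (simp add: field_simps)
  also have "\<dots> = 0" unfolding e by simp
  finally show ?thesis using a by (subst H_mult) (auto simp: N_one)
qed

text \<open>The group axioms are checked directly on triples. Only associativity goes back to
  matrices: the product is the set product of cosets, so it inherits associativity from matrix
  multiplication.\<close>

lemma group_N: "group N"
proof (rule groupI)
  fix x y assume "x \<in> carrier N" "y \<in> carrier N"
  then obtain a b c a' b' c' where x: "Q a b c" "x = H a b c" and y: "Q a' b' c'" "y = H a' b' c'"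
    by (auto simp: N_carrier)
  have "x \<otimes>\<^bsub>N\<^esub> y = H (a * a') (a * b' + b * (cj a' / a')) (a * c' - b * cj b' / a' + c / cj a')"
    unfolding x y by (intro H_mult Q_nonzero[OF x(1)] Q_nonzero[OF y(1)])
  thus "x \<otimes>\<^bsub>N\<^esub> y \<in> carrier N"
    using H_in_N[OF Q_mult[OF x(1) y(1)]] by simp
  fix z assume "z \<in> carrier N"
  have m: "X \<otimes>\<^bsub>N\<^esub> Y = {A ** B | A B. A \<in> X \<and> B \<in> Y}" for X Y
    by (auto simp: N_grp_def PSU3_def FactGroup_def set_mult_def SU3_def)
  show "x \<otimes>\<^bsub>N\<^esub> y \<otimes>\<^bsub>N\<^esub> z = x \<otimes>\<^bsub>N\<^esub> (y \<otimes>\<^bsub>N\<^esub> z)"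
  proof -
    have "x \<otimes>\<^bsub>N\<^esub> y \<otimes>\<^bsub>N\<^esub> z = {A ** B ** C | A B C. A \<in> x \<and> B \<in> y \<and> C \<in> z}"
      unfolding m by blast
    moreover have "x \<otimes>\<^bsub>N\<^esub> (y \<otimes>\<^bsub>N\<^esub> z) = {A ** (B ** C) | A B C. A \<in> x \<and> B \<in> y \<and> C \<in> z}"
      unfolding m by blast
    ultimately show ?thesis by (simp add: matrix_mul_assoc)
  qed
next
  show "\<one>\<^bsub>N\<^esub> \<in> carrier N"
    unfolding N_one by (rule H_in_N) (simp add: Q_iff)
  fix x assume "x \<in> carrier N"
  then obtain a b c where x: "Q a b c" "x = H a b c"
    by (auto simp: N_carrier)
  show "\<one>\<^bsub>N\<^esub> \<otimes>\<^bsub>N\<^esub> x = x"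
    using Q_nonzero[OF x(1)] unfolding x N_one by (subst H_mult) auto
  show "\<exists>y\<in>carrier N. y \<otimes>\<^bsub>N\<^esub> x = \<one>\<^bsub>N\<^esub>"
    using H_inv_mult[OF x(1)] H_in_N[OF Q_inv[OF x(1)]] unfolding x by blast
qed

sublocale N: group N
  by (rule group_N)

lemma fin_N: "finite (carrier N)"
proof -
  have "carrier N \<subseteq> (\<lambda>(a, b, c). H a b c) ` Q_set q"
  proof
    fix x assume "x \<in> carrier N"
    then obtain a b c where "Q a b c" "x = H a b c" by (auto simp: N_carrier)
    thus "x \<in> (\<lambda>(a, b, c). H a b c) ` Q_set q"
      by (intro image_eqI[of _ _ "(a, b, c)"]) auto
  qed
  moreover have "finite (Q_set q :: ('f \<times> 'f \<times> 'f) set)"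
    using finite_subset[OF subset_UNIV, of "Q_set q"] fin[of UNIV] by (simp add: finite_prod)
  ultimately show ?thesis
    by (rule finite_subset[OF _ finite_imageI])
qed

lemma H_inv: "Q a b c \<Longrightarrow> inv\<^bsub>N\<^esub> (H a b c) = H (1 / a) (- b / cj a) (cj c)"
  by (intro N.inv_equality H_inv_mult H_in_N Q_inv)

text \<open>The second entry is multiplied by a ratio, hence by an element of
  \<open>L_set q\<close>, and the third by a norm. The former lets \<open>U_y\<close> depend only on
  the coset of \<open>y\<close>; the latter merges all nonzero third entries over a fixed
  \<open>a\<close> when \<open>b = 0\<close>.\<close>

lemma conj_torus:
  assumes "Q a b c" "\<alpha> \<noteq> 0"
  shows "H \<alpha> 0 0 \<otimes>\<^bsub>N\<^esub> H a b c \<otimes>\<^bsub>N\<^esub> inv\<^bsub>N\<^esub> (H \<alpha> 0 0) = H a (b * (\<alpha>\<^sup>2 / cj \<alpha>)) (c * (\<alpha> * cj \<alpha>))"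
proof -
  have "Q \<alpha> 0 0" using assms(2) by (simp add: Q_iff)
  thus ?thesis
    using Q_nonzero[OF assms(1)] assms(2)
    by (simp add: H_inv H_mult) (simp add: field_simps power2_eq_square)
qed

text \<open>The diagonal entry is unchanged and the second entry is translated by a multiple of
  \<open>cj a / a - a\<close>. So \<open>b\<close> can be cleared for \<open>a\<close> outside
  \<Gamma> and is rigid for \<open>a\<close> in \<Gamma>.\<close>

lemma conj_unipotent:
  assumes "Q a b c" "Q 1 \<beta> \<delta>"
  shows "H 1 \<beta> \<delta> \<otimes>\<^bsub>N\<^esub> H a b c \<otimes>\<^bsub>N\<^esub> inv\<^bsub>N\<^esub> (H 1 \<beta> \<delta>) =
    H a (b + \<beta> * (cj a / a - a)) (c + a * cj \<delta> + (b + \<beta> * (cj a / a)) * cj \<beta> - \<beta> * cj b / a + \<delta> / cj a)"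
  using Q_nonzero[OF assms(1)] by (simp add: H_inv[OF assms(2)] H_mult) (simp add: field_simps)

lemma H_decompose:
  assumes "Q a b c"
  obtains \<beta> \<delta> where "Q 1 \<beta> \<delta>" "H a b c = H 1 \<beta> \<delta> \<otimes>\<^bsub>N\<^esub> H a 0 0"
proof
  have a: "a \<noteq> 0" using assms by (rule Q_nonzero)
  show "Q 1 (b * a / cj a) (c * cj a)"
    using assms by (simp add: Q_iff field_simps)
  show "H a b c = H 1 (b * a / cj a) (c * cj a) \<otimes>\<^bsub>N\<^esub> H a 0 0"
    using a by (simp add: H_mult)
qed

section \<open>Conjugacy classes\<close>

abbreviation \<d> :: "'f \<Rightarrow> ('f^3^3) set" where "\<d> a \<equiv> H a 0 0"
abbreviation \<t> :: "'f \<Rightarrow> ('f^3^3) set" where "\<t> a \<equiv> H a 0 (a * \<omega>)"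
abbreviation \<u> :: "'f \<Rightarrow> ('f^3^3) set" where "\<u> y \<equiv> H 1 y (y * cj y * \<tau>)"

lemma Q_d: "a \<noteq> 0 \<Longrightarrow> Q a 0 0"
  by (simp add: Q_iff)

lemma Q_t: "a \<noteq> 0 \<Longrightarrow> Q a 0 (a * \<omega>)"
  by (simp add: Q_iff)

lemma Q_u: "Q 1 y (y * cj y * \<tau>)"
  by (simp add: Q_iff algebra_simps)

lemma Q_torus: "Q a b c \<Longrightarrow> \<alpha> \<noteq> 0 \<Longrightarrow> Q a (b * (\<alpha>\<^sup>2 / cj \<alpha>)) (c * (\<alpha> * cj \<alpha>))"
proof -
  assume Q: "Q a b c" and \<alpha>: "\<alpha> \<noteq> 0"
  have "b * (\<alpha>\<^sup>2 / cj \<alpha>) * cj (b * (\<alpha>\<^sup>2 / cj \<alpha>)) + a * cj (c * (\<alpha> * cj \<alpha>)) + c * (\<alpha> * cj \<alpha>) * cj a =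
    (b * cj b + a * cj c + c * cj a) * (\<alpha> * cj \<alpha>)"
    using \<alpha> by (simp add: field_simps power2_eq_square)
  thus ?thesis using Q by (simp add: Q_iff)
qed

lemma Q_scale: "l \<in> \<Gamma> \<Longrightarrow> Q a b c \<Longrightarrow> Q (l * a) (l * b) (l * c)"
proof -
  assume l: "l \<in> \<Gamma>" and Q: "Q a b c"
  have "l * b * cj (l * b) + l * a * cj (l * c) + l * c * cj (l * a)
    = (l * cj l) * (b * cj b + a * cj c + c * cj a)"
    by (simp add: algebra_simps)
  thus ?thesis using Q Gamma_nonzero[OF l] by (simp add: Q_iff)
qed

text \<open>For \<open>a\<close> of norm one the quantity \<open>c (a\<^sup>3 - 1) - a b b\<^sup>q\<close> vanishes exactly on the conjugates of
  diagonal elements, hence separates the classes of \<open>d\<^sub>a\<close> and \<open>t\<^sub>a\<close>.\<close>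

lemma Psi_cj:
  assumes "a \<in> \<Psi>"
  shows "a \<noteq> 0" "cj a = 1 / a"
proof -
  show "a \<noteq> 0" using assms by (auto simp: Psi_iff)
  thus "cj a = 1 / a"
    using assms by (metis Psi_iff nonzero_mult_div_cancel_left)
qed

lemma defect_unipotent:
  fixes a b c \<beta> \<delta> :: 'f
  assumes "Q 1 \<beta> \<delta>" "a \<in> \<Psi>"
  defines "b' \<equiv> b + \<beta> * (cj a / a - a)"
    and "c' \<equiv> c + a * cj \<delta> + (b + \<beta> * (cj a / a)) * cj \<beta> - \<beta> * cj b / a + \<delta> / cj a"
  shows "c' * (a ^ 3 - 1) - a * (b' * cj b') = c * (a ^ 3 - 1) - a * (b * cj b)"
proof -
  note a = Psi_cj[OF assms(2)]
  \<comment> \<open>With \<open>cj \<delta>\<close> eliminated and \<open>cj a = 1 / a\<close>, the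
    claim becomes a rational identity.\<close>
  have \<delta>: "cj \<delta> = - \<beta> * cj \<beta> - \<delta>"
    using assms(1) by (simp add: Q_iff eq_diff_eq eq_neg_iff_add_eq_0 algebra_simps)
  show ?thesis
    unfolding b'_def c'_def using a(1)
    by (simp add: \<delta> a(2) field_simps power2_eq_square power3_eq_cube)
qed

lemma Q_conj_unipotent:
  assumes "Q a b c" "Q 1 \<beta> \<delta>"
  shows "Q a (b + \<beta> * (cj a / a - a)) (c + a * cj \<delta> + (b + \<beta> * (cj a / a)) * cj \<beta> - \<beta> * cj b / a + \<delta> / cj a)"
proof -
  have a: "a \<noteq> 0" using assms Q_nonzero by blast
  show ?thesis
    using Q_mult[OF Q_mult[OF assms(2,1)] Q_inv[OF assms(2)]] a by (simp add: field_simps)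
qed

text \<open>A principle for proving that elements are not conjugate. A conjugating element is a
  unipotent one times a torus element, and the resulting triple is known only up to \<Gamma>; hence
  the three closure conditions on \<open>R\<close>.\<close>

lemma conj_class_invariant:
  assumes Q: "Q a b c" "Q a' b' c'" and conj: "H a' b' c' \<in> conj_class N (H a b c)"
    and R: "R a b c"
    and scale: "\<And>l a b c. l \<in> \<Gamma> \<Longrightarrow> Q a b c \<Longrightarrow> R a b c \<Longrightarrow> R (l * a) (l * b) (l * c)"
    and torus: "\<And>\<alpha> a b c. \<alpha> \<noteq> 0 \<Longrightarrow> Q a b c \<Longrightarrow> R a b c \<Longrightarrow>
      R a (b * (\<alpha>\<^sup>2 / cj \<alpha>)) (c * (\<alpha> * cj \<alpha>))"
    and unipotent: "\<And>\<beta> \<delta> a b c. Q 1 \<beta> \<delta> \<Longrightarrow> Q a b c \<Longrightarrow> R a b c \<Longrightarrow>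
      R a (b + \<beta> * (cj a / a - a)) (c + a * cj \<delta> + (b + \<beta> * (cj a / a)) * cj \<beta> - \<beta> * cj b / a + \<delta> / cj a)"
  shows "R a' b' c'"
proof -
  obtain g where g: "g \<in> carrier N" "H a' b' c' = g \<otimes>\<^bsub>N\<^esub> H a b c \<otimes>\<^bsub>N\<^esub> inv\<^bsub>N\<^esub> g"
    using conj by (auto simp: conj_class_def)
  obtain \<alpha> b0 c0 where 0: "Q \<alpha> b0 c0" "g = H \<alpha> b0 c0"
    using g(1) by (auto simp: N_carrier)
  then obtain \<beta> \<delta> where \<beta>: "Q 1 \<beta> \<delta>" "g = H 1 \<beta> \<delta> \<otimes>\<^bsub>N\<^esub> \<d> \<alpha>"
    using H_decompose by blast
  have \<alpha>: "\<alpha> \<noteq> 0" using 0 Q_nonzero by blast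
  define b1 c1 where "b1 = b * (\<alpha>\<^sup>2 / cj \<alpha>)" and "c1 = c * (\<alpha> * cj \<alpha>)"
  have 1: "Q a b1 c1" "R a b1 c1"
    unfolding b1_def c1_def using Q_torus torus Q(1) R \<alpha> by auto
  have mem: "H 1 \<beta> \<delta> \<in> carrier N" "\<d> \<alpha> \<in> carrier N" "H a b c \<in> carrier N"
    using \<beta> \<alpha> Q by (auto intro: H_in_N Q_d)
  have "H a' b' c' = H 1 \<beta> \<delta> \<otimes>\<^bsub>N\<^esub> (\<d> \<alpha> \<otimes>\<^bsub>N\<^esub> H a b c \<otimes>\<^bsub>N\<^esub> inv\<^bsub>N\<^esub> (\<d> \<alpha>)) \<otimes>\<^bsub>N\<^esub> inv\<^bsub>N\<^esub> (H 1 \<beta> \<delta>)"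
    unfolding g(2) \<beta>(2) using mem by (simp add: N.inv_mult_group N.m_assoc)
  also have "\<dots> = H a (b1 + \<beta> * (cj a / a - a)) (c1 + a * cj \<delta> + (b1 + \<beta> * (cj a / a)) * cj \<beta> - \<beta> * cj b1 / a + \<delta> / cj a)"
    unfolding conj_torus[OF Q(1) \<alpha>] b1_def[symmetric] c1_def[symmetric] by (rule conj_unipotent[OF 1(1) \<beta>(1)])
  finally have eq: "H a (b1 + \<beta> * (cj a / a - a))
      (c1 + a * cj \<delta> + (b1 + \<beta> * (cj a / a)) * cj \<beta> - \<beta> * cj b1 / a + \<delta> / cj a) = H a' b' c'" ..
  then obtain l where l: "l \<in> \<Gamma>" "a' = l * a" "b' = l * (b1 + \<beta> * (cj a / a - a))"
      "c' = l * (c1 + a * cj \<delta> + (b1 + \<beta> * (cj a / a)) * cj \<beta> - \<beta> * cj b1 / a + \<delta> / cj a)"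
    unfolding H_eq_iff by blast
  show ?thesis
    unfolding l(2-4) using scale[OF l(1) Q_conj_unipotent[OF 1(1) \<beta>(1)] unipotent[OF \<beta>(1) 1]] .
qed

lemma conj_class_diag_part:
  assumes Q: "Q a b c" "Q a' b' c'" and conj: "H a' b' c' \<in> conj_class N (H a b c)"
  shows "a' / a \<in> \<Gamma>"
proof -
  have "a \<noteq> 0" using Q Q_nonzero by blast
  show ?thesis
  proof (rule conj_class_invariant[OF Q conj, of "\<lambda>x y z. x / a \<in> \<Gamma>"])
    show "a / a \<in> \<Gamma>" using \<open>a \<noteq> 0\<close> Gamma_one by simp
    fix l x assume "l \<in> \<Gamma>" "x / a \<in> \<Gamma>"
    from Gamma_mult[OF this] show "l * x / a \<in> \<Gamma>" by simp
  qed
qed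

lemma conj_class_defect:
  assumes Q: "Q a b c" "Q a' b' c'" and conj: "H a' b' c' \<in> conj_class N (H a b c)"
    and a: "a \<in> \<Psi>" and c: "c * (a ^ 3 - 1) = a * (b * cj b)"
  shows "c' * (a' ^ 3 - 1) = a' * (b' * cj b')"
proof -
  \<comment> \<open>Membership in \<Psi> is carried along because \<open>defect_unipotent\<close>
    requires it. Scaling by \<Gamma> multiplies both sides of the equation by \<open>l\<close>, and
    the torus multiplies them by a norm.\<close>
  have "a' \<in> \<Psi> \<and> c' * (a' ^ 3 - 1) = a' * (b' * cj b')"
  proof (rule conj_class_invariant[OF Q conj, of "\<lambda>a b c. a \<in> \<Psi> \<and> c * (a ^ 3 - 1) = a * (b * cj b)"])
    show "a \<in> \<Psi> \<and> c * (a ^ 3 - 1) = a * (b * cj b)" using a c by blast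
  next
    fix l a b c assume l: "l \<in> \<Gamma>" and Ra: "a \<in> \<Psi> \<and> c * (a ^ 3 - 1) = a * (b * cj b)"
    have "l * c * ((l * a) ^ 3 - 1) = l * (c * (a ^ 3 - 1))"
      using l by (simp add: Gamma_iff power_mult_distrib)
    also have "\<dots> = l * a * (l * b * cj (l * b))"
      using Ra l by (simp add: Gamma_iff algebra_simps)
    finally show "l * a \<in> \<Psi> \<and> l * c * ((l * a) ^ 3 - 1) = l * a * (l * b * cj (l * b))"
      using l Ra Gamma_subset_Psi Psi_mult by blast
  next
    fix \<alpha> a b c :: 'f assume \<alpha>: "\<alpha> \<noteq> 0" and Ra: "a \<in> \<Psi> \<and> c * (a ^ 3 - 1) = a * (b * cj b)"
    have "c * (\<alpha> * cj \<alpha>) * (a ^ 3 - 1) = a * (b * cj b) * (\<alpha> * cj \<alpha>)"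
      using Ra by (metis mult.assoc mult.commute)
    also have "\<dots> = a * (b * (\<alpha>\<^sup>2 / cj \<alpha>) * cj (b * (\<alpha>\<^sup>2 / cj \<alpha>)))"
      using \<alpha> by (simp add: field_simps power2_eq_square)
    finally show "a \<in> \<Psi> \<and> c * (\<alpha> * cj \<alpha>) * (a ^ 3 - 1) = a * (b * (\<alpha>\<^sup>2 / cj \<alpha>) * cj (b * (\<alpha>\<^sup>2 / cj \<alpha>)))"
      using Ra by blast
  next
    fix \<beta> \<delta> a b c assume "Q 1 \<beta> \<delta>" and Ra: "a \<in> \<Psi> \<and> c * (a ^ 3 - 1) = a * (b * cj b)"
    from defect_unipotent[OF this(1), of a c b] Ra
    show "a \<in> \<Psi> \<and> (c + a * cj \<delta> + (b + \<beta> * (cj a / a)) * cj \<beta> - \<beta> * cj b / a + \<delta> / cj a) * (a ^ 3 - 1)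
      = a * ((b + \<beta> * (cj a / a - a)) * cj (b + \<beta> * (cj a / a - a)))"
      by simp
  qed
  thus ?thesis by blast
qed

lemma L_mult: "x \<in> L_set q \<Longrightarrow> y \<in> L_set q \<Longrightarrow> x * y \<in> (L_set q :: 'f set)"
  unfolding L_set_def mem_Collect_eq by (metis no_zero_divisors power_mult_distrib)

lemma conj_class_L:
  assumes conj: "\<u> z \<in> conj_class N (\<u> y)" and y: "y \<noteq> 0"
  shows "z / y \<in> L_set q"
proof -
  \<comment> \<open>Dividing \<open>b\<close> by \<open>a\<close> compensates the scaling by
    \<Gamma>. With \<open>a\<close> in \<Gamma> the unipotent shift of \<open>b\<close> vanishes,
    which leaves the ratios of the torus.\<close>
  let ?R = "\<lambda>a b c. a \<in> \<Gamma> \<and> b / (a * y) \<in> L_set q"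
  have "?R 1 z (z * cj z * \<tau>)"
  proof (rule conj_class_invariant[OF Q_u Q_u conj, of ?R])
    show "?R 1 y (y * cj y * \<tau>)"
      using y Gamma_one by (auto simp: L_set_def intro!: exI[of _ 1])
  next
    fix l a b c assume "l \<in> \<Gamma>" "?R a b c"
    thus "?R (l * a) (l * b) (l * c)"
      using Gamma_nonzero Gamma_mult by auto
  next
    fix \<alpha> a b c :: 'f assume "\<alpha> \<noteq> 0" "?R a b c"
    moreover from \<open>\<alpha> \<noteq> 0\<close> have "\<alpha>\<^sup>2 / cj \<alpha> \<in> L_set q"
      using L_set_iff_ratio by blast
    ultimately show "?R a (b * (\<alpha>\<^sup>2 / cj \<alpha>)) (c * (\<alpha> * cj \<alpha>))"
      using L_mult[of "b / (a * y)" "\<alpha>\<^sup>2 / cj \<alpha>"] by (simp add: mult.commute)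
  next
    fix \<beta> \<delta> a b c assume R: "?R a b c"
    hence "cj a / a - a = 0"
      using Gamma_cj[of a] Gamma_nonzero[of a] by (simp add: power2_eq_square)
    thus "?R a (b + \<beta> * (cj a / a - a)) (c + a * cj \<delta> + (b + \<beta> * (cj a / a)) * cj \<beta> - \<beta> * cj b / a + \<delta> / cj a)"
      using R by simp
  qed
  thus ?thesis by simp
qed

section \<open>Normal forms for the arguments of a class function\<close>

definition class_fun :: "(('f^3^3) set \<Rightarrow> 'b) \<Rightarrow> bool"
  where "class_fun f \<longleftrightarrow> (\<forall>x\<in>carrier N. \<forall>y\<in>carrier N. f (x \<otimes>\<^bsub>N\<^esub> y \<otimes>\<^bsub>N\<^esub> inv\<^bsub>N\<^esub> x) = f y)"

lemma class_fun_torus: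
  "class_fun f \<Longrightarrow> Q a b c \<Longrightarrow> \<alpha> \<noteq> 0 \<Longrightarrow> f (H a (b * (\<alpha>\<^sup>2 / cj \<alpha>)) (c * (\<alpha> * cj \<alpha>))) = f (H a b c)"
  unfolding class_fun_def by (metis H_in_N Q_d conj_torus)

lemma class_fun_unipotent:
  "class_fun f \<Longrightarrow> Q a b c \<Longrightarrow> Q 1 \<beta> \<delta> \<Longrightarrow>
    f (H a (b + \<beta> * (cj a / a - a)) (c + a * cj \<delta> + (b + \<beta> * (cj a / a)) * cj \<beta> - \<beta> * cj b / a + \<delta> / cj a))
    = f (H a b c)"
  unfolding class_fun_def by (metis H_in_N conj_unipotent)

lemma class_fun_t:
  assumes f: "class_fun f" and Q: "Q a 0 c" and c: "c \<noteq> 0"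
  shows "f (H a 0 c) = f (\<t> a)"
proof -
  have a: "a \<noteq> 0" using Q Q_nonzero by blast
  \<comment> \<open>Both \<open>c / a\<close> and \<omega> change sign under \<open>cj\<close> up to
    the same factor needed for \<open>Q\<close>, so their quotient \<open>s\<close> is fixed by
    \<open>cj\<close> and is therefore a norm.\<close>
  define s where "s = c / (a * \<omega>)"
  have "cj s = s"
    using Q a \<omega>0 by (simp add: s_def Q_iff field_simps) (simp add: neg_eq_iff_add_eq_0)
  moreover have "s \<noteq> 0" using c a \<omega>0 by (simp add: s_def)
  ultimately obtain \<alpha> where \<alpha>: "\<alpha> \<noteq> 0" "\<alpha> * cj \<alpha> = s"
    using norm_surj by blast
  have "a * \<omega> * (\<alpha> * cj \<alpha>) = c"
    unfolding \<alpha> using a \<omega>0 by (simp add: s_def)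
  thus ?thesis
    using class_fun_torus[OF f Q_t[OF a] \<alpha>(1)] by simp
qed

text \<open>Outside \<Gamma> the second entry can be translated to zero. The last conclusion records
  the invariant quantity, which decides whether the new third entry is zero.\<close>

lemma class_fun_reduce:
  assumes Q: "Q a b c" and a: "a \<notin> \<Gamma>"
  obtains c' where "Q a 0 c'" "\<And>f. class_fun f \<Longrightarrow> f (H a b c) = f (H a 0 c')"
    "a \<in> \<Psi> \<Longrightarrow> c' * (a ^ 3 - 1) = c * (a ^ 3 - 1) - a * (b * cj b)"
proof -
  have a0: "a \<noteq> 0" using Q Q_nonzero by blast
  hence e: "cj a / a - a \<noteq> 0"
    using a by (simp add: Gamma_iff_cj_eq_square field_simps power2_eq_square)
  define \<beta> where "\<beta> = - b / (cj a / a - a)"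
  have b: "b + \<beta> * (cj a / a - a) = 0"
    using e by (simp add: \<beta>_def)
  note Q1 = Q_u[of \<beta>]
  show ?thesis
  proof (rule that)
    show "Q a 0 (c + a * cj (\<beta> * cj \<beta> * \<tau>) + (b + \<beta> * (cj a / a)) * cj \<beta> - \<beta> * cj b / a + \<beta> * cj \<beta> * \<tau> / cj a)"
      using Q_conj_unipotent[OF Q Q1] unfolding b .
  next
    fix f :: "_ \<Rightarrow> 'z" assume "class_fun f"
    from class_fun_unipotent[OF this Q Q1, symmetric, unfolded b]
    show "f (H a b c) = f (H a 0 (c + a * cj (\<beta> * cj \<beta> * \<tau>) + (b + \<beta> * (cj a / a)) * cj \<beta> - \<beta> * cj b / a + \<beta> * cj \<beta> * \<tau> / cj a))" .
  qed (use defect_unipotent[OF Q1, of a c b] in \<open>simp only: b cj_0 mult_zero_left mult_zero_right diff_zero\<close>)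
qed

lemma class_fun_generic:
  assumes f: "class_fun f" and Q: "Q a b c" and a: "a \<notin> \<Psi>"
  shows "f (H a b c) = f (\<d> a)"
proof -
  have "a \<notin> \<Gamma>" using a Gamma_subset_Psi by blast
  then obtain c' where c': "Q a 0 c'" "f (H a b c) = f (H a 0 c')"
    using class_fun_reduce[OF Q] f by metis
  have a0: "a \<noteq> 0" "1 - a * cj a \<noteq> 0" using Q a Q_nonzero by (auto simp: Psi_iff)
  \<comment> \<open>A central unipotent element has \<open>cj \<delta> = - \<delta>\<close>, so it
    changes the third entry by \<open>\<delta> * (1 - a * cj a) / cj a\<close>. The factor is
    nonzero for \<open>a\<close> outside \<Psi>, and this \<delta> cancels
    \<open>c'\<close>.\<close>
  define \<delta> where "\<delta> = - c' * cj a / (1 - a * cj a)"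
  have cc: "a * cj c' = - (c' * cj a)"
    using c'(1) by (simp add: Q_iff eq_neg_iff_add_eq_0)
  have \<delta>': "cj \<delta> = c' * cj a / (1 - a * cj a)"
  proof -
    have "cj \<delta> = - (a * cj c') / (1 - a * cj a)"
      by (simp add: \<delta>_def mult.commute)
    thus ?thesis by (simp only: cc minus_minus)
  qed
  have "Q 1 0 \<delta>"
    by (simp add: Q_iff \<delta>') (simp add: \<delta>_def)
  moreover have "c' + a * cj \<delta> + \<delta> / cj a = 0"
  proof -
    have "c' + a * cj \<delta> + \<delta> / cj a = (c' * (1 - a * cj a) + a * (c' * cj a) - c') / (1 - a * cj a)"
      unfolding \<delta>' using a0 by (simp add: \<delta>_def add_divide_distrib diff_divide_distrib)
    thus ?thesis by (simp add: algebra_simps)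
  qed
  ultimately have "f (H a 0 c') = f (\<d> a)"
    using class_fun_unipotent[OF f c'(1), of 0 \<delta>] by simp
  thus ?thesis using c' by simp
qed

lemma class_fun_Psi:
  assumes f: "class_fun f" and Q: "Q a b c" and a: "a \<in> \<Psi>" "a \<notin> \<Gamma>"
  shows "f (H a b c) = (if c * (a ^ 3 - 1) = a * (b * cj b) then f (\<d> a) else f (\<t> a))"
proof -
  have "a ^ 3 - 1 \<noteq> 0" using a Psi_Gamma_iff_cube by simp
  moreover obtain c' where "Q a 0 c'" "f (H a b c) = f (H a 0 c')"
    "c' * (a ^ 3 - 1) = c * (a ^ 3 - 1) - a * (b * cj b)"
    using class_fun_reduce[OF Q a(2)] f a(1) by metis
  ultimately show ?thesis
    using class_fun_t[OF f] by (cases "c' = 0") auto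
qed

text \<open>For \<open>a = 1\<close> the second entry does not move, while the third changes by
  \<open>b * cj \<beta> - \<beta> * cj b\<close> if the conjugating element is
  \<open>\<u> \<beta>\<close>. For \<open>b \<noteq> 0\<close> these differences are all elements
  with \<open>cj \<kappa> = - \<kappa>\<close>.\<close>

lemma class_fun_u:
  assumes f: "class_fun f" and Q: "Q 1 b c" and b: "b \<noteq> 0"
  shows "f (H 1 b c) = f (\<u> b)"
proof -
  define \<kappa> where "\<kappa> = b * cj b * \<tau> - c"
  have cc: "cj c = - c - b * cj b"
    using Q by (simp add: Q_iff eq_diff_eq eq_neg_iff_add_eq_0 add_ac)
  have \<kappa>: "cj \<kappa> = - \<kappa>"
    by (simp add: \<kappa>_def cc) (simp add: algebra_simps)
  \<comment> \<open>Chosen so that \<open>b * cj \<beta> = - \<kappa> * \<tau>\<close>. The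
    difference then equals \<open>- \<kappa> * (\<tau> + cj \<tau>)\<close>, which is \<kappa>
    because \<tau> has trace -1.\<close>
  define \<beta> where "\<beta> = cj (- \<kappa> * \<tau>) / cj b"
  have "b * cj \<beta> = - \<kappa> * \<tau>" "\<beta> * cj b = - \<kappa> - \<kappa> * \<tau>"
    using b by (simp_all add: \<beta>_def \<kappa>) (simp add: algebra_simps)
  hence "b * cj \<beta> - \<beta> * cj b = \<kappa>"
    by simp
  moreover have "cj (\<beta> * cj \<beta> * \<tau>) + \<beta> * cj \<beta> + \<beta> * cj \<beta> * \<tau> = 0"
    by (simp add: algebra_simps)
  ultimately have "c + cj (\<beta> * cj \<beta> * \<tau>) + (b + \<beta>) * cj \<beta> - \<beta> * cj b + \<beta> * cj \<beta> * \<tau> = b * cj b * \<tau>"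
    by (simp add: \<kappa>_def algebra_simps)
  thus ?thesis
    using class_fun_unipotent[OF f Q Q_u[of \<beta>]] by simp
qed

lemma class_fun_u_L:
  assumes f: "class_fun f" and "l \<in> L_set q"
  shows "f (\<u> (y * l)) = f (\<u> y)"
proof -
  obtain \<alpha> where \<alpha>: "\<alpha> \<noteq> 0" "l = \<alpha>\<^sup>2 / cj \<alpha>"
    using assms(2) L_set_iff_ratio by auto
  have "y * l * cj (y * l) * \<tau> = y * cj y * \<tau> * (\<alpha> * cj \<alpha>)"
    unfolding \<alpha>(2) using \<alpha>(1) by (simp add: field_simps power2_eq_square)
  thus ?thesis
    using class_fun_torus[OF f Q_u \<alpha>(1)] \<alpha>(2) by simp
qed

end

section \<open>Class sums and their products\<close>

text \<open>The argument \<open>k_type\<close> fixes the coefficient type \<open>'k\<close>, which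
  the parameters of \<open>hermitian_setup\<close> do not mention.\<close>

locale hermitian_algebra = hermitian_setup p r q \<omega> \<tau>
  for p r q :: nat and \<omega> \<tau> :: "'f::field" +
  fixes k_type :: "'k::field itself"
  assumes char_k: "CHAR('k) = p"
begin

abbreviation lk :: "(('f^3^3) set \<Rightarrow>\<^sub>0 'k) \<Rightarrow> ('f^3^3) set \<Rightarrow> 'k" where "lk \<equiv> Poly_Mapping.lookup"
abbreviation Z :: "(('f^3^3) set \<Rightarrow>\<^sub>0 'k) ring" where "Z \<equiv> ZkN q"
abbreviation \<D> :: "'f \<Rightarrow> (('f^3^3) set \<Rightarrow>\<^sub>0 'k)" where "\<D> \<equiv> D_elt q"
abbreviation \<T> :: "'f \<Rightarrow> (('f^3^3) set \<Rightarrow>\<^sub>0 'k)" where "\<T> \<equiv> T_elt q \<omega>"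
abbreviation \<U> :: "'f \<Rightarrow> (('f^3^3) set \<Rightarrow>\<^sub>0 'k)" where "\<U> \<equiv> U_elt q \<tau>"

lemma q_eq_0: "(of_nat q :: 'k) = 0"
  using p r of_nat_CHAR[where 'a='k] by (simp add: q char_k)

lemma Z_iff: "f \<in> carrier Z \<longleftrightarrow> f \<in> carrier (group_algebra N) \<and> class_fun (lk f)"
  by (simp add: ZkN_def centre_group_algebra_iff[OF group_N fin_N] class_fun_def)

lemma Z_class_fun: "f \<in> carrier Z \<Longrightarrow> class_fun (lk f)"
  by (simp add: Z_iff)

lemma Z_ops: "\<zero>\<^bsub>Z\<^esub> = 0" "f \<oplus>\<^bsub>Z\<^esub> g = f + g" "f \<otimes>\<^bsub>Z\<^esub> g = f \<otimes>\<^bsub>group_algebra N\<^esub> g" "\<one>\<^bsub>Z\<^esub> = Id_elt q"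
  by (simp_all add: ZkN_def ring_centre_def group_algebra_def Id_elt_def)

sublocale Z: cring Z
  unfolding ZkN_def by (rule cring_ring_centre[OF ring_group_algebra[OF group_N fin_N]])

lemma Z_add: "f \<in> carrier Z \<Longrightarrow> g \<in> carrier Z \<Longrightarrow> f + g \<in> carrier Z"
  using Z.a_closed by (simp add: Z_ops)

lemma Z_zero: "0 \<in> carrier Z"
  using Z.zero_closed by (simp add: Z_ops)

lemma Z_scale: "f \<in> carrier Z \<Longrightarrow> ga_scale c f \<in> carrier Z"
  using ga_scale_mult(1)[OF group_N fin_N] by (auto simp: Z_iff class_fun_def lookup_ga_scale)

lemma Z_diff: "f \<in> carrier Z \<Longrightarrow> g \<in> carrier Z \<Longrightarrow> f - g \<in> carrier Z"
  using Z_add[of f "ga_scale (-1) g"] Z_scale[of g "-1"] by simp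

lemma Z_subspace: "ga.subspace (carrier Z)"
  by (auto simp: ga.subspace_def Z_add Z_zero Z_scale)

lemma Z_mult_scale:
  assumes "f \<in> carrier Z" "g \<in> carrier Z"
  shows "ga_scale c f \<otimes>\<^bsub>Z\<^esub> g = ga_scale c (f \<otimes>\<^bsub>Z\<^esub> g)" "f \<otimes>\<^bsub>Z\<^esub> ga_scale c g = ga_scale c (f \<otimes>\<^bsub>Z\<^esub> g)"
  using ga_scale_mult(2,3)[OF group_N fin_N] assms by (auto simp: Z_iff Z_ops)

lemma Z_distrib:
  assumes "f \<in> carrier Z" "g \<in> carrier Z" "h \<in> carrier Z"
  shows "(f + g) \<otimes>\<^bsub>Z\<^esub> h = f \<otimes>\<^bsub>Z\<^esub> h + g \<otimes>\<^bsub>Z\<^esub> h" "h \<otimes>\<^bsub>Z\<^esub> (f + g) = h \<otimes>\<^bsub>Z\<^esub> f + h \<otimes>\<^bsub>Z\<^esub> g"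
  using Z.l_distr[OF assms] Z.r_distr[OF assms] by (simp_all add: Z_ops(2))

lemma H_normalise:
  assumes "a \<in> \<Gamma>" "Q a b c"
  shows "H a b c = H 1 (b / a) (c / a)" "Q 1 (b / a) (c / a)"
proof -
  have l: "1 / a \<in> \<Gamma>" using Gamma_divide[OF Gamma_one assms(1)] .
  show "H a b c = H 1 (b / a) (c / a)"
    unfolding H_eq_iff using l Gamma_nonzero[OF assms(1)] by (intro bexI[of _ "1 / a"]) auto
  show "Q 1 (b / a) (c / a)"
    using Q_scale[OF l assms(2)] Gamma_nonzero[OF assms(1)] by simp
qed

text \<open>The representatives \<open>\<d> a\<close>, \<open>\<t> a\<close> with \<open>a\<close>
  in \<Psi>, and \<open>\<u> y\<close> meet every class. This is the means by which central elements
  are compared throughout.\<close>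

lemma Z_eq_0I:
  assumes f: "f \<in> carrier Z" and d: "\<And>a. a \<noteq> 0 \<Longrightarrow> lk f (\<d> a) = 0"
    and t: "\<And>a. a \<in> \<Psi> \<Longrightarrow> lk f (\<t> a) = 0" and u: "\<And>y. y \<noteq> 0 \<Longrightarrow> lk f (\<u> y) = 0"
  shows "f = 0"
proof (rule poly_mapping_eqI)
  fix x
  note cf = Z_class_fun[OF f]
  show "lk f x = lk 0 x"
  proof (cases "x \<in> carrier N")
    case False
    thus ?thesis using f lookup_group_algebra_outside[of f N x] by (simp add: Z_iff)
  next
    case True
    then obtain a b c where Q: "Q a b c" and x: "x = H a b c"
      by (auto simp: N_carrier)
    note a = Q_nonzero[OF Q]
    consider "a \<notin> \<Psi>" | "a \<in> \<Psi>" "a \<notin> \<Gamma>" | "a \<in> \<Gamma>" by blast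
    thus ?thesis
    proof cases
      case 1
      thus ?thesis using class_fun_generic[OF cf Q] d[OF a] x by simp
    next
      case 2
      thus ?thesis using class_fun_Psi[OF cf Q 2] d[OF a] t x by simp
    next
      case 3
      note H = H_normalise[OF 3 Q]
      consider "b \<noteq> 0" | "b = 0" "c \<noteq> 0" | "b = 0" "c = 0" by blast
      thus ?thesis
      proof cases
        case 1
        thus ?thesis using class_fun_u[OF cf H(2)] H(1) u[of "b / a"] a x by simp
      next
        case 2
        thus ?thesis using class_fun_t[OF cf, of 1 "c / a"] H t[of 1] a x by (simp add: Psi_iff)
      next
        case 3
        thus ?thesis using d[OF a] x by simp
      qed
    qed
  qed
qed

lemma lk_class_sum:
  "Q a b c \<Longrightarrow> lk (class_sum N (H a b c)) x = (if x \<in> conj_class N (H a b c) then 1 else 0)"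
  by (rule lookup_class_sum[OF group_N fin_N H_in_N])

lemma class_sum_Z: "Q a b c \<Longrightarrow> class_sum N (H a b c) \<in> carrier Z"
  unfolding ZkN_def by (rule class_sum_centre[OF group_N fin_N H_in_N])

lemma D_Z: "x \<noteq> 0 \<Longrightarrow> \<D> x \<in> carrier Z"
  unfolding D_elt_def by (intro class_sum_Z Q_d)

lemma T_Z: "x \<noteq> 0 \<Longrightarrow> \<T> x \<in> carrier Z"
  unfolding T_elt_def by (intro class_sum_Z Q_t)

lemma U_Z: "\<U> y \<in> carrier Z"
  unfolding U_elt_def by (intro class_sum_Z Q_u)

lemma Id_Z: "Id_elt q \<in> carrier Z"
  using Z.one_closed by (simp add: Z_ops)

lemma conj_self: "Q a b c \<Longrightarrow> H a b c \<in> conj_class N (H a b c)"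
  by (rule conj_class_self[OF group_N fin_N H_in_N])

lemma conj_sym: "Q a b c \<Longrightarrow> h \<in> conj_class N (H a b c) \<Longrightarrow> H a b c \<in> conj_class N h"
  by (rule conj_class_sym[OF group_N fin_N H_in_N])

lemma Psi_nonzero: "x \<in> \<Psi> \<Longrightarrow> x \<noteq> 0"
  using Psi_cj by blast

lemma Psi_if_ratio: "a / x \<in> \<Gamma> \<Longrightarrow> x \<noteq> 0 \<Longrightarrow> a \<in> \<Psi> \<longleftrightarrow> x \<in> \<Psi>"
proof -
  assume r: "a / x \<in> \<Gamma>" and x: "x \<noteq> 0"
  hence P: "a / x \<in> \<Psi>" and a: "a \<noteq> 0" using Gamma_subset_Psi Gamma_nonzero[OF r] by auto
  show ?thesis
    using Psi_mult[OF P, of x] Psi_divide[OF _ P, of a] x a by auto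
qed

lemma Gamma_if_ratio: "a / x \<in> \<Gamma> \<Longrightarrow> x \<noteq> 0 \<Longrightarrow> a \<in> \<Gamma> \<longleftrightarrow> x \<in> \<Gamma>"
proof -
  assume P: "a / x \<in> \<Gamma>" and x: "x \<noteq> 0"
  have a: "a \<noteq> 0" using Gamma_nonzero[OF P] by auto
  show ?thesis
    using Gamma_mult[OF P, of x] Gamma_divide[OF _ P, of a] x a by auto
qed

lemma Gamma_ratio_sym: "a / x \<in> \<Gamma> \<longleftrightarrow> x / a \<in> \<Gamma>"
  using Gamma_divide[OF Gamma_one, of "a / x"] Gamma_divide[OF Gamma_one, of "x / a"] by auto

section \<open>Coefficients of the class sums at the representatives\<close>

lemma lookup_D_d: "x \<noteq> 0 \<Longrightarrow> a \<noteq> 0 \<Longrightarrow> lk (\<D> x) (\<d> a) = (if a / x \<in> \<Gamma> then 1 else 0)"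
proof -
  assume x: "x \<noteq> 0" and a: "a \<noteq> 0"
  have "\<d> a \<in> conj_class N (\<d> x)" if "a / x \<in> \<Gamma>"
  proof -
    have "\<d> x = \<d> a" unfolding H_eq_iff using that x by (intro bexI[of _ "a / x"]) auto
    thus ?thesis using conj_self[OF Q_d[OF a]] by simp
  qed
  thus ?thesis
    using conj_class_diag_part[OF Q_d[OF x] Q_d[OF a]] by (auto simp: D_elt_def lk_class_sum[OF Q_d[OF x]])
qed

text \<open>The quantity \<open>c * (a ^ 3 - 1) - a * (b * cj b)\<close> is zero on the class of
  \<open>\<d> x\<close> for \<open>x\<close> in \<Psi>, but at \<open>\<t> a\<close> it is
  \<open>a * \<omega> * (a ^ 3 - 1)\<close>, nonzero outside \<Gamma>.\<close>

lemma lookup_D_t: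
  assumes x: "x \<noteq> 0" "x \<notin> \<Gamma>" and a: "a \<in> \<Psi>"
  shows "lk (\<D> x) (\<t> a) = 0"
proof -
  note a0 = Psi_nonzero[OF a]
  have "\<t> a \<notin> conj_class N (\<d> x)"
  proof
    assume c: "\<t> a \<in> conj_class N (\<d> x)"
    note r = conj_class_diag_part[OF Q_d[OF x(1)] Q_t[OF a0] c]
    have "a * \<omega> * (a ^ 3 - 1) = 0"
      using conj_class_defect[OF Q_d[OF x(1)] Q_t[OF a0] c] Psi_if_ratio[OF r x(1)] a by simp
    hence "a \<in> \<Gamma>" using a a0 \<omega>0 by (simp add: Psi_Gamma_iff_cube)
    thus False using Gamma_if_ratio[OF r x(1)] x(2) by blast
  qed
  thus ?thesis by (simp add: D_elt_def lk_class_sum[OF Q_d[OF x(1)]])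
qed

lemma lookup_D_u:
  assumes x: "x \<noteq> 0" "x \<notin> \<Gamma>"
  shows "lk (\<D> x) (\<u> y) = 0"
proof -
  have "\<u> y \<notin> conj_class N (\<d> x)"
    using conj_class_diag_part[OF Q_d[OF x(1)] Q_u] Gamma_if_ratio[OF _ x(1), of 1] x Gamma_one by blast
  thus ?thesis by (simp add: D_elt_def lk_class_sum[OF Q_d[OF x(1)]])
qed

lemma lookup_T_d:
  assumes x: "x \<in> \<Psi>" and a: "a \<noteq> 0"
  shows "lk (\<T> x) (\<d> a) = 0"
proof -
  note x0 = Psi_nonzero[OF x]
  have "\<d> a \<notin> conj_class N (\<t> x)"
  proof
    assume c: "\<d> a \<in> conj_class N (\<t> x)"
    note r = conj_class_diag_part[OF Q_t[OF x0] Q_d[OF a] c]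
    note c' = conj_sym[OF Q_t[OF x0] c]
    show False
    \<comment> \<open>Over \<Gamma> the invariant cannot separate the two points, as
      \<open>x ^ 3 = 1\<close> there; but then \<open>\<d> a\<close> is the identity, which is alone
      in its class.\<close>
    proof (cases "a \<in> \<Gamma>")
      case True
      have "\<d> a = \<one>\<^bsub>N\<^esub>"
        using H_normalise[OF True Q_d[OF a]] by (simp add: N_one)
      with c' obtain g where "g \<in> carrier N" "\<t> x = g \<otimes>\<^bsub>N\<^esub> \<one>\<^bsub>N\<^esub> \<otimes>\<^bsub>N\<^esub> inv\<^bsub>N\<^esub> g"
        by (auto simp: conj_class_def)
      hence "\<t> x = H 1 0 0"
        by (simp add: N_one[symmetric])
      thus False
        using x0 \<omega>0 by (auto simp: H_eq_iff dest: Gamma_nonzero)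
    next
      case False
      have "x * \<omega> * (x ^ 3 - 1) = 0"
        using conj_class_defect[OF Q_d[OF a] Q_t[OF x0] c'] Psi_if_ratio[OF r x0] x by simp
      hence "x \<in> \<Gamma>" using x x0 \<omega>0 by (simp add: Psi_Gamma_iff_cube)
      thus False using Gamma_if_ratio[OF r x0] False by blast
    qed
  qed
  thus ?thesis by (simp add: T_elt_def lk_class_sum[OF Q_t[OF x0]])
qed

lemma lookup_T_t:
  assumes x: "x \<noteq> 0" and a: "a \<noteq> 0"
  shows "lk (\<T> x) (\<t> a) = (if a / x \<in> \<Gamma> then 1 else 0)"
proof -
  have "\<t> a \<in> conj_class N (\<t> x)" if "a / x \<in> \<Gamma>"
  proof -
    have "\<t> x = \<t> a" unfolding H_eq_iff using that x by (intro bexI[of _ "a / x"]) auto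
    thus ?thesis using conj_self[OF Q_t[OF a]] by simp
  qed
  thus ?thesis
    using conj_class_diag_part[OF Q_t[OF x] Q_t[OF a]] by (auto simp: T_elt_def lk_class_sum[OF Q_t[OF x]])
qed

text \<open>At diagonal entry 1 the equation of \<open>conj_class_defect\<close> reads
  \<open>0 = y * cj y\<close>.\<close>

lemma u_not_conj_d: "a \<noteq> 0 \<Longrightarrow> y \<noteq> 0 \<Longrightarrow> \<u> y \<notin> conj_class N (\<d> a)"
proof
  assume a: "a \<noteq> 0" and y: "y \<noteq> 0" and c: "\<u> y \<in> conj_class N (\<d> a)"
  have "1 / a \<in> \<Gamma>"
    using conj_class_diag_part[OF Q_d[OF a] Q_u c] .
  hence "a \<in> \<Psi>"
    using Psi_if_ratio[of 1 a] a by (simp add: Psi_iff)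
  from conj_class_defect[OF Q_d[OF a] Q_u c this] y show False by simp
qed

lemma u_not_conj_t: "a \<in> \<Psi> \<Longrightarrow> y \<noteq> 0 \<Longrightarrow> \<u> y \<notin> conj_class N (\<t> a)"
proof
  assume a: "a \<in> \<Psi>" and y: "y \<noteq> 0" and c: "\<u> y \<in> conj_class N (\<t> a)"
  note a0 = Psi_nonzero[OF a]
  have "1 / a \<in> \<Gamma>"
    using conj_class_diag_part[OF Q_t[OF a0] Q_u c] .
  hence "a ^ 3 = 1"
    using Gamma_if_ratio[of 1 a] a0 Gamma_one by (simp add: Gamma_iff)
  with conj_class_defect[OF Q_t[OF a0] Q_u c a] y show False by simp
qed

lemma lookup_T_u: "x \<in> \<Psi> \<Longrightarrow> y \<noteq> 0 \<Longrightarrow> lk (\<T> x) (\<u> y) = 0"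
  using u_not_conj_t by (simp add: T_elt_def lk_class_sum[OF Q_t[OF Psi_nonzero]])

lemma lookup_U_d: "a \<noteq> 0 \<Longrightarrow> y \<noteq> 0 \<Longrightarrow> lk (\<U> y) (\<d> a) = 0"
  using u_not_conj_d conj_sym[OF Q_u] by (auto simp: U_elt_def lk_class_sum[OF Q_u])

lemma lookup_U_t: "a \<in> \<Psi> \<Longrightarrow> y \<noteq> 0 \<Longrightarrow> lk (\<U> y) (\<t> a) = 0"
  using u_not_conj_t conj_sym[OF Q_u] by (auto simp: U_elt_def lk_class_sum[OF Q_u])

lemma lookup_U_u: "y \<noteq> 0 \<Longrightarrow> lk (\<U> y) (\<u> z) = (if z / y \<in> L_set q then 1 else 0)"
proof -
  assume y: "y \<noteq> 0"
  have "lk (\<U> y) (\<u> (y * (z / y))) = lk (\<U> y) (\<u> y)" if "z / y \<in> L_set q"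
    by (rule class_fun_u_L[OF Z_class_fun[OF U_Z] that])
  hence "lk (\<U> y) (\<u> z) = lk (\<U> y) (\<u> y)" if "z / y \<in> L_set q"
    using that y by simp
  thus ?thesis
    using conj_class_L[OF _ y, of z] conj_self[OF Q_u[of y]]
    by (auto simp: U_elt_def lk_class_sum[OF Q_u])
qed

lemma Id_values:
  "a \<noteq> 0 \<Longrightarrow> lk (Id_elt q) (\<d> a) = (if a \<in> \<Gamma> then 1 else 0)"
  "a \<noteq> 0 \<Longrightarrow> lk (Id_elt q) (\<t> a) = 0"
  "y \<noteq> 0 \<Longrightarrow> lk (Id_elt q) (\<u> y) = 0"
  using \<omega>0 by (auto simp: Id_elt_def lookup_single when_def N_one H_eq_iff)

end

section \<open>The class of \<open>\<d> x\<close> for \<open>x\<close> in \<Psi> - \<Gamma>,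
  parametrised by the field\<close>

context hermitian_setup
begin

text \<open>The third entry is the one for which \<open>c (x\<^sup>3 - 1) - x b b\<^sup>q\<close> vanishes.\<close>

definition dconj :: "'f \<Rightarrow> 'f \<Rightarrow> ('f^3^3) set"
  where "dconj x b = H x b (x * (b * cj b) / (x ^ 3 - 1))"

text \<open>The norm of \<open>b\<close> factors out of the hermitian condition. As
  \<open>cj x = 1 / x\<close>, what remains is the identity
  \<open>1 + X / (1 - X) + 1 / (X - 1) = 0\<close> with \<open>X = x ^ 3\<close>.\<close>

lemma Q_dconj:
  assumes "x \<in> \<Psi>" "x \<notin> \<Gamma>"
  shows "Q x b (x * (b * cj b) / (x ^ 3 - 1))"
proof -
  note x = Psi_cj[OF assms(1)]
  have n: "x ^ 3 - 1 \<noteq> 0" "1 - x ^ 3 \<noteq> 0" using assms Psi_Gamma_iff_cube by auto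
  have e1: "x * cj (x * (b * cj b) / (x ^ 3 - 1)) = (b * cj b) * (x ^ 3 / (1 - x ^ 3))"
    using x(1) n by (simp add: x(2) power_divide divide_simps)
  have e2: "x * (b * cj b) / (x ^ 3 - 1) * cj x = (b * cj b) * (1 / (x ^ 3 - 1))"
    using x(1) n by (simp add: x(2))
  have e3: "x ^ 3 / (1 - x ^ 3) + 1 / (x ^ 3 - 1) = -1"
    using n by (simp add: divide_simps) (simp add: algebra_simps)
  have "b * cj b + x * cj (x * (b * cj b) / (x ^ 3 - 1)) + x * (b * cj b) / (x ^ 3 - 1) * cj x
    = (b * cj b) * (1 + (x ^ 3 / (1 - x ^ 3) + 1 / (x ^ 3 - 1)))"
    unfolding e1 e2 distrib_left mult_1_right add.assoc ..
  also have "\<dots> = 0"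
    unfolding e3 by simp
  finally show ?thesis using x(1) by (simp add: Q_iff)
qed

lemma inj_dconj: "x \<noteq> 0 \<Longrightarrow> inj (dconj x)"
  by (rule injI) (auto simp: dconj_def H_eq_iff)

text \<open>The invariant quantity stays zero under conjugation, and its vanishing determines the
  third entry from the second. So only the translation of the second entry is left to
  record.\<close>

lemma dconj_conj:
  assumes x: "x \<in> \<Psi>" "x \<notin> \<Gamma>" and Q: "Q 1 \<beta> \<delta>"
  shows "H 1 \<beta> \<delta> \<otimes>\<^bsub>N\<^esub> dconj x b \<otimes>\<^bsub>N\<^esub> inv\<^bsub>N\<^esub> (H 1 \<beta> \<delta>) = dconj x (b + \<beta> * (cj x / x - x))"
proof -
  have n: "x ^ 3 - 1 \<noteq> 0" using x Psi_Gamma_iff_cube by auto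
  define c where "c = x * (b * cj b) / (x ^ 3 - 1)"
  define b' where "b' = b + \<beta> * (cj x / x - x)"
  define c' where "c' = c + x * cj \<delta> + (b + \<beta> * (cj x / x)) * cj \<beta> - \<beta> * cj b / x + \<delta> / cj x"
  have "c' * (x ^ 3 - 1) - x * (b' * cj b') = c * (x ^ 3 - 1) - x * (b * cj b)"
    unfolding c'_def b'_def by (rule defect_unipotent[OF Q x(1)])
  also have "\<dots> = 0" using n by (simp add: c_def)
  finally have "c' = x * (b' * cj b') / (x ^ 3 - 1)"
    using n by (simp add: eq_divide_eq)
  moreover have "H 1 \<beta> \<delta> \<otimes>\<^bsub>N\<^esub> H x b c \<otimes>\<^bsub>N\<^esub> inv\<^bsub>N\<^esub> (H 1 \<beta> \<delta>) = H x b' c'"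
    unfolding c'_def b'_def c_def by (rule conj_unipotent[OF Q_dconj[OF x] Q])
  ultimately show ?thesis by (simp add: dconj_def c_def b'_def)
qed

text \<open>One inclusion is \<open>conj_class_defect\<close>. For the other, the translations of
  \<open>dconj_conj\<close> act transitively on the index because \<open>cj x / x - x\<close> is
  nonzero outside \<Gamma>.\<close>

lemma conj_class_d:
  assumes x: "x \<in> \<Psi>" "x \<notin> \<Gamma>"
  shows "conj_class N (\<d> x) = range (dconj x)"
proof
  have n: "x ^ 3 - 1 \<noteq> 0" using x Psi_Gamma_iff_cube by auto
  note x0 = Psi_cj(1)[OF x(1)]
  show "conj_class N (\<d> x) \<subseteq> range (dconj x)"
  proof
    fix h assume h: "h \<in> conj_class N (\<d> x)"
    have "h \<in> carrier N"
      using conj_class_subset[OF group_N fin_N H_in_N[OF Q_d[OF x0]]] h by blast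
    then obtain a b c where Q: "Q a b c" and habc: "h = H a b c"
      by (auto simp: N_carrier)
    have r: "a / x \<in> \<Gamma>"
      using conj_class_diag_part[OF Q_d[OF x0] Q] h habc by simp
    define l where "l = x / a"
    have a0: "a \<noteq> 0" using Q Q_nonzero by blast
    have l: "l \<in> \<Gamma>"
      using Gamma_divide[OF Gamma_one r] by (simp add: l_def)
    have hx: "h = H x (l * b) (l * c)"
      unfolding habc H_eq_iff using l a0 by (intro bexI[of _ l]) (auto simp: l_def)
    have Q': "Q x (l * b) (l * c)"
      using Q_scale[OF l Q] a0 by (simp add: l_def)
    have "l * c * (x ^ 3 - 1) = x * (l * b * cj (l * b))"
      using conj_class_defect[OF Q_d[OF x0] Q' _ x(1)] h hx by simp
    hence "l * c = x * (l * b * cj (l * b)) / (x ^ 3 - 1)"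
      using n by (simp add: eq_divide_eq)
    hence "h = dconj x (l * b)" unfolding hx dconj_def by simp
    thus "h \<in> range (dconj x)" by blast
  qed
  show "range (dconj x) \<subseteq> conj_class N (\<d> x)"
  proof safe
    fix b
    have e: "cj x / x - x \<noteq> 0"
      using x(2) x0 by (simp add: Gamma_iff_cj_eq_square field_simps power2_eq_square)
    define \<beta> where "\<beta> = b / (cj x / x - x)"
    have "H 1 \<beta> (\<beta> * cj \<beta> * \<tau>) \<otimes>\<^bsub>N\<^esub> dconj x 0 \<otimes>\<^bsub>N\<^esub> inv\<^bsub>N\<^esub> (H 1 \<beta> (\<beta> * cj \<beta> * \<tau>)) = dconj x b"
      unfolding dconj_conj[OF x Q_u] using e by (simp add: \<beta>_def)
    moreover have "dconj x 0 = \<d> x" by (simp add: dconj_def)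
    ultimately show "dconj x b \<in> conj_class N (\<d> x)"
      unfolding conj_class_def using H_in_N[OF Q_u[of \<beta>]] by force
  qed
qed

end

context hermitian_algebra
begin

text \<open>The factors are exchanged first, so that the summation variable of the convolution runs
  over the class of \<open>\<d> x\<close>, hence over the field.\<close>

lemma mult_D:
  assumes f: "f \<in> carrier Z" and x: "x \<in> \<Psi>" "x \<notin> \<Gamma>" and v: "v \<in> carrier N"
  shows "lk (f \<otimes>\<^bsub>Z\<^esub> \<D> x) v = (\<Sum>b\<in>UNIV. lk f (inv\<^bsub>N\<^esub> (dconj x b) \<otimes>\<^bsub>N\<^esub> v))"
proof -
  note x0 = Psi_nonzero[OF x(1)]
  have "lk (f \<otimes>\<^bsub>Z\<^esub> \<D> x) v = lk (\<D> x \<otimes>\<^bsub>Z\<^esub> f) v"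
    using Z.m_comm[OF f D_Z[OF x0]] by simp
  also have "\<dots> = (\<Sum>y\<in>carrier N. lk (\<D> x) y * lk f (inv\<^bsub>N\<^esub> y \<otimes>\<^bsub>N\<^esub> v))"
    using f D_Z[OF x0] v by (simp add: Z_ops Z_iff lookup_group_algebra_mult[OF group_N fin_N])
  also have "\<dots> = (\<Sum>y\<in>range (dconj x). lk f (inv\<^bsub>N\<^esub> y \<otimes>\<^bsub>N\<^esub> v))"
  proof (rule sum.mono_neutral_cong_right[OF fin_N])
    show "range (dconj x) \<subseteq> carrier N"
      using conj_class_subset[OF group_N fin_N H_in_N[OF Q_d[OF x0]]] conj_class_d[OF x] by simp
  qed (simp_all add: D_elt_def lk_class_sum[OF Q_d[OF x0]] conj_class_d[OF x])
  also have "\<dots> = (\<Sum>b\<in>UNIV. lk f (inv\<^bsub>N\<^esub> (dconj x b) \<otimes>\<^bsub>N\<^esub> v))"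
    using inj_dconj[OF x0] by (subst sum.reindex) (auto simp: inj_on_def)
  finally show ?thesis .
qed

text \<open>Every element of the unipotent part commutes with some element of it that is not in its centre, and
  conjugation by the latter acts on the index of the sum in \<open>mult_D\<close> as a nontrivial translation.\<close>

lemma mult_D_translation:
  assumes f: "f \<in> carrier Z" and x: "x \<in> \<Psi>" "x \<notin> \<Gamma>" and v: "v \<in> carrier N"
    and Q: "Q 1 \<beta> \<delta>" "\<beta> \<noteq> 0"
    and comm: "H 1 \<beta> \<delta> \<otimes>\<^bsub>N\<^esub> v \<otimes>\<^bsub>N\<^esub> inv\<^bsub>N\<^esub> (H 1 \<beta> \<delta>) = v"
  shows "lk (f \<otimes>\<^bsub>Z\<^esub> \<D> x) v = 0"
proof -
  note x0 = Psi_nonzero[OF x(1)]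
  define h where "h = H 1 \<beta> \<delta>"
  have h: "h \<in> carrier N" using Q by (simp add: h_def H_in_N)
  have w: "dconj x b \<in> carrier N" for b
    unfolding dconj_def by (rule H_in_N[OF Q_dconj[OF x]])
  let ?e = "\<beta> * (cj x / x - x)"
  have "?e \<noteq> 0"
    using x(2) x0 Q(2) by (simp add: Gamma_iff_cj_eq_square field_simps power2_eq_square)
  moreover have "lk f (inv\<^bsub>N\<^esub> (dconj x (?e + b)) \<otimes>\<^bsub>N\<^esub> v) = lk f (inv\<^bsub>N\<^esub> (dconj x b) \<otimes>\<^bsub>N\<^esub> v)" for b
  proof -
    have "inv\<^bsub>N\<^esub> (dconj x (?e + b)) \<otimes>\<^bsub>N\<^esub> v
      = inv\<^bsub>N\<^esub> (h \<otimes>\<^bsub>N\<^esub> dconj x b \<otimes>\<^bsub>N\<^esub> inv\<^bsub>N\<^esub> h) \<otimes>\<^bsub>N\<^esub> (h \<otimes>\<^bsub>N\<^esub> v \<otimes>\<^bsub>N\<^esub> inv\<^bsub>N\<^esub> h)"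
      using dconj_conj[OF x Q(1), of b] comm by (simp add: h_def add.commute)
    also have "\<dots> = h \<otimes>\<^bsub>N\<^esub> (inv\<^bsub>N\<^esub> (dconj x b) \<otimes>\<^bsub>N\<^esub> ((inv\<^bsub>N\<^esub> h \<otimes>\<^bsub>N\<^esub> h) \<otimes>\<^bsub>N\<^esub> v)) \<otimes>\<^bsub>N\<^esub> inv\<^bsub>N\<^esub> h"
      using h w v by (simp add: N.inv_mult_group N.m_assoc del: N.l_inv N.Units_l_inv)
    also have "\<dots> = h \<otimes>\<^bsub>N\<^esub> (inv\<^bsub>N\<^esub> (dconj x b) \<otimes>\<^bsub>N\<^esub> v) \<otimes>\<^bsub>N\<^esub> inv\<^bsub>N\<^esub> h"
      using h v by simp
    finally show ?thesis
      using Z_class_fun[OF f] h w v by (simp add: class_fun_def)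
  qed
  ultimately show ?thesis
    unfolding mult_D[OF f x v] by (rule sum_translation_invariant_eq_0[OF fin char_f char_k p])
qed

text \<open>The commuting elements fed to \<open>mult_D_translation\<close> are
  \<open>H 1 1 \<tau>\<close>, which is \<open>\<u> 1\<close>, for the central points
  \<open>\<d> 1\<close> and \<open>\<t> 1\<close>, and \<open>\<u> y\<close> itself for
  \<open>\<u> y\<close>.\<close>

lemma mult_D_unipotent:
  assumes f: "f \<in> carrier Z" and x: "x \<in> \<Psi>" "x \<notin> \<Gamma>"
  shows "lk (f \<otimes>\<^bsub>Z\<^esub> \<D> x) (\<d> 1) = 0" "lk (f \<otimes>\<^bsub>Z\<^esub> \<D> x) (\<t> 1) = 0"
    "y \<noteq> 0 \<Longrightarrow> lk (f \<otimes>\<^bsub>Z\<^esub> \<D> x) (\<u> y) = 0"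
proof -
  have c: "H 1 1 \<tau> \<otimes>\<^bsub>N\<^esub> H 1 0 c \<otimes>\<^bsub>N\<^esub> inv\<^bsub>N\<^esub> (H 1 1 \<tau>) = H 1 0 c" if "Q 1 0 c" for c
    using conj_unipotent[OF that Q_u[of 1]] by simp
  show "lk (f \<otimes>\<^bsub>Z\<^esub> \<D> x) (\<d> 1) = 0" "lk (f \<otimes>\<^bsub>Z\<^esub> \<D> x) (\<t> 1) = 0"
    using mult_D_translation[OF f x, of _ 1 \<tau>] c[OF Q_d] c[of \<omega>] Q_t[of 1] Q_u[of 1]
      H_in_N[OF Q_d[of 1]] H_in_N[OF Q_t[of 1]]
    by auto
  have u: "\<u> y \<in> carrier N" by (rule H_in_N[OF Q_u])
  have "\<u> y \<otimes>\<^bsub>N\<^esub> \<u> y \<otimes>\<^bsub>N\<^esub> inv\<^bsub>N\<^esub> (\<u> y) = \<u> y"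
    unfolding N.m_assoc[OF u u N.inv_closed[OF u]] N.r_inv[OF u] N.r_one[OF u] ..
  thus "y \<noteq> 0 \<Longrightarrow> lk (f \<otimes>\<^bsub>Z\<^esub> \<D> x) (\<u> y) = 0"
    by (intro mult_D_translation[OF f x u Q_u])
qed

lemma inv_dconj_mult:
  assumes x: "x \<in> \<Psi>" "x \<notin> \<Gamma>" and a: "a \<noteq> 0"
  shows "inv\<^bsub>N\<^esub> (dconj x b) \<otimes>\<^bsub>N\<^esub> H a 0 c = H (a / x) (- (b * x * (cj a / a)))
    (c / x + x\<^sup>2 * (b * cj b) / (1 - x ^ 3) / cj a)"
proof -
  note xc = Psi_cj[OF x(1)]
  have n: "x ^ 3 - 1 \<noteq> 0" "1 - x ^ 3 \<noteq> 0" using x Psi_Gamma_iff_cube by auto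
  have "cj (x * (b * cj b) / (x ^ 3 - 1)) = x\<^sup>2 * (b * cj b) / (1 - x ^ 3)"
    using xc(1) n by (simp add: xc(2) power_divide divide_simps) (simp add: algebra_simps power2_eq_square power3_eq_cube)
  thus ?thesis
    unfolding dconj_def H_inv[OF Q_dconj[OF x]] using xc(1) a
    by (subst H_mult) (simp_all add: xc(2))
qed

lemma Q_inv_dconj_mult:
  assumes x: "x \<in> \<Psi>" "x \<notin> \<Gamma>" and Q: "Q a 0 c"
  shows "Q (a / x) (- (b * x * (cj a / a))) (c / x + x\<^sup>2 * (b * cj b) / (1 - x ^ 3) / cj a)"
proof -
  note xc = Psi_cj[OF x(1)]
  have n: "x ^ 3 - 1 \<noteq> 0" "1 - x ^ 3 \<noteq> 0" using x Psi_Gamma_iff_cube by auto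
  have "cj (x * (b * cj b) / (x ^ 3 - 1)) = x\<^sup>2 * (b * cj b) / (1 - x ^ 3)"
    using xc(1) n by (simp add: xc(2) power_divide divide_simps) (simp add: algebra_simps power2_eq_square power3_eq_cube)
  thus ?thesis
    using Q_mult[OF Q_inv[OF Q_dconj[OF x, of b]] Q] xc Q_nonzero[OF Q] by simp
qed

lemma sum_const_f: "(\<Sum>b\<in>(UNIV :: 'f set). c :: 'k) = 0"
  unfolding sum_constant card_f by (simp add: q_eq_0)

lemma mult_D_generic:
  assumes f: "f \<in> carrier Z" and x: "x \<in> \<Psi>" "x \<notin> \<Gamma>" and a: "a \<noteq> 0" "a \<notin> \<Psi>"
  shows "lk (f \<otimes>\<^bsub>Z\<^esub> \<D> x) (\<d> a) = 0"
proof -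
  have "a / x \<notin> \<Psi>"
    using Psi_mult[OF _ x(1), of "a / x"] Psi_nonzero[OF x(1)] a by auto
  hence "lk f (inv\<^bsub>N\<^esub> (dconj x b) \<otimes>\<^bsub>N\<^esub> \<d> a) = lk f (\<d> (a / x))" for b
    unfolding inv_dconj_mult[OF x a(1)]
    by (intro class_fun_generic[OF Z_class_fun[OF f] Q_inv_dconj_mult[OF x Q_d[OF a(1)]]])
  thus ?thesis
    unfolding mult_D[OF f x H_in_N[OF Q_d[OF a(1)]]] by (simp only: sum_const_f)
qed

text \<open>Subtracting the constant \<open>v\<close> costs nothing, as the field has
  \<open>q ^ 2\<close> elements and \<open>q\<close> is zero in \<open>'k\<close>.\<close>

lemma sum_two_values:
  fixes u v :: 'k and S :: "'f set"
  shows "(\<Sum>b\<in>UNIV. if b \<in> S then u else v) = of_nat (card S) * (u - v)"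
proof -
  have "(\<Sum>b\<in>UNIV. if b \<in> S then u else v) = (\<Sum>b\<in>UNIV. (if b \<in> S then u - v else 0) + v)"
    by (intro sum.cong) auto
  also have "\<dots> = (\<Sum>b\<in>UNIV. if b \<in> S then u - v else 0)"
    unfolding sum.distrib sum_const_f by simp
  also have "\<dots> = of_nat (card S) * (u - v)"
    using fin by (simp add: sum.If_cases)
  finally show ?thesis .
qed

text \<open>The summand at index \<open>b\<close> is the value of \<open>f\<close> at \<open>d\<^bsub>a/x\<^esub>\<close> precisely for \<open>b = 0\<close>, respectively for the
  \<open>q + 1\<close> solutions of \<open>b b\<^sup>q = s\<close>; all other summands are the value at \<open>t\<^bsub>a/x\<^esub>\<close>.\<close>

lemma mult_D_Psi:
  assumes f: "f \<in> carrier Z" and x: "x \<in> \<Psi>" "x \<notin> \<Gamma>" and a: "a \<in> \<Psi>" "a \<notin> \<Gamma>" and y: "a / x \<notin> \<Gamma>"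
  shows "lk (f \<otimes>\<^bsub>Z\<^esub> \<D> x) (\<d> a) = lk f (\<d> (a / x)) - lk f (\<t> (a / x))"
    and "lk (f \<otimes>\<^bsub>Z\<^esub> \<D> x) (\<t> a) = lk f (\<d> (a / x)) - lk f (\<t> (a / x))"
proof -
  note xc = Psi_cj[OF x(1)] and ac = Psi_cj[OF a(1)]
  note cf = Z_class_fun[OF f]
  define X A where "X = x ^ 3" and "A = a ^ 3"
  have nz: "X \<noteq> 0" "A \<noteq> 0" "1 - X \<noteq> 0" "A - 1 \<noteq> 0" "A - X \<noteq> 0"
  proof -
    show "X \<noteq> 0" "A \<noteq> 0" using xc(1) ac(1) by (auto simp: X_def A_def)
    show "1 - X \<noteq> 0" "A - 1 \<noteq> 0"
      using x a Psi_Gamma_iff_cube by (auto simp: X_def A_def)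
    have "(a / x) ^ 3 \<noteq> 1"
      using Psi_Gamma_iff_cube[OF Psi_divide[OF a(1) x(1)]] y by simp
    thus "A - X \<noteq> 0" using xc(1) by (auto simp: X_def A_def power_divide)
  qed
  have P: "a / x \<in> \<Psi>" by (rule Psi_divide[OF a(1) x(1)])
  have D: "(a / x) ^ 3 - 1 = (A - X) / X"
    using nz xc(1) by (simp add: A_def X_def power_divide field_simps)
  \<comment> \<open>The factors \<open>x\<close> and \<open>cj a / a\<close> have norm one, so the
    second entry keeps the norm of \<open>b\<close>.\<close>
  have nb: "- (b * x * (cj a / a)) * cj (- (b * x * (cj a / a))) = b * cj b" for b
    using xc(1) ac(1) by (simp add: xc(2) ac(2))
  \<comment> \<open>The condition of \<open>class_fun_Psi\<close> for the shifted element, cleared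
    of denominators. For \<open>c = 0\<close> it forces \<open>b = 0\<close>; for
    \<open>c = a * \<omega>\<close> it prescribes the norm of \<open>b\<close>.\<close>
  have key: "(c / x + x\<^sup>2 * (b * cj b) / (1 - x ^ 3) / cj a) * ((a / x) ^ 3 - 1) = (a / x) * (b * cj b)
      \<longleftrightarrow> c * (A - X) * (1 - X) = a * X * (1 - A) * (b * cj b)" for b c
  proof -
    define n where "n = b * cj b"
    have "x\<^sup>2 * n / (1 - x ^ 3) / cj a = a * X * n / (x * (1 - X))"
      using xc(1) ac(1) nz by (simp add: X_def ac(2) field_simps power2_eq_square power3_eq_cube)
    hence "(c / x + x\<^sup>2 * n / (1 - x ^ 3) / cj a) * ((a / x) ^ 3 - 1) - (a / x) * n
      = (c / x + a * X * n / (x * (1 - X))) * ((A - X) / X) - (a / x) * n"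
      by (simp only: D)
    also have "\<dots> = (c * (A - X) * (1 - X) - a * X * (1 - A) * n) / (x * X * (1 - X))"
      using xc(1) nz by (simp add: divide_simps) (simp add: algebra_simps)
    finally show ?thesis
      unfolding n_def[symmetric] using xc(1) nz by (metis diff_eq_diff_eq diff_self divide_eq_0_iff no_zero_divisors eq_iff_diff_eq_0)
  qed
  have val: "lk f (inv\<^bsub>N\<^esub> (dconj x b) \<otimes>\<^bsub>N\<^esub> H a 0 c) =
      (if c * (A - X) * (1 - X) = a * X * (1 - A) * (b * cj b) then lk f (\<d> (a / x)) else lk f (\<t> (a / x)))"
    if "Q a 0 c" for b c
    unfolding inv_dconj_mult[OF x ac(1)] class_fun_Psi[OF cf Q_inv_dconj_mult[OF x that] P y] nb key ..
  have "lk (f \<otimes>\<^bsub>Z\<^esub> \<D> x) (\<d> a) = (\<Sum>b\<in>UNIV. if b \<in> {0::'f} then lk f (\<d> (a / x)) else lk f (\<t> (a / x)))"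
    unfolding mult_D[OF f x H_in_N[OF Q_d[OF ac(1)]]] val[OF Q_d[OF ac(1)]]
    by (rule sum.cong[OF refl]) (use nz ac(1) in auto)
  thus "lk (f \<otimes>\<^bsub>Z\<^esub> \<D> x) (\<d> a) = lk f (\<d> (a / x)) - lk f (\<t> (a / x))"
    unfolding sum_two_values by simp
  \<comment> \<open>The norm obtained by solving the condition \<open>key\<close> with
    \<open>c = a * \<omega>\<close>.\<close>
  define s where "s = \<omega> * (A - X) * (1 - X) / (X * (1 - A))"
  have "s \<noteq> 0" using nz \<omega>0 by (simp add: s_def)
  moreover have "cj s = s"
  proof -
    have "cj X = 1 / X" "cj A = 1 / A"
      using xc(2) ac(2) by (simp_all add: X_def A_def power_divide)
    hence "cj s = - \<omega> * (1 / A - 1 / X) * (1 - 1 / X) / (1 / X * (1 - 1 / A))"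
      by (simp add: s_def)
    also have "\<dots> = s"
      using nz unfolding s_def by (simp add: divide_simps) (simp add: algebra_simps)
    finally show ?thesis .
  qed
  ultimately have card: "card {b. b * cj b = s} = q + 1"
    by (rule card_norm_fibre)
  have "lk (f \<otimes>\<^bsub>Z\<^esub> \<D> x) (\<t> a) =
    (\<Sum>b\<in>UNIV. if b \<in> {b. b * cj b = s} then lk f (\<d> (a / x)) else lk f (\<t> (a / x)))"
    unfolding mult_D[OF f x H_in_N[OF Q_t[OF ac(1)]]] val[OF Q_t[OF ac(1)]]
  proof (intro sum.cong refl if_cong)
    fix b
    have "a * \<omega> * (A - X) * (1 - X) = a * X * (1 - A) * (b * cj b) \<longleftrightarrow> b * cj b = s"
      using nz ac(1) by (simp add: s_def eq_divide_eq) (auto simp: algebra_simps)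
    thus "a * \<omega> * (A - X) * (1 - X) = a * X * (1 - A) * (b * cj b) \<longleftrightarrow> b \<in> {b. b * cj b = s}"
      by simp
  qed
  thus "lk (f \<otimes>\<^bsub>Z\<^esub> \<D> x) (\<t> a) = lk f (\<d> (a / x)) - lk f (\<t> (a / x))"
    unfolding sum_two_values card by (simp add: q_eq_0)
qed

text \<open>Over \<Gamma> all summands are values on the unipotent part: index 0 gives the central
  element, and the other indices give the \<open>\<u> y\<close> with every
  \<open>y \<noteq> 0\<close> once. So the coefficients at \<open>\<d> a\<close> and
  \<open>\<t> a\<close> share the sum over \<open>y\<close>.\<close>

lemma mult_D_same:
  assumes f: "f \<in> carrier Z" and x: "x \<in> \<Psi>" "x \<notin> \<Gamma>" and y: "a / x \<in> \<Gamma>"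
  shows "lk (f \<otimes>\<^bsub>Z\<^esub> \<D> x) (\<d> a) = lk f (\<d> 1) + (\<Sum>y\<in>UNIV - {0}. lk f (\<u> y))"
    and "lk (f \<otimes>\<^bsub>Z\<^esub> \<D> x) (\<t> a) = lk f (\<t> 1) + (\<Sum>y\<in>UNIV - {0}. lk f (\<u> y))"
proof -
  note x0 = Psi_nonzero[OF x(1)] and cf = Z_class_fun[OF f]
  have "\<d> a = \<d> x" "\<t> a = \<t> x"
    using y x0 by (auto simp: H_eq_iff Gamma_ratio_sym[of a] dest: Gamma_nonzero intro!: bexI[of _ "x / a"])
  moreover have "lk (f \<otimes>\<^bsub>Z\<^esub> \<D> x) (H x 0 c) = lk f (H 1 0 (c / x)) + (\<Sum>y\<in>UNIV - {0}. lk f (\<u> y))"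
    if Q: "Q x 0 c" for c
  proof -
    define m where "m = - (x * (cj x / x))"
    have m: "m \<noteq> 0" using x0 by (simp add: m_def)
    have "lk f (inv\<^bsub>N\<^esub> (dconj x b) \<otimes>\<^bsub>N\<^esub> H x 0 c) = (if b = 0 then lk f (H 1 0 (c / x)) else lk f (\<u> (b * m)))" for b
    proof (cases "b = 0")
      case True
      thus ?thesis using x0 by (simp add: inv_dconj_mult[OF x x0])
    next
      case False
      hence "b * m \<noteq> 0" using m by simp
      thus ?thesis
        using class_fun_u[OF cf, of "b * m"] Q_inv_dconj_mult[OF x Q, of b] x0 False
        by (simp add: inv_dconj_mult[OF x x0] m_def mult.assoc)
    qed
    hence "lk (f \<otimes>\<^bsub>Z\<^esub> \<D> x) (H x 0 c) = (\<Sum>b\<in>UNIV. if b = 0 then lk f (H 1 0 (c / x)) else lk f (\<u> (b * m)))"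
      unfolding mult_D[OF f x H_in_N[OF Q]] by simp
    also have "\<dots> = lk f (H 1 0 (c / x)) + (\<Sum>b\<in>UNIV - {0}. lk f (\<u> (b * m)))"
      using fin by (subst sum.remove[of _ 0]) (auto intro!: sum.cong)
    also have "(\<Sum>b\<in>UNIV - {0}. lk f (\<u> (b * m))) = (\<Sum>y\<in>UNIV - {0}. lk f (\<u> y))"
      by (rule sum.reindex_bij_witness[of _ "\<lambda>y. y / m" "\<lambda>b. b * m"]) (use m in auto)
    finally show ?thesis .
  qed
  ultimately show "lk (f \<otimes>\<^bsub>Z\<^esub> \<D> x) (\<d> a) = lk f (\<d> 1) + (\<Sum>y\<in>UNIV - {0}. lk f (\<u> y))"
    and "lk (f \<otimes>\<^bsub>Z\<^esub> \<D> x) (\<t> a) = lk f (\<t> 1) + (\<Sum>y\<in>UNIV - {0}. lk f (\<u> y))"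
    using Q_d[OF x0] Q_t[OF x0] x0 by simp_all
qed

end

section \<open>Cosets and the radical\<close>

definition coset_rep :: "'a set \<Rightarrow> 'a"
  where "coset_rep X = (SOME x. x \<in> X)"

lemma group_field_units: "group (field_units :: 'a::field monoid)"
  by (rule groupI) (auto simp: field_units_def intro!: bexI[of _ "inverse _"])

lemma subgroup_field_units:
  fixes K :: "'a::field set"
  assumes K: "0 \<notin> K" "1 \<in> K" and div: "\<And>x y. x \<in> K \<Longrightarrow> y \<in> K \<Longrightarrow> x / y \<in> K"
  shows "subgroup K field_units"
proof (rule group.subgroupI[OF group_field_units])
  show "K \<subseteq> carrier field_units" "K \<noteq> {}"
    using K by (auto simp: field_units_def)
  fix x assume x: "x \<in> K"
  hence "inv\<^bsub>field_units\<^esub> x = 1 / x"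
    using K(1) by (intro group.inv_equality[OF group_field_units]) (auto simp: field_units_def)
  thus "inv\<^bsub>field_units\<^esub> x \<in> K"
    using div[OF K(2) x] by simp
  fix y assume y: "y \<in> K"
  show "x \<otimes>\<^bsub>field_units\<^esub> y \<in> K"
    using div[OF x div[OF K(2) y]] by (simp add: field_units_def)
qed

text \<open>Cosets are rewritten as sets of elements with a prescribed ratio, so that membership
  becomes a condition on a quotient in the field.\<close>

lemma carrier_field_units_Mod:
  fixes K :: "'a::field set"
  assumes "S \<subseteq> UNIV - {0}"
  shows "carrier (field_units\<lparr>carrier := S\<rparr> Mod K) = (\<lambda>x. {y. y / x \<in> K}) ` S"
proof -
  have "K #>\<^bsub>field_units\<lparr>carrier := S\<rparr>\<^esub> x = {y. y / x \<in> K}" if "x \<in> S" for x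
  proof -
    have x: "x \<noteq> 0" using that assms by auto
    show ?thesis
    proof safe
      fix y assume "y \<in> K #>\<^bsub>field_units\<lparr>carrier := S\<rparr>\<^esub> x"
      thus "y / x \<in> K" using x by (auto simp: r_coset_def field_units_def)
    next
      fix y assume "y / x \<in> K"
      moreover have "y = y / x * x" using x by simp
      ultimately show "y \<in> K #>\<^bsub>field_units\<lparr>carrier := S\<rparr>\<^esub> x"
        by (force simp: r_coset_def field_units_def)
    qed
  qed
  thus ?thesis by (simp add: carrier_FactGroup)
qed

lemma coset_rep_quotient:
  fixes K :: "'a::field set"
  assumes K: "1 \<in> K" "0 \<notin> K" "\<And>x y. x \<in> K \<Longrightarrow> y \<in> K \<Longrightarrow> x / y \<in> K" and S: "S \<subseteq> UNIV - {0}"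
    and X: "X \<in> (\<lambda>x. {y. y / x \<in> K}) ` S"
  shows "coset_rep X \<noteq> 0" "\<And>y. y \<in> X \<longleftrightarrow> y / coset_rep X \<in> K" "\<exists>x\<in>S. coset_rep X / x \<in> K"
proof -
  obtain x where x: "x \<in> S" "x \<noteq> 0" "X = {y. y / x \<in> K}"
    using X S by auto
  hence "x \<in> X" using K by simp
  hence "coset_rep X \<in> X"
    unfolding coset_rep_def by (rule someI)
  hence e: "coset_rep X / x \<in> K"
    using x by blast
  thus "\<exists>x\<in>S. coset_rep X / x \<in> K" using x by blast
  show e0: "coset_rep X \<noteq> 0" using e K(2) by auto
  fix y
  have "y / x \<in> K" if "y / coset_rep X \<in> K"
    using K(3)[OF that K(3)[OF K(1) e]] e0 x by (simp add: field_simps)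
  moreover have "y / coset_rep X \<in> K" if "y / x \<in> K"
    using K(3)[OF that e] e0 x by (simp add: field_simps)
  ultimately show "y \<in> X \<longleftrightarrow> y / coset_rep X \<in> K"
    using x by auto
qed

lemma on_coset_eq:
  assumes "\<And>y. y \<in> X \<Longrightarrow> f y = f x" "x \<in> X"
  shows "on_coset f X = f x"
proof -
  have "f ` X \<subseteq> {f x}" using assms(1) by blast
  moreover have "{f x} \<subseteq> f ` X" using assms(2) by blast
  ultimately have "f ` X = {f x}" by (rule equalityI)
  thus ?thesis by (simp add: on_coset_def)
qed

context hermitian_setup
begin

lemma L_set_closed: "0 \<notin> (L_set q :: 'f set)" "1 \<in> (L_set q :: 'f set)"
  "x \<in> L_set q \<Longrightarrow> y \<in> L_set q \<Longrightarrow> x / y \<in> (L_set q :: 'f set)"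
proof -
  show "0 \<notin> (L_set q :: 'f set)"
    by (auto simp: L_set_def)
  show "1 \<in> (L_set q :: 'f set)"
    unfolding L_set_def by (intro CollectI exI[of _ 1]) simp
  assume "x \<in> L_set q" "y \<in> L_set q"
  then obtain a b :: 'f where "x = a ^ gam q" "y = b ^ gam q" "a \<noteq> 0" "b \<noteq> 0"
    by (auto simp: L_set_def)
  thus "x / y \<in> L_set q"
    unfolding L_set_def by (intro CollectI exI[of _ "a / b"]) (simp add: power_divide)
qed

lemma zero_notin_Gamma: "0 \<notin> \<Gamma>"
  using Gamma_nonzero by blast

lemma Psi_subset: "\<Psi> \<subseteq> UNIV - {0}"
  using Psi_cj by auto

lemma units_mod_Gamma_eq: "units_mod_Gamma q = (\<lambda>x. {y. y / x \<in> \<Gamma>}) ` (UNIV - {0})"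
  using carrier_field_units_Mod[of "UNIV - {0}" \<Gamma>]
  by (simp add: units_mod_Gamma_def field_units_def)

lemma Psi_mod_Gamma_eq: "Psi_mod_Gamma q = (\<lambda>x. {y. y / x \<in> \<Gamma>}) ` \<Psi>"
  unfolding Psi_mod_Gamma_def by (rule carrier_field_units_Mod[OF Psi_subset])

lemma units_mod_L_eq: "units_mod_L q = (\<lambda>x::'f. {y. y / x \<in> L_set q}) ` (UNIV - {0})"
  using carrier_field_units_Mod[of "UNIV - {0}" "L_set q :: 'f set"]
  by (simp add: units_mod_L_def field_units_def)

lemma rep_units:
  assumes "X \<in> units_mod_Gamma q"
  shows "coset_rep X \<noteq> 0" "y \<in> X \<longleftrightarrow> y / coset_rep X \<in> \<Gamma>"
proof -
  note X = assms[unfolded units_mod_Gamma_eq]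
  show "coset_rep X \<noteq> 0"
    by (rule coset_rep_quotient(1)[OF Gamma_one zero_notin_Gamma Gamma_divide order_refl X])
  show "y \<in> X \<longleftrightarrow> y / coset_rep X \<in> \<Gamma>"
    by (rule coset_rep_quotient(2)[OF Gamma_one zero_notin_Gamma Gamma_divide order_refl X])
qed

lemma rep_L:
  assumes "X \<in> units_mod_L q"
  shows "coset_rep X \<noteq> (0::'f)" "y \<in> X \<longleftrightarrow> y / coset_rep X \<in> L_set q"
proof -
  note X = assms[unfolded units_mod_L_eq]
  show "coset_rep X \<noteq> (0::'f)"
    by (rule coset_rep_quotient(1)[OF L_set_closed(2,1,3) order_refl X])
  show "y \<in> X \<longleftrightarrow> y / coset_rep X \<in> L_set q"
    by (rule coset_rep_quotient(2)[OF L_set_closed(2,1,3) order_refl X])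
qed

lemma Gamma_in_units_mod: "\<Gamma> \<in> units_mod_Gamma q"
  unfolding units_mod_Gamma_eq by (rule image_eqI[of _ _ 1]) simp_all

lemma Gamma_in_Psi_mod: "\<Gamma> \<in> Psi_mod_Gamma q"
  unfolding Psi_mod_Gamma_eq by (rule image_eqI[of _ _ 1]) (simp_all add: Psi_iff)

lemma Psi_mod_subset: "Psi_mod_Gamma q \<subseteq> (units_mod_Gamma q :: 'f set set)"
  unfolding units_mod_Gamma_eq Psi_mod_Gamma_eq using Psi_subset by (intro image_mono)

lemma rep_Psi: "X \<in> Psi_mod_Gamma q \<Longrightarrow> coset_rep X \<in> \<Psi>"
  using coset_rep_quotient(3)[OF Gamma_one zero_notin_Gamma Gamma_divide Psi_subset, folded Psi_mod_Gamma_eq, of X]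
    Psi_mult[of "coset_rep X / _"] Gamma_subset_Psi Psi_subset by (metis DiffE UNIV_I insertI1 nonzero_divide_eq_eq subset_iff)

lemma rep_not_Gamma: "X \<in> units_mod_Gamma q - {\<Gamma>} \<Longrightarrow> coset_rep X \<notin> \<Gamma>"
proof
  assume X: "X \<in> units_mod_Gamma q - {\<Gamma>}" and r: "coset_rep X \<in> \<Gamma>"
  hence R: "coset_rep X \<noteq> 0" "\<And>y. y \<in> X \<longleftrightarrow> y / coset_rep X \<in> \<Gamma>"
    using rep_units[of X] by blast+
  have "y / coset_rep X \<in> \<Gamma> \<longleftrightarrow> y \<in> \<Gamma>" for y
    using Gamma_mult[OF _ r, of "y / coset_rep X"] Gamma_divide[OF _ r, of y] R(1) X by auto
  hence "X = \<Gamma>" using R(2) X by blast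
  thus False using X by blast
qed

lemma rep_ratio_iff:
  assumes "X \<in> units_mod_Gamma q" "Y \<in> units_mod_Gamma q"
  shows "coset_rep X / coset_rep Y \<in> \<Gamma> \<longleftrightarrow> X = Y"
proof
  assume r: "coset_rep X / coset_rep Y \<in> \<Gamma>"
  have "y / coset_rep X \<in> \<Gamma> \<longleftrightarrow> y / coset_rep Y \<in> \<Gamma>" for y
    using Gamma_mult[OF _ r, of "y / coset_rep X"] Gamma_divide[OF _ r, of "y / coset_rep Y"]
      rep_units(1)[OF assms(1)] rep_units(1)[OF assms(2)] by auto
  thus "X = Y" using rep_units(2)[OF assms(1)] rep_units(2)[OF assms(2)] by blast
next
  assume "X = Y"
  thus "coset_rep X / coset_rep Y \<in> \<Gamma>" using rep_units(1)[OF assms(2)] Gamma_one by simp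
qed

lemma rep_L_ratio_iff:
  assumes "X \<in> units_mod_L q" "Y \<in> units_mod_L q"
  shows "coset_rep X / coset_rep Y \<in> (L_set q :: 'f set) \<longleftrightarrow> X = Y"
proof
  assume r: "coset_rep X / coset_rep Y \<in> L_set q"
  have "y / coset_rep X \<in> L_set q \<longleftrightarrow> y / coset_rep Y \<in> L_set q" for y
    using L_mult[OF _ r, of "y / coset_rep X"] L_set_closed(3)[OF _ r, of "y / coset_rep Y"]
      rep_L(1)[OF assms(1)] rep_L(1)[OF assms(2)] by auto
  thus "X = Y" using rep_L(2)[OF assms(1)] rep_L(2)[OF assms(2)] by blast
next
  assume "X = Y"
  thus "coset_rep X / coset_rep Y \<in> L_set q" using rep_L(1)[OF assms(2)] L_set_closed by simp
qed

lemma subgroup_Gamma: "subgroup \<Gamma> field_units"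
  by (rule subgroup_field_units[OF zero_notin_Gamma Gamma_one Gamma_divide])

lemma subgroup_Psi: "subgroup \<Psi> field_units"
  using Psi_subset by (intro subgroup_field_units Psi_divide) (auto simp: Psi_iff)

lemma card_units_mod_Gamma: "card (units_mod_Gamma q :: 'f set set) * gam q = q ^ 2 - 1"
  using group.lagrange[OF group_field_units subgroup_Gamma] fin
  by (simp add: units_mod_Gamma_def FactGroup_def card_Gamma Coset.order_def field_units_def card_f)

lemma card_Psi_mod_Gamma: "card (Psi_mod_Gamma q :: 'f set set) * gam q = q + 1"
proof -
  interpret P: group "field_units\<lparr>carrier := \<Psi>\<rparr>"
    by (rule group.subgroup_imp_group[OF group_field_units subgroup_Psi])
  have "subgroup \<Gamma> (field_units\<lparr>carrier := \<Psi>\<rparr>)"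
    by (rule group.subgroup_incl[OF group_field_units subgroup_Gamma subgroup_Psi Gamma_subset_Psi])
  from P.lagrange[OF this] show ?thesis
    by (simp add: Psi_mod_Gamma_def FactGroup_def card_Gamma Coset.order_def card_Psi)
qed

text \<open>Lagrange and \<open>card_L\<close> write \<open>q ^ 2 - 1\<close> as a multiple of the
  order of \<open>L_set q\<close> in two ways, and the order cancels.\<close>

lemma card_units_mod_L: "card (units_mod_L q :: 'f set set) = gam q"
proof -
  have "card (units_mod_L q :: 'f set set) * card (L_set q :: 'f set) = q ^ 2 - 1"
    using group.lagrange[OF group_field_units subgroup_field_units[OF L_set_closed]] fin
    by (simp add: units_mod_L_def FactGroup_def Coset.order_def field_units_def card_f)
  moreover have "card (L_set q :: 'f set) \<noteq> 0"
    using L_set_closed(2) fin by (auto simp: card_eq_0_iff)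
  ultimately show ?thesis
    using card_L by (metis mult.commute mult_cancel2)
qed

lemma finite_sets_f: "finite (S :: 'f set set)"
  by (rule finite_subset[OF _ finite_Pow_iff[THEN iffD2, OF fin[of UNIV]]]) auto

end

section \<open>The radical, its powers and their bases\<close>

context hermitian_algebra
begin

lemma on_coset_DT:
  assumes X: "X \<in> units_mod_Gamma q"
  shows "on_coset \<D> X = \<D> (coset_rep X)" "on_coset \<T> X = \<T> (coset_rep X)"
proof -
  note R = rep_units(1,2)[OF X]
  have mem: "coset_rep X \<in> X" using R Gamma_one by auto
  \<comment> \<open>The cases \<open>c = 0\<close> and \<open>c = \<omega>\<close> treat
    \<open>\<d>\<close> and \<open>\<t>\<close> together.\<close>
  have eq: "H y 0 (y * c) = H (coset_rep X) 0 (coset_rep X * c)" if "y \<in> X" for y c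
  proof -
    have "y / coset_rep X \<in> \<Gamma>" using that R by blast
    hence "H (coset_rep X) 0 (coset_rep X * c) = H y 0 (y * c)"
      unfolding H_eq_iff using R(1) by (intro bexI[of _ "y / coset_rep X"]) auto
    thus ?thesis ..
  qed
  show "on_coset \<D> X = \<D> (coset_rep X)"
    by (rule on_coset_eq[OF _ mem]) (use eq[of _ 0] in \<open>simp add: D_elt_def\<close>)
  show "on_coset \<T> X = \<T> (coset_rep X)"
    by (rule on_coset_eq[OF _ mem]) (use eq[of _ \<omega>] in \<open>simp add: T_elt_def\<close>)
qed

text \<open>In contrast to \<open>\<d>\<close> and \<open>\<t>\<close>, the elements
  \<open>\<u> y\<close> for \<open>y\<close> in one coset are only conjugate in general, so the
  class sums are compared through their values.\<close>

lemma on_coset_U: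
  assumes X: "X \<in> units_mod_L q"
  shows "on_coset \<U> X = \<U> (coset_rep X)"
proof (rule on_coset_eq)
  note R = rep_L(1,2)[OF X]
  show "coset_rep X \<in> X" using R L_set_closed by auto
  fix y assume "y \<in> X"
  hence r: "y / coset_rep X \<in> L_set q" using R by blast
  hence y: "y \<noteq> 0" using L_set_closed(1) by auto
  have "\<U> y - \<U> (coset_rep X) = 0"
  proof (rule Z_eq_0I[OF Z_diff[OF U_Z U_Z]])
    fix z :: 'f
    have "z / y \<in> L_set q \<longleftrightarrow> z / coset_rep X \<in> L_set q"
      using L_mult[OF _ r, of "z / y"] L_set_closed(3)[OF _ r, of "z / coset_rep X"] R(1) y by auto
    thus "lk (\<U> y - \<U> (coset_rep X)) (\<u> z) = 0"
      using y R(1) by (simp add: lookup_minus lookup_U_u)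
  qed (use y R(1) in \<open>simp_all add: lookup_minus lookup_U_d lookup_U_t\<close>)
  thus "\<U> y = \<U> (coset_rep X)" by simp
qed

text \<open>\<open>Rad\<close> turns out to be the radical and \<open>Sq\<close> its square; \<open>Inv\<close> consists of the central elements
  that are invariant under the centre of the unipotent part.\<close>

definition Rad :: "(('f^3^3) set \<Rightarrow>\<^sub>0 'k) set"
  where "Rad = {f \<in> carrier Z. lk f (\<t> 1) = lk f (\<d> 1)}"

definition Inv :: "(('f^3^3) set \<Rightarrow>\<^sub>0 'k) set"
  where "Inv = {f \<in> carrier Z. \<forall>a\<in>\<Psi>. lk f (\<t> a) = lk f (\<d> a)}"

definition Sq :: "(('f^3^3) set \<Rightarrow>\<^sub>0 'k) set"
  where "Sq = {f \<in> Inv. (\<forall>a. a \<noteq> 0 \<and> a \<notin> \<Psi> - \<Gamma> \<longrightarrow> lk f (\<d> a) = 0) \<and> (\<forall>y. y \<noteq> 0 \<longrightarrow> lk f (\<u> y) = 0)}"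

lemma Inv_subset_Rad: "Inv \<subseteq> Rad"
proof
  fix f assume "f \<in> Inv"
  hence f: "f \<in> carrier Z" "\<forall>a\<in>\<Psi>. lk f (\<t> a) = lk f (\<d> a)" by (auto simp: Inv_def)
  from bspec[OF f(2), of 1] f(1) show "f \<in> Rad" by (simp add: Rad_def Psi_iff)
qed

lemma Sq_subset_Inv: "Sq \<subseteq> Inv"
  by (auto simp: Sq_def)

lemma Rad_subset_Z: "Rad \<subseteq> carrier Z"
  by (auto simp: Rad_def)

lemma subspace_Rad: "ga.subspace Rad"
  by (auto simp: ga.subspace_def Rad_def Z_zero Z_add Z_scale lookup_add lookup_ga_scale)

lemma subspace_Inv: "ga.subspace Inv"
  by (auto simp: ga.subspace_def Inv_def Z_zero Z_add Z_scale lookup_add lookup_ga_scale)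

lemma subspace_Sq: "ga.subspace Sq"
  using subspace_Inv by (auto simp: ga.subspace_def Sq_def lookup_add lookup_ga_scale)

lemma d_t_Gamma: "a \<in> \<Gamma> \<Longrightarrow> \<d> a = \<d> 1" "a \<in> \<Gamma> \<Longrightarrow> \<t> a = \<t> 1"
  using H_normalise(1)[OF _ Q_d] H_normalise(1)[OF _ Q_t] Gamma_nonzero by auto

text \<open>Membership of \<open>f\<close> in \<open>Rad\<close> enters where \<open>a / x\<close>
  lies in \<Gamma>: there the coefficients at \<open>\<d> a\<close> and \<open>\<t> a\<close> differ
  by \<open>lk f (\<d> 1) - lk f (\<t> 1)\<close>. Elsewhere in \<Psi> the product formulas already
  give equal values.\<close>

lemma Rad_mult_D:
  assumes f: "f \<in> Rad" and x: "x \<in> \<Psi>" "x \<notin> \<Gamma>"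
  shows "f \<otimes>\<^bsub>Z\<^esub> \<D> x \<in> Sq"
proof -
  have fZ: "f \<in> carrier Z" and f1: "lk f (\<t> 1) = lk f (\<d> 1)" using f by (auto simp: Rad_def)
  have "f \<otimes>\<^bsub>Z\<^esub> \<D> x \<in> carrier Z" using fZ D_Z[OF Psi_nonzero[OF x(1)]] by simp
  moreover have "lk (f \<otimes>\<^bsub>Z\<^esub> \<D> x) (\<t> a) = lk (f \<otimes>\<^bsub>Z\<^esub> \<D> x) (\<d> a)" if a: "a \<in> \<Psi>" for a
  proof -
    consider "a \<in> \<Gamma>" | "a \<notin> \<Gamma>" "a / x \<in> \<Gamma>" | "a \<notin> \<Gamma>" "a / x \<notin> \<Gamma>" by blast
    thus ?thesis
      using mult_D_unipotent[OF fZ x] d_t_Gamma[of a] mult_D_same[OF fZ x, of a] mult_D_Psi[OF fZ x a] f1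
      by cases simp_all
  qed
  moreover have "lk (f \<otimes>\<^bsub>Z\<^esub> \<D> x) (\<d> a) = 0" if "a \<noteq> 0" "a \<notin> \<Psi> - \<Gamma>" for a
    using that mult_D_generic[OF fZ x that(1)] mult_D_unipotent[OF fZ x] d_t_Gamma[of a]
    by (cases "a \<in> \<Gamma>") auto
  ultimately show ?thesis
    using mult_D_unipotent(3)[OF fZ x] by (auto simp: Sq_def Inv_def)
qed

lemma Sq_eq_0I:
  assumes f: "f \<in> Sq" and 0: "\<And>a. a \<in> \<Psi> \<Longrightarrow> a \<notin> \<Gamma> \<Longrightarrow> lk f (\<d> a) = 0"
  shows "f = 0"
proof -
  have fZ: "f \<in> carrier Z" and t: "\<And>a. a \<in> \<Psi> \<Longrightarrow> lk f (\<t> a) = lk f (\<d> a)"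
    and d: "\<And>a. a \<noteq> 0 \<Longrightarrow> a \<notin> \<Psi> - \<Gamma> \<Longrightarrow> lk f (\<d> a) = 0"
    and u: "\<And>y. y \<noteq> 0 \<Longrightarrow> lk f (\<u> y) = 0"
    using f by (auto simp: Sq_def Inv_def)
  have d0: "lk f (\<d> a) = 0" if "a \<noteq> 0" for a
    using d[OF that] 0[of a] by blast
  show ?thesis
    using d0 u t Psi_nonzero by (intro Z_eq_0I[OF fZ]) auto
qed

text \<open>The product lies in \<open>Sq\<close> again, so only its values at \<open>\<d> a\<close>
  for \<open>a\<close> in \<Psi> - \<Gamma> matter. They are differences of values that
  \<open>Inv\<close> makes equal, or sums of values on the unipotent part, where \<open>f\<close>
  vanishes.\<close>

lemma Sq_mult_D:
  assumes f: "f \<in> Sq" and x: "x \<in> \<Psi>" "x \<notin> \<Gamma>"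
  shows "f \<otimes>\<^bsub>Z\<^esub> \<D> x = 0"
proof (rule Sq_eq_0I)
  have fZ: "f \<in> carrier Z" and t: "\<And>a. a \<in> \<Psi> \<Longrightarrow> lk f (\<t> a) = lk f (\<d> a)"
    and d: "\<And>a. a \<noteq> 0 \<Longrightarrow> a \<notin> \<Psi> - \<Gamma> \<Longrightarrow> lk f (\<d> a) = 0"
    and u: "\<And>y. y \<noteq> 0 \<Longrightarrow> lk f (\<u> y) = 0"
    using f by (auto simp: Sq_def Inv_def)
  show "f \<otimes>\<^bsub>Z\<^esub> \<D> x \<in> Sq"
    using Rad_mult_D[OF _ x] f Sq_subset_Inv Inv_subset_Rad by blast
  fix a assume a: "a \<in> \<Psi>" "a \<notin> \<Gamma>"
  have "(\<Sum>y\<in>UNIV - {0}. lk f (\<u> y)) = 0"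
    by (rule sum.neutral) (use u in auto)
  thus "lk (f \<otimes>\<^bsub>Z\<^esub> \<D> x) (\<d> a) = 0"
    using mult_D_same(1)[OF fZ x, of a] mult_D_Psi(1)[OF fZ x a] t[OF Psi_divide[OF a(1) x(1)]]
      d[of 1] Gamma_one by (cases "a / x \<in> \<Gamma>") auto
qed

lemma t_power: "\<t> 1 [^]\<^bsub>N\<^esub> n = H 1 0 (of_nat n * \<omega>)" for n :: nat
  by (induction n) (simp_all add: N_one H_mult algebra_simps)

text \<open>Multiplication by \<open>\<t> 1\<close> changes only the third entry of a triple. The
  normal forms depend on that entry only through the choice between \<open>\<d> a\<close> and
  \<open>\<t> a\<close> with \<open>a\<close> in \<Psi>, where \<open>f\<close> takes equal
  values.\<close>

lemma Inv_translate:
  assumes f: "f \<in> Inv" and x: "x \<in> carrier N"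
  shows "lk f (x \<otimes>\<^bsub>N\<^esub> \<t> 1) = lk f x" "lk f (\<t> 1 \<otimes>\<^bsub>N\<^esub> x) = lk f x"
proof -
  have fZ: "f \<in> carrier Z" and t: "\<And>a. a \<in> \<Psi> \<Longrightarrow> lk f (\<t> a) = lk f (\<d> a)"
    using f by (auto simp: Inv_def)
  note cf = Z_class_fun[OF fZ]
  have z: "\<t> 1 \<in> carrier N" using H_in_N[OF Q_t[of 1]] by simp
  obtain a b c where Q: "Q a b c" and xe: "x = H a b c"
    using x by (auto simp: N_carrier)
  note a = Q_nonzero[OF Q]
  have prod: "x \<otimes>\<^bsub>N\<^esub> \<t> 1 = H a b (a * \<omega> + c)"
    unfolding xe using a by (simp add: H_mult)
  have Q': "Q a b (a * \<omega> + c)"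
    using Q_mult[OF Q Q_t[of 1]] by simp
  consider "a \<notin> \<Psi>" | "a \<in> \<Psi>" "a \<notin> \<Gamma>" | "a \<in> \<Gamma>" by blast
  thus 1: "lk f (x \<otimes>\<^bsub>N\<^esub> \<t> 1) = lk f x"
  proof cases
    case 1
    thus ?thesis unfolding prod unfolding xe using class_fun_generic[OF cf] Q Q' by simp
  next
    case 2
    thus ?thesis unfolding prod unfolding xe using class_fun_Psi[OF cf Q 2] class_fun_Psi[OF cf Q' 2] t by simp
  next
    case 3
    note H = H_normalise[OF 3 Q] and H' = H_normalise[OF 3 Q']
    show ?thesis
    proof (cases "b = 0")
      case True
      have "lk f (H 1 0 c) = lk f (\<d> 1)" if "Q 1 0 c" for c
        using class_fun_t[OF cf that] t[of 1] by (cases "c = 0") (auto simp: Psi_iff)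
      thus ?thesis unfolding prod unfolding xe using H H' True by simp
    next
      case False
      thus ?thesis unfolding prod unfolding xe H(1) H'(1)
        using class_fun_u[OF cf H(2)] class_fun_u[OF cf H'(2)] a by simp
    qed
  qed
  \<comment> \<open>\<open>\<t> 1 \<otimes> x\<close> is the conjugate of
    \<open>x \<otimes> \<t> 1\<close> under \<open>\<t> 1\<close>.\<close>
  have "lk f (\<t> 1 \<otimes>\<^bsub>N\<^esub> x) = lk f (\<t> 1 \<otimes>\<^bsub>N\<^esub> (x \<otimes>\<^bsub>N\<^esub> \<t> 1) \<otimes>\<^bsub>N\<^esub> inv\<^bsub>N\<^esub> (\<t> 1))"
    using x z by (simp only: N.m_assoc N.m_closed N.inv_closed N.r_inv N.r_one)
  also have "\<dots> = lk f (x \<otimes>\<^bsub>N\<^esub> \<t> 1)"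
    using cf x z N.m_closed[OF x z] unfolding class_fun_def by blast
  finally show "lk f (\<t> 1 \<otimes>\<^bsub>N\<^esub> x) = lk f x" using 1 by simp
qed

text \<open>Replacing \<open>x\<close> by \<open>\<t> 1 \<otimes> x\<close> leaves each convolution
  summand unchanged, and \<open>\<t> 1\<close> has order \<open>p\<close>, so
  \<open>sum_left_invariant_eq_0\<close> applies.\<close>

lemma Inv_mult_Inv:
  assumes f: "f \<in> Inv" and g: "g \<in> Inv"
  shows "f \<otimes>\<^bsub>Z\<^esub> g = 0"
proof (rule poly_mapping_eqI)
  fix v
  have fZ: "f \<in> carrier Z" and gZ: "g \<in> carrier Z" using f g by (auto simp: Inv_def)
  define z where "z = \<t> 1"
  have z: "z \<in> carrier N" using H_in_N[OF Q_t[of 1]] by (simp add: z_def)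
  have "\<t> 1 \<noteq> \<one>\<^bsub>N\<^esub>" using \<omega>0 by (auto simp: N_one H_eq_iff dest: Gamma_nonzero)
  moreover have "\<t> 1 [^]\<^bsub>N\<^esub> p = \<one>\<^bsub>N\<^esub>"
    unfolding t_power N_one using of_nat_CHAR[where 'a='f] char_f by simp
  ultimately have z': "z \<noteq> \<one>\<^bsub>N\<^esub>" "z [^]\<^bsub>N\<^esub> p = \<one>\<^bsub>N\<^esub>" by (simp_all add: z_def)
  have "(\<Sum>x\<in>carrier N. lk f x * lk g (inv\<^bsub>N\<^esub> x \<otimes>\<^bsub>N\<^esub> v)) = 0" if v: "v \<in> carrier N"
  proof (rule N.sum_left_invariant_eq_0[OF fin_N z z' p char_k])
    fix x assume x: "x \<in> carrier N"
    \<comment> \<open>A class function allows \<open>inv x\<close> to be moved to the right of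
      \<open>v\<close>. This puts the factor coming from \<open>inv (z \<otimes> x)\<close> at the
      end, where right translation by \<open>z\<close> removes it.\<close>
    have conj: "lk g (inv\<^bsub>N\<^esub> y \<otimes>\<^bsub>N\<^esub> v) = lk g (v \<otimes>\<^bsub>N\<^esub> inv\<^bsub>N\<^esub> y)" if y: "y \<in> carrier N" for y
    proof -
      have "lk g (inv\<^bsub>N\<^esub> y \<otimes>\<^bsub>N\<^esub> v) = lk g (y \<otimes>\<^bsub>N\<^esub> (inv\<^bsub>N\<^esub> y \<otimes>\<^bsub>N\<^esub> v) \<otimes>\<^bsub>N\<^esub> inv\<^bsub>N\<^esub> y)"
        using Z_class_fun[OF gZ] y v by (simp add: class_fun_def)
      also have "y \<otimes>\<^bsub>N\<^esub> (inv\<^bsub>N\<^esub> y \<otimes>\<^bsub>N\<^esub> v) \<otimes>\<^bsub>N\<^esub> inv\<^bsub>N\<^esub> y = v \<otimes>\<^bsub>N\<^esub> inv\<^bsub>N\<^esub> y"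
        using y v by (simp add: N.m_assoc[symmetric])
      finally show ?thesis .
    qed
    have "lk g (v \<otimes>\<^bsub>N\<^esub> inv\<^bsub>N\<^esub> (z \<otimes>\<^bsub>N\<^esub> x)) = lk g (v \<otimes>\<^bsub>N\<^esub> inv\<^bsub>N\<^esub> (z \<otimes>\<^bsub>N\<^esub> x) \<otimes>\<^bsub>N\<^esub> z)"
      using Inv_translate(1)[OF g, of "v \<otimes>\<^bsub>N\<^esub> inv\<^bsub>N\<^esub> (z \<otimes>\<^bsub>N\<^esub> x)"] v x z by (simp add: z_def)
    also have "v \<otimes>\<^bsub>N\<^esub> inv\<^bsub>N\<^esub> (z \<otimes>\<^bsub>N\<^esub> x) \<otimes>\<^bsub>N\<^esub> z = v \<otimes>\<^bsub>N\<^esub> inv\<^bsub>N\<^esub> x"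
      using x z v by (simp add: N.inv_mult_group N.m_assoc)
    finally have "lk g (inv\<^bsub>N\<^esub> (z \<otimes>\<^bsub>N\<^esub> x) \<otimes>\<^bsub>N\<^esub> v) = lk g (inv\<^bsub>N\<^esub> x \<otimes>\<^bsub>N\<^esub> v)"
      using conj x z by simp
    thus "lk f (z \<otimes>\<^bsub>N\<^esub> x) * lk g (inv\<^bsub>N\<^esub> (z \<otimes>\<^bsub>N\<^esub> x) \<otimes>\<^bsub>N\<^esub> v) = lk f x * lk g (inv\<^bsub>N\<^esub> x \<otimes>\<^bsub>N\<^esub> v)"
      using Inv_translate(2)[OF f x] by (simp add: z_def)
  qed
  thus "lk (f \<otimes>\<^bsub>Z\<^esub> g) v = lk 0 v"
    using fZ gZ by (simp add: Z_ops Z_iff lookup_group_algebra_mult[OF group_N fin_N])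
qed

lemma D_T_in_Sq:
  assumes x: "x \<in> \<Psi>" "x \<notin> \<Gamma>"
  shows "\<D> x + \<T> x \<in> Sq"
proof -
  note x0 = Psi_nonzero[OF x(1)]
  have "a / x \<notin> \<Gamma>" if "a \<notin> \<Psi> - \<Gamma>" for a
    using Psi_if_ratio[OF _ x0, of a] Gamma_if_ratio[OF _ x0, of a] x that by blast
  thus ?thesis
    using x0 x Psi_nonzero Z_add[OF D_Z[OF x0] T_Z[OF x0]]
    by (auto simp: Sq_def Inv_def lookup_add lookup_D_d lookup_D_t lookup_D_u lookup_T_d lookup_T_t lookup_T_u)
qed

lemma zeta_in_Inv: "\<T> 1 + Id_elt q \<in> Inv"
  using Z_add[OF T_Z[of 1] Id_Z] Psi_nonzero lookup_T_d[of 1] lookup_T_t[of 1]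
  by (auto simp: Inv_def lookup_add Id_values Psi_iff)

text \<open>This exhibits the basis elements of \<open>Sq\<close> as products of two elements of
  \<open>Rad\<close>. Both sides lie in \<open>Sq\<close>, so it suffices to compare them at
  \<open>\<d> a\<close> for \<open>a\<close> in \<Psi> - \<Gamma>.\<close>

lemma zeta_mult_D:
  assumes x: "x \<in> \<Psi>" "x \<notin> \<Gamma>"
  shows "(\<T> 1 + Id_elt q) \<otimes>\<^bsub>Z\<^esub> \<D> x = \<D> x + \<T> x"
proof -
  let ?z = "\<T> 1 + Id_elt q"
  note x0 = Psi_nonzero[OF x(1)]
  have zI: "?z \<in> Inv" by (rule zeta_in_Inv)
  hence zZ: "?z \<in> carrier Z" by (simp add: Inv_def)
  have one: "1 \<in> \<Psi>" by (simp add: Psi_iff)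
  have "?z \<otimes>\<^bsub>Z\<^esub> \<D> x - (\<D> x + \<T> x) = 0"
  proof (rule Sq_eq_0I)
    show "?z \<otimes>\<^bsub>Z\<^esub> \<D> x - (\<D> x + \<T> x) \<in> Sq"
      using Rad_mult_D[OF _ x] zI Inv_subset_Rad D_T_in_Sq[OF x] subspace_Sq
      by (intro ga.subspace_diff) auto
    fix a assume a: "a \<in> \<Psi>" "a \<notin> \<Gamma>"
    note a0 = Psi_nonzero[OF a(1)]
    have "lk (?z \<otimes>\<^bsub>Z\<^esub> \<D> x) (\<d> a) = (if a / x \<in> \<Gamma> then 1 else 0)"
    proof (cases "a / x \<in> \<Gamma>")
      case True
      have "(\<Sum>y\<in>UNIV - {0}. lk ?z (\<u> y)) = 0"
        by (rule sum.neutral) (simp add: lookup_add lookup_T_u[OF one] Id_values)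
      moreover have "lk ?z (\<d> 1) = 1"
        by (simp add: lookup_add lookup_T_d[OF one] Id_values Gamma_one)
      ultimately show ?thesis
        using mult_D_same(1)[OF zZ x True] True by simp
    next
      case False
      have "\<forall>a\<in>\<Psi>. lk ?z (\<t> a) = lk ?z (\<d> a)"
        using zI unfolding Inv_def by blast
      from bspec[OF this Psi_divide[OF a(1) x(1)]]
      have "lk ?z (\<t> (a / x)) = lk ?z (\<d> (a / x))" .
      thus ?thesis
        using mult_D_Psi(1)[OF zZ x a False] False by simp
    qed
    thus "lk (?z \<otimes>\<^bsub>Z\<^esub> \<D> x - (\<D> x + \<T> x)) (\<d> a) = 0"
      using x0 a0 x by (simp add: lookup_minus lookup_add lookup_D_d lookup_T_d)
  qed
  thus ?thesis by simp
qed

abbreviation DD :: "(('f^3^3) set \<Rightarrow>\<^sub>0 'k) set" where "DD \<equiv> \<D> ` (\<Psi> - \<Gamma>)"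

lemma rep_Psi_mod:
  assumes "X \<in> Psi_mod_Gamma q - {\<Gamma>}"
  shows "coset_rep X \<in> \<Psi>" "coset_rep X \<notin> \<Gamma>" "coset_rep X \<noteq> 0" "X \<in> units_mod_Gamma q"
  using rep_Psi[of X] rep_not_Gamma[of X] Psi_mod_subset Psi_nonzero assms by blast+

lemma coset_of_Psi:
  assumes "a \<in> \<Psi>" "a \<notin> \<Gamma>"
  shows "{y. y / a \<in> \<Gamma>} \<in> Psi_mod_Gamma q - {\<Gamma>}" "coset_rep {y. y / a \<in> \<Gamma>} / a \<in> \<Gamma>"
proof -
  have a: "a \<noteq> 0" using assms Psi_nonzero by blast
  have "a \<in> {y. y / a \<in> \<Gamma>}" using a Gamma_one by simp
  hence "{y. y / a \<in> \<Gamma>} \<noteq> \<Gamma>" using assms(2) by blast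
  thus 1: "{y. y / a \<in> \<Gamma>} \<in> Psi_mod_Gamma q - {\<Gamma>}"
    using assms by (auto simp: Psi_mod_Gamma_eq)
  have "coset_rep {y. y / a \<in> \<Gamma>} \<in> {y. y / a \<in> \<Gamma>}"
    unfolding coset_rep_def by (rule someI[of _ a]) (use a Gamma_one in simp)
  thus "coset_rep {y. y / a \<in> \<Gamma>} / a \<in> \<Gamma>" by simp
qed

lemma H_Gamma_ratio:
  assumes "b / a \<in> \<Gamma>" "a \<noteq> 0"
  shows "\<d> b = \<d> a" "\<t> b = \<t> a"
proof -
  have "\<d> a = \<d> b" "\<t> a = \<t> b"
    unfolding H_eq_iff using assms by (auto intro!: bexI[of _ "b / a"])
  thus "\<d> b = \<d> a" "\<t> b = \<t> a" by simp_all
qed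

text \<open>Over \<Psi> - \<Gamma> the element \<open>\<D> x\<close> has value 1 at
  \<open>\<d> x\<close> and 0 at \<open>\<t> x\<close>, so subtracting multiples of these elements
  equalises the values coset by coset. Over \<Gamma> they are equal by the definition of
  \<open>Rad\<close>.\<close>

lemma Rad_decompose:
  assumes f: "f \<in> Rad"
  obtains g h where "g \<in> Inv" "h \<in> ga.span DD" "f = g + h"
proof -
  have fZ: "f \<in> carrier Z" and f1: "lk f (\<t> 1) = lk f (\<d> 1)"
    using f by (auto simp: Rad_def)
  let ?S = "Psi_mod_Gamma q - {\<Gamma>}"
  define c where "c X = lk f (\<d> (coset_rep X)) - lk f (\<t> (coset_rep X))" for X
  define h where "h = (\<Sum>X\<in>?S. ga_scale (c X) (\<D> (coset_rep X)))"
  have hs: "h \<in> ga.span DD"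
    unfolding h_def using rep_Psi_mod by (intro ga.span_sum ga.span_scale ga.span_base) auto
  have hZ: "h \<in> carrier Z"
    unfolding h_def using rep_Psi_mod Z_subspace
    by (intro ga.subspace_sum ga.subspace_scale D_Z) auto
  have "lk (f - h) (\<t> a) = lk (f - h) (\<d> a)" if a: "a \<in> \<Psi>" for a
  proof -
    note a0 = Psi_nonzero[OF a]
    have ht: "lk h (\<t> a) = 0"
      unfolding h_def lookup_sum
      by (rule sum.neutral) (use rep_Psi_mod a in \<open>auto simp: lookup_ga_scale lookup_D_t\<close>)
    have hd: "lk h (\<d> a) = (\<Sum>X\<in>?S. if a / coset_rep X \<in> \<Gamma> then c X else 0)"
      unfolding h_def lookup_sum using rep_Psi_mod a0 by (intro sum.cong) (auto simp: lookup_ga_scale lookup_D_d)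
    show ?thesis
    proof (cases "a \<in> \<Gamma>")
      case True
      have "a / coset_rep X \<notin> \<Gamma>" if "X \<in> ?S" for X
        using Gamma_if_ratio[OF _ rep_Psi_mod(3)[OF that], of a] rep_Psi_mod(2)[OF that] True by blast
      hence "lk h (\<d> a) = 0"
        unfolding hd by (intro sum.neutral) simp
      thus ?thesis using ht f1 d_t_Gamma[OF True] by (simp add: lookup_minus)
    next
      case False
      define Y where "Y = {y. y / a \<in> \<Gamma>}"
      have Y: "Y \<in> ?S" "coset_rep Y / a \<in> \<Gamma>"
        using coset_of_Psi[OF a False] by (simp_all add: Y_def)
      have "a / coset_rep X \<in> \<Gamma> \<longleftrightarrow> X = Y" if X: "X \<in> ?S" for X
      proof -
        have "a / coset_rep X \<in> \<Gamma> \<longleftrightarrow> coset_rep Y / coset_rep X \<in> \<Gamma>"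
          using Gamma_mult[OF Y(2), of "a / coset_rep X"] Gamma_divide[OF _ Y(2), of "coset_rep Y / coset_rep X"]
            a0 rep_Psi_mod(3)[OF X] rep_Psi_mod(3)[OF Y(1)] by auto
        also have "\<dots> \<longleftrightarrow> Y = X"
          by (rule rep_ratio_iff[OF rep_Psi_mod(4)[OF Y(1)] rep_Psi_mod(4)[OF X]])
        finally show ?thesis by blast
      qed
      hence "lk h (\<d> a) = (\<Sum>X\<in>?S. if X = Y then c X else 0)"
        unfolding hd by (intro sum.cong) auto
      also have "\<dots> = c Y"
        using finite_sets_f Y(1) by simp
      also have "\<dots> = lk f (\<d> a) - lk f (\<t> a)"
        using H_Gamma_ratio[OF Y(2) a0] by (simp add: c_def)
      finally show ?thesis using ht by (simp add: lookup_minus)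
    qed
  qed
  hence "f - h \<in> Inv"
    using Z_diff[OF fZ hZ] by (auto simp: Inv_def)
  thus ?thesis using that[of "f - h" h] hs by simp
qed

lemma mult_span_D:
  assumes f: "f \<in> carrier Z" and V: "ga.subspace V"
    and D: "\<And>x. x \<in> \<Psi> \<Longrightarrow> x \<notin> \<Gamma> \<Longrightarrow> f \<otimes>\<^bsub>Z\<^esub> \<D> x \<in> V" and h: "h \<in> ga.span DD"
  shows "f \<otimes>\<^bsub>Z\<^esub> h \<in> V"
proof -
  let ?W = "{h \<in> carrier Z. f \<otimes>\<^bsub>Z\<^esub> h \<in> V}"
  have "ga.subspace ?W"
    using V Z.r_null[OF f] f
    by (auto simp: ga.subspace_def Z_zero Z_add Z_scale Z_distrib Z_mult_scale Z_ops(1))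
  moreover have "DD \<subseteq> ?W"
    using D D_Z Psi_nonzero by auto
  ultimately have "ga.span DD \<subseteq> ?W"
    by (rule ga.span_minimal[rotated])
  thus ?thesis using h by auto
qed

lemma span_D_Z: "ga.span DD \<subseteq> carrier Z"
  using D_Z Psi_nonzero by (intro ga.span_minimal Z_subspace) auto

text \<open>With \<open>f = f1 + f2\<close> and \<open>g = g1 + g2\<close> the product is
  \<open>f * g2 + g1 * f2 + f1 * g1\<close>. The first two terms are products with combinations of
  the \<open>\<D> x\<close>, and the last is zero.\<close>

lemma Rad_mult_Rad:
  assumes f: "f \<in> Rad" and g: "g \<in> Rad"
  shows "f \<otimes>\<^bsub>Z\<^esub> g \<in> Sq"
proof -
  obtain f1 f2 where f12: "f1 \<in> Inv" "f2 \<in> ga.span DD" "f = f1 + f2"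
    using Rad_decompose[OF f] .
  obtain g1 g2 where g12: "g1 \<in> Inv" "g2 \<in> ga.span DD" "g = g1 + g2"
    using Rad_decompose[OF g] .
  have Inv: "Inv \<subseteq> carrier Z" by (auto simp: Inv_def)
  have Z: "f \<in> carrier Z" "f1 \<in> carrier Z" "g1 \<in> carrier Z" "f2 \<in> carrier Z" "g2 \<in> carrier Z"
    using f Rad_subset_Z f12(1,2) g12(1,2) Inv span_D_Z by blast+
  have 1: "f \<otimes>\<^bsub>Z\<^esub> g2 \<in> Sq"
    using mult_span_D[OF Z(1) subspace_Sq Rad_mult_D[OF f] g12(2)] .
  have "g1 \<otimes>\<^bsub>Z\<^esub> f2 \<in> Sq"
    using mult_span_D[OF Z(3) subspace_Sq Rad_mult_D f12(2)] g12(1) Inv_subset_Rad by blast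
  moreover have "f \<otimes>\<^bsub>Z\<^esub> g1 = f1 \<otimes>\<^bsub>Z\<^esub> g1 + g1 \<otimes>\<^bsub>Z\<^esub> f2"
    unfolding f12(3) using Z Z_distrib(1) Z.m_comm[OF Z(4) Z(3)] by simp
  ultimately have 2: "f \<otimes>\<^bsub>Z\<^esub> g1 \<in> Sq"
    using Inv_mult_Inv[OF f12(1) g12(1)] by simp
  have "f \<otimes>\<^bsub>Z\<^esub> g = f \<otimes>\<^bsub>Z\<^esub> g1 + f \<otimes>\<^bsub>Z\<^esub> g2"
    unfolding g12(3) using Z Z_distrib(2) by simp
  thus ?thesis using 1 2 subspace_Sq by (simp add: ga.subspace_def)
qed

lemma Sq_mult_Rad:
  assumes f: "f \<in> Sq" and g: "g \<in> Rad"
  shows "f \<otimes>\<^bsub>Z\<^esub> g = 0"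
proof -
  obtain g1 g2 where g12: "g1 \<in> Inv" "g2 \<in> ga.span DD" "g = g1 + g2"
    using Rad_decompose[OF g] .
  have fI: "f \<in> Inv" using f Sq_subset_Inv by blast
  hence fZ: "f \<in> carrier Z" by (simp add: Inv_def)
  have V: "ga.subspace {0 :: ('f^3^3) set \<Rightarrow>\<^sub>0 'k}" by (simp add: ga.subspace_def)
  have "f \<otimes>\<^bsub>Z\<^esub> \<D> x \<in> {0}" if "x \<in> \<Psi>" "x \<notin> \<Gamma>" for x
    using Sq_mult_D[OF f that] by simp
  from mult_span_D[OF fZ V this g12(2)] have "f \<otimes>\<^bsub>Z\<^esub> g2 = 0" by simp
  moreover have "g2 \<in> carrier Z" using g12(2) span_D_Z by blast
  moreover have "g1 \<in> carrier Z" using g12(1) by (simp add: Inv_def)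
  ultimately show ?thesis
    unfolding g12(3) using Z_distrib(2)[OF _ _ fZ] Inv_mult_Inv[OF fI g12(1)] by simp
qed

text \<open>The functional with kernel \<open>Rad\<close> takes the value 1 at
  \<open>Id_elt q\<close>, so the centre is \<open>Rad\<close> plus the scalar multiples of the
  identity.\<close>

lemma Z_split:
  assumes f: "f \<in> carrier Z"
  shows "f - ga_scale (lk f (\<d> 1) - lk f (\<t> 1)) (Id_elt q) \<in> Rad"
  using Z_diff[OF f Z_scale[OF Id_Z]] Gamma_one Id_values(1)[of 1] Id_values(2)[of 1]
  by (simp add: Rad_def lookup_minus lookup_ga_scale)

lemma Id_mult: "f \<in> carrier Z \<Longrightarrow> ga_scale c (Id_elt q) \<otimes>\<^bsub>Z\<^esub> f = ga_scale c f"
  using Z_mult_scale(1)[OF Id_Z, of f c] Z.l_one[of f] by (simp add: Z_ops(4))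

text \<open>A central element is a scalar plus an element of \<open>Rad\<close>, so closure under
  multiplication follows from \<open>Rad_mult_Rad\<close> and
  \<open>Sq \<subseteq> Rad\<close>.\<close>

lemma ideal_Rad: "ideal Rad Z"
proof (rule idealI)
  show "ring Z" by (rule Z.ring_axioms)
  show "subgroup Rad (add_monoid Z)"
  proof (rule Z.add.subgroupI)
    show "Rad \<subseteq> carrier Z" by (rule Rad_subset_Z)
    show "Rad \<noteq> {}" using subspace_Rad by (auto simp: ga.subspace_def)
    fix f assume f: "f \<in> Rad"
    have "\<ominus>\<^bsub>Z\<^esub> f = - f"
      using f Rad_subset_Z Z_diff[OF Z_zero, of f] by (intro Z.minus_equality) (auto simp: Z_ops)
    thus "\<ominus>\<^bsub>Z\<^esub> f \<in> Rad"
      using ga.subspace_neg[OF subspace_Rad f] by simp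
    fix g assume "g \<in> Rad"
    thus "f \<oplus>\<^bsub>Z\<^esub> g \<in> Rad"
      using f subspace_Rad by (simp add: Z_ops ga.subspace_def)
  qed
  fix f x assume f: "f \<in> Rad" and x: "x \<in> carrier Z"
  have fZ: "f \<in> carrier Z" using f Rad_subset_Z by blast
  define c where "c = lk x (\<d> 1) - lk x (\<t> 1)"
  have r: "x - ga_scale c (Id_elt q) \<in> Rad" using Z_split[OF x] by (simp add: c_def)
  have "x \<otimes>\<^bsub>Z\<^esub> f = (x - ga_scale c (Id_elt q)) \<otimes>\<^bsub>Z\<^esub> f + ga_scale c (Id_elt q) \<otimes>\<^bsub>Z\<^esub> f"
    using Z_distrib(1)[of "x - ga_scale c (Id_elt q)" "ga_scale c (Id_elt q)" f] r Rad_subset_Z Z_scale[OF Id_Z] fZ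
    by auto
  also have "\<dots> \<in> Rad"
    using Rad_mult_Rad[OF r f] Sq_subset_Inv Inv_subset_Rad subspace_Rad f
    by (auto simp: Id_mult[OF fZ] ga.subspace_def)
  finally show "x \<otimes>\<^bsub>Z\<^esub> f \<in> Rad" .
  thus "f \<otimes>\<^bsub>Z\<^esub> x \<in> Rad" using Z.m_comm[OF fZ x] by simp
qed

lemma maximal_Rad: "maximalideal Rad Z"
proof (rule maximalidealI[OF ideal_Rad])
  have "Id_elt q \<notin> Rad"
    using Id_values(1)[of 1] Id_values(2)[of 1] Gamma_one by (simp add: Rad_def)
  thus "carrier Z \<noteq> Rad" using Id_Z by blast
  fix I assume I: "ideal I Z" "Rad \<subseteq> I" "I \<subseteq> carrier Z"
  show "I = Rad \<or> I = carrier Z"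
  proof (rule disjCI)
    assume "I \<noteq> carrier Z"
    show "I = Rad"
    proof (rule ccontr)
      assume "I \<noteq> Rad"
      then obtain f where f: "f \<in> I" "f \<notin> Rad" using I by blast
      have fZ: "f \<in> carrier Z" using f I by blast
      define c where "c = lk f (\<d> 1) - lk f (\<t> 1)"
      define h where "h = f - ga_scale c (Id_elt q)"
      have c0: "c \<noteq> 0" using f(2) fZ by (auto simp: Rad_def c_def)
      have h: "h \<in> Rad" unfolding h_def c_def by (rule Z_split[OF fZ])
      hence nh: "- h \<in> I" using ga.subspace_neg[OF subspace_Rad] I by blast
      have "f + - h \<in> I"
        using additive_subgroup.a_closed[OF ideal.axioms(1)[OF I(1)] f(1) nh] by (simp add: Z_ops)
      hence "ga_scale c (Id_elt q) \<in> I" by (simp add: h_def)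
      from ideal.I_l_closed[OF I(1) this Z_scale[OF Id_Z, of "1 / c"]]
      have "\<one>\<^bsub>Z\<^esub> \<in> I"
        using c0 by (simp add: Id_mult[OF Z_scale[OF Id_Z]] Z_ops(4))
      hence "I = carrier Z" by (rule ideal.one_imp_carrier[OF I(1)])
      thus False using \<open>I \<noteq> carrier Z\<close> by blast
    qed
  qed
qed

text \<open>\<open>Rad\<close> is itself maximal, and each of its elements has cube zero and hence
  lies in every prime ideal, in particular in every maximal one.\<close>

lemma radical_eq: "jacobson_radical Z = Rad"
proof
  show "jacobson_radical Z \<subseteq> Rad"
    using maximal_Rad by (auto simp: jacobson_radical_def)
  show "Rad \<subseteq> jacobson_radical Z"
  proof
    fix f assume f: "f \<in> Rad"
    hence fZ: "f \<in> carrier Z" using Rad_subset_Z by blast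
    have "f \<in> I" if I: "maximalideal I Z" for I
    proof -
      have P: "primeideal I Z" by (rule Z.maximalideal_prime[OF I])
      have "(f \<otimes>\<^bsub>Z\<^esub> f) \<otimes>\<^bsub>Z\<^esub> f = \<zero>\<^bsub>Z\<^esub>"
        using Sq_mult_Rad[OF Rad_mult_Rad[OF f f] f] by (simp add: Z_ops(1))
      moreover have "\<zero>\<^bsub>Z\<^esub> \<in> I"
        using additive_subgroup.zero_closed[OF ideal.axioms(1)[OF maximalideal.axioms(1)[OF I]]] .
      ultimately show ?thesis
        using primeideal.I_prime[OF P] fZ by (metis Z.m_closed)
    qed
    thus "f \<in> jacobson_radical Z" using fZ by (auto simp: jacobson_radical_def)
  qed
qed

lemma basis_Sq:
  "is_basis_family (Psi_mod_Gamma q - {\<Gamma>}) (\<lambda>X. on_coset \<D> X + on_coset \<T> X) Sq"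
  "ga.dim Sq = card (Psi_mod_Gamma q - {\<Gamma>} :: 'f set set)"
proof -
  let ?S = "Psi_mod_Gamma q - {\<Gamma>}"
  have b: "on_coset \<D> X + on_coset \<T> X = \<D> (coset_rep X) + \<T> (coset_rep X)" if "X \<in> ?S" for X
    using on_coset_DT[OF rep_Psi_mod(4)[OF that]] by simp
  have mem: "on_coset \<D> X + on_coset \<T> X \<in> Sq" if "X \<in> ?S" for X
    unfolding b[OF that] using rep_Psi_mod[OF that] by (intro D_T_in_Sq)
  have dual: "lk (on_coset \<D> X + on_coset \<T> X) (\<d> (coset_rep Y)) = (if X = Y then 1 else 0)"
    if "X \<in> ?S" "Y \<in> ?S" for X Y
    unfolding b[OF that(1)] using rep_Psi_mod[OF that(1)] rep_Psi_mod[OF that(2)] rep_ratio_iff[of Y X]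
    by (auto simp: lookup_add lookup_D_d lookup_T_d)
  have sep: "f = 0" if f: "f \<in> Sq" and 0: "\<And>X. X \<in> ?S \<Longrightarrow> lk f (\<d> (coset_rep X)) = 0" for f
  proof (rule Sq_eq_0I[OF f])
    fix a assume a: "a \<in> \<Psi>" "a \<notin> \<Gamma>"
    show "lk f (\<d> a) = 0"
      using 0[OF coset_of_Psi(1)[OF a]] H_Gamma_ratio(1)[OF coset_of_Psi(2)[OF a] Psi_nonzero[OF a(1)]] by simp
  qed
  show "is_basis_family ?S (\<lambda>X. on_coset \<D> X + on_coset \<T> X) Sq" "ga.dim Sq = card ?S"
    using is_basis_family_dualI[OF finite_sets_f subspace_Sq mem dual sep] by blast+
qed

text \<open>\<open>ideal_prod\<close> closes the products under addition only. It is therefore first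
  shown to be a subspace, after which it suffices to find the basis of \<open>Sq\<close> in
  it.\<close>

lemma ideal_prod_Rad: "ideal_prod Z Rad Rad = Sq"
proof
  show "ideal_prod Z Rad Rad \<subseteq> Sq"
  proof
    fix s assume "s \<in> ideal_prod Z Rad Rad"
    thus "s \<in> Sq"
      by induction (use Rad_mult_Rad subspace_Sq in \<open>auto simp: Z_ops(2) ga.subspace_def\<close>)
  qed
  have "ga.subspace (ideal_prod Z Rad Rad)"
    unfolding ga.subspace_def
  proof safe
    have "0 \<in> Rad" using subspace_Rad by (simp add: ga.subspace_def)
    from ideal_prod.prod[OF this this, of Z] show "0 \<in> ideal_prod Z Rad Rad"
      using Z.l_null[OF Z_zero] by (simp add: Z_ops(1))
  next
    fix f g assume "f \<in> ideal_prod Z Rad Rad" "g \<in> ideal_prod Z Rad Rad"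
    from ideal_prod.sum[OF this] show "f + g \<in> ideal_prod Z Rad Rad" by (simp add: Z_ops(2))
  next
    fix c f assume "f \<in> ideal_prod Z Rad Rad"
    thus "ga_scale c f \<in> ideal_prod Z Rad Rad"
    proof induction
      case (prod i j)
      \<comment> \<open>The scalar is absorbed into the left factor.\<close>
      have "ga_scale c i \<in> Rad" using prod subspace_Rad by (simp add: ga.subspace_def)
      moreover have "i \<in> carrier Z" "j \<in> carrier Z"
        using prod Rad_subset_Z by blast+
      ultimately show ?case
        using ideal_prod.prod[of "ga_scale c i" Rad j Rad Z] prod(2) by (simp only: Z_mult_scale(1))
    next
      case (sum s1 s2)
      from ideal_prod.sum[OF sum.IH] show ?case
        by (simp add: Z_ops(2) ga.scale_right_distrib)
    qed
  qed
  moreover have "on_coset \<D> X + on_coset \<T> X \<in> ideal_prod Z Rad Rad" if X: "X \<in> Psi_mod_Gamma q - {\<Gamma>}" for X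
  proof -
    note R = rep_Psi_mod[OF X]
    have "\<D> (coset_rep X) \<in> Rad"
      using D_Z[OF R(3)] lookup_D_t[OF R(3,2), of 1] lookup_D_d[OF R(3), of 1] Gamma_if_ratio[OF _ R(3), of 1] R(2) Gamma_one
      by (auto simp: Rad_def Psi_iff)
    from ideal_prod.prod[OF _ this, of "\<T> 1 + Id_elt q" Rad Z] show ?thesis
      using zeta_in_Inv Inv_subset_Rad zeta_mult_D[OF R(1,2)] on_coset_DT[OF R(4)] by auto
  qed
  ultimately have "ga.span ((\<lambda>X. on_coset \<D> X + on_coset \<T> X) ` (Psi_mod_Gamma q - {\<Gamma>})) \<subseteq> ideal_prod Z Rad Rad"
    by (intro ga.span_minimal) auto
  thus "Sq \<subseteq> ideal_prod Z Rad Rad"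
    using basis_Sq(1) by (simp add: is_basis_family_def)
qed

lemma ideal_prod_Sq_Rad: "ideal_prod Z Sq Rad = {0}"
proof
  show "ideal_prod Z Sq Rad \<subseteq> {0}"
  proof
    fix s assume "s \<in> ideal_prod Z Sq Rad"
    thus "s \<in> {0}"
      by induction (auto simp: Sq_mult_Rad Z_ops(2))
  qed
  have "0 \<in> Sq" "0 \<in> Rad" using subspace_Rad subspace_Sq by (simp_all add: ga.subspace_def)
  from ideal_prod.prod[OF this, of Z] show "{0} \<subseteq> ideal_prod Z Sq Rad"
    using Sq_mult_Rad[OF \<open>0 \<in> Sq\<close> \<open>0 \<in> Rad\<close>] by simp
qed

text \<open>The evaluation points dual to \<open>J_family\<close>. On \<open>Rad\<close> the values
  at \<open>\<d> 1\<close> and \<open>\<t> 1\<close> agree, so the single point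
  \<open>\<t> 1\<close> serves for the identity as well.\<close>

primrec J_rep :: "'f J_index \<Rightarrow> ('f^3^3) set"
  where
    "J_rep (D_ix X) = \<d> (coset_rep X)"
  | "J_rep (T_ix X) = \<t> (coset_rep X)"
  | "J_rep T1_ix = \<t> 1"
  | "J_rep (U_ix X) = \<u> (coset_rep X)"

lemma J_indices_cases [consumes 1, case_names D T T1 U]:
  assumes "i \<in> J_indices q"
  obtains X where "i = D_ix X" "X \<in> units_mod_Gamma q" "coset_rep X \<noteq> 0" "coset_rep X \<notin> \<Gamma>"
  | X where "i = T_ix X" "X \<in> units_mod_Gamma q" "coset_rep X \<noteq> 0" "coset_rep X \<notin> \<Gamma>" "coset_rep X \<in> \<Psi>"
  | "i = T1_ix"
  | X where "i = U_ix X" "X \<in> units_mod_L q" "coset_rep X \<noteq> 0"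
proof -
  consider X where "i = D_ix X" "X \<in> units_mod_Gamma q - {\<Gamma>}" | X where "i = T_ix X" "X \<in> Psi_mod_Gamma q - {\<Gamma>}"
    | "i = T1_ix" | X where "i = U_ix X" "X \<in> units_mod_L q"
    using assms by (auto simp: J_indices_def)
  thus ?thesis
  proof cases
    case (1 X)
    thus ?thesis using that(1)[of X] rep_units(1)[of X] rep_not_Gamma[of X] by blast
  next
    case (2 X)
    thus ?thesis using that(2)[of X] rep_Psi_mod[OF 2(2)] by blast
  next
    case 3
    thus ?thesis by (rule that(3))
  next
    case (4 X)
    thus ?thesis using that(4)[of X] rep_L(1)[of X] by blast
  qed
qed

lemma basis_Rad:
  "is_basis_family (J_indices q) (J_family q \<omega> \<tau>) Rad"
  "ga.dim Rad = card (J_indices q :: 'f J_index set)"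
proof -
  have one: "1 \<in> \<Psi>" by (simp add: Psi_iff)
  have fI: "finite (J_indices q :: 'f J_index set)"
    by (auto simp: J_indices_def finite_sets_f)
  have one_ratio: "1 / x \<notin> \<Gamma>" if "x \<noteq> 0" "x \<notin> \<Gamma>" for x
    using Gamma_if_ratio[OF _ that(1), of 1] that Gamma_one by blast
  have mem: "J_family q \<omega> \<tau> i \<in> Rad" if "i \<in> J_indices q" for i
    using that
  proof (cases rule: J_indices_cases)
    case (D X)
    thus ?thesis using on_coset_DT(1)[of X] D_Z[of "coset_rep X"] lookup_D_t[OF _ _ one, of "coset_rep X"]
        lookup_D_d[of "coset_rep X" 1] one_ratio[of "coset_rep X"]
      by (simp add: Rad_def)
  next
    case (T X)
    thus ?thesis using on_coset_DT(2)[of X] T_Z[of "coset_rep X"] lookup_T_t[of "coset_rep X" 1]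
        lookup_T_d[of "coset_rep X" 1] one_ratio[of "coset_rep X"]
      by (simp add: Rad_def)
  next
    case T1
    thus ?thesis using zeta_in_Inv Inv_subset_Rad by auto
  next
    case (U X)
    thus ?thesis using on_coset_U[of X] U_Z lookup_U_d[of 1 "coset_rep X"] lookup_U_t[OF one, of "coset_rep X"]
      by (simp add: Rad_def)
  qed
  have dual: "lk (J_family q \<omega> \<tau> i) (J_rep j) = (if i = j then 1 else 0)"
    if ij: "i \<in> J_indices q" "j \<in> J_indices q" for i j
    using ij(1)
  proof (cases rule: J_indices_cases)
    case (D X)
    have "lk (\<D> (coset_rep X)) (\<t> 1) = 0" by (rule lookup_D_t[OF D(3,4) one])
    with ij(2) show ?thesis
      using D by (cases rule: J_indices_cases)
        (simp_all add: on_coset_DT lookup_D_d lookup_D_t lookup_D_u rep_ratio_iff)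
  next
    case (T X)
    have "lk (\<T> (coset_rep X)) (\<t> 1) = 0"
      using lookup_T_t[OF T(3), of 1] one_ratio[OF T(3,4)] by simp
    with ij(2) show ?thesis
      using T by (cases rule: J_indices_cases)
        (simp_all add: on_coset_DT lookup_T_d lookup_T_t lookup_T_u rep_ratio_iff)
  next
    case T1
    have "lk (\<T> 1 + Id_elt q) (\<t> 1) = 1"
      using lookup_T_t[of 1 1] Id_values(2)[of 1] Gamma_one by (simp add: lookup_add)
    with ij(2) show ?thesis
      using T1 by (cases rule: J_indices_cases)
        (simp_all add: lookup_add lookup_T_d[OF one] lookup_T_t lookup_T_u[OF one] Id_values)
  next
    case (U X)
    have "lk (\<U> (coset_rep X)) (\<t> 1) = 0" by (rule lookup_U_t[OF one U(3)])
    with ij(2) show ?thesis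
      using U by (cases rule: J_indices_cases)
        (simp_all add: on_coset_U lookup_U_d lookup_U_t lookup_U_u rep_L_ratio_iff)
  qed
  have sep: "f = 0" if f: "f \<in> Rad" and 0: "\<And>j. j \<in> J_indices q \<Longrightarrow> lk f (J_rep j) = 0" for f
  proof -
    have fZ: "f \<in> carrier Z" and f1: "lk f (\<t> 1) = lk f (\<d> 1)" using f by (auto simp: Rad_def)
    have t1: "lk f (\<t> 1) = 0" using 0[of T1_ix] by (simp add: J_indices_def)
    show ?thesis
    proof (rule Z_eq_0I[OF fZ])
      fix a :: 'f assume a: "a \<noteq> 0"
      show "lk f (\<d> a) = 0"
      proof (cases "a \<in> \<Gamma>")
        case True
        thus ?thesis using t1 f1 d_t_Gamma by simp
      next
        case False
        define X where "X = {y. y / a \<in> \<Gamma>}"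
        have aX: "a \<in> X" using a Gamma_one by (simp add: X_def)
        have X: "X \<in> units_mod_Gamma q" using a by (auto simp: X_def units_mod_Gamma_eq)
        have "X \<noteq> \<Gamma>" using aX False by blast
        hence "lk f (\<d> (coset_rep X)) = 0" using 0[of "D_ix X"] X by (simp add: J_indices_def)
        moreover have "a / coset_rep X \<in> \<Gamma>" using aX rep_units(2)[OF X] by blast
        ultimately show ?thesis using H_Gamma_ratio(1)[OF _ rep_units(1)[OF X]] by simp
      qed
    next
      fix a assume a: "a \<in> \<Psi>"
      show "lk f (\<t> a) = 0"
      proof (cases "a \<in> \<Gamma>")
        case True
        thus ?thesis using t1 d_t_Gamma by simp
      next
        case False
        from 0[of "T_ix {y. y / a \<in> \<Gamma>}"] coset_of_Psi[OF a False]
        show ?thesis using H_Gamma_ratio(2)[OF coset_of_Psi(2)[OF a False] Psi_nonzero[OF a]]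
          by (simp add: J_indices_def)
      qed
    next
      fix y :: 'f assume y: "y \<noteq> 0"
      define X where "X = {z. z / y \<in> L_set q}"
      have X: "X \<in> units_mod_L q" using y by (auto simp: X_def units_mod_L_eq)
      have "y \<in> X" using y L_set_closed by (simp add: X_def)
      hence r: "y / coset_rep X \<in> L_set q" using rep_L(2)[OF X] by blast
      have "lk f (\<u> (coset_rep X)) = 0" using 0[of "U_ix X"] X by (simp add: J_indices_def)
      thus "lk f (\<u> y) = 0"
        using class_fun_u_L[OF Z_class_fun[OF fZ] r, of "coset_rep X"] rep_L(1)[OF X] by simp
    qed
  qed
  show "is_basis_family (J_indices q) (J_family q \<omega> \<tau>) Rad" "ga.dim Rad = card (J_indices q :: 'f J_index set)"
    using is_basis_family_dualI[OF fI subspace_Rad mem dual sep] by blast+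
qed

lemma card_Psi_mod_minus:
  "real (card (Psi_mod_Gamma q - {\<Gamma>} :: 'f set set)) = (real q + 1) / real (gam q) - 1"
proof -
  let ?n = "card (Psi_mod_Gamma q :: 'f set set)"
  have "?n * gam q = q + 1" by (rule card_Psi_mod_Gamma)
  hence "real ?n * real (gam q) = real q + 1" by (metis of_nat_1 of_nat_add of_nat_mult)
  hence "real ?n = (real q + 1) / real (gam q)" using gam_pos by (simp add: field_simps)
  \<comment> \<open>Positivity makes the truncated subtraction for the removed coset agree with that
    of the reals.\<close>
  moreover have "?n > 0" using Gamma_in_Psi_mod finite_sets_f card_gt_0_iff by blast
  ultimately show ?thesis
    using Gamma_in_Psi_mod by (simp add: card_Diff_singleton of_nat_diff)
qed

lemma card_J_indices:
  "real (card (J_indices q :: 'f J_index set)) = (real q ^ 2 + real q) / real (gam q) + real (gam q) - 1"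
proof -
  let ?n = "card (units_mod_Gamma q :: 'f set set)"
  have "?n * gam q = q ^ 2 - 1" by (rule card_units_mod_Gamma)
  hence "real ?n * real (gam q) = real (q ^ 2 - 1)" by (metis of_nat_mult)
  also have "\<dots> = real q ^ 2 - 1" using q_gt_1 by (simp add: of_nat_diff)
  finally have n: "real ?n = (real q ^ 2 - 1) / real (gam q)" using gam_pos by (simp add: field_simps)
  have "?n > 0" using Gamma_in_units_mod finite_sets_f card_gt_0_iff by blast
  hence n': "real (card (units_mod_Gamma q - {\<Gamma>} :: 'f set set)) = (real q ^ 2 - 1) / real (gam q) - 1"
    using Gamma_in_units_mod n by (simp add: card_Diff_singleton of_nat_diff)
  let ?A = "D_ix ` (units_mod_Gamma q - {\<Gamma>})" and ?B = "T_ix ` (Psi_mod_Gamma q - {\<Gamma>})"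
    and ?C = "U_ix ` (units_mod_L q :: 'f set set)"
  have "card (?A \<union> ?B \<union> {T1_ix} \<union> ?C) = card (?A \<union> ?B \<union> {T1_ix}) + card ?C"
    by (rule card_Un_disjoint) (auto simp: finite_sets_f)
  moreover have "card (?A \<union> ?B \<union> {T1_ix}) = card (?A \<union> ?B) + card {T1_ix :: 'f J_index}"
    by (rule card_Un_disjoint) (auto simp: finite_sets_f)
  moreover have "card (?A \<union> ?B) = card ?A + card ?B"
    by (rule card_Un_disjoint) (auto simp: finite_sets_f)
  ultimately have "card (J_indices q :: 'f J_index set) = card (D_ix ` (units_mod_Gamma q - {\<Gamma>}))
      + card (T_ix ` (Psi_mod_Gamma q - {\<Gamma>})) + 1 + card (U_ix ` (units_mod_L q :: 'f set set))"
    unfolding J_indices_def by simp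
  also have "\<dots> = card (units_mod_Gamma q - {\<Gamma>}) + card (Psi_mod_Gamma q - {\<Gamma>}) + 1 + gam q"
    by (simp add: card_image inj_on_def card_units_mod_L)
  \<comment> \<open>The two removed trivial cosets and the extra index \<open>T1_ix\<close> leave
    the constant -1, and the two quotients add up to \<open>(q ^ 2 + q) / gam q\<close>.\<close>
  finally have "real (card (J_indices q :: 'f J_index set))
    = ((real q ^ 2 - 1) / real (gam q) - 1) + ((real q + 1) / real (gam q) - 1) + 1 + real (gam q)"
    by (simp add: n' card_Psi_mod_minus)
  also have "\<dots> = (real q ^ 2 + real q) / real (gam q) + real (gam q) - 1"
    by (simp add: diff_divide_distrib add_divide_distrib)
  finally show ?thesis .
qed

end

theorem theorem41:
  fixes p r q :: nat
    and \<omega> \<tau> :: "'f::field"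
    and Z :: "(('f^3^3) set \<Rightarrow>\<^sub>0 'k::field) ring"
    and J J2 J3 :: "(('f^3^3) set \<Rightarrow>\<^sub>0 'k) set"
  assumes "prime p" and "r \<ge> 1" and "q = p ^ r"
    and "CARD('f) = q ^ 2"
    and "CHAR('k) = p"
    and "\<omega> \<noteq> 0" and "\<omega> + qbar q \<omega> = 0"
    and "\<tau> + qbar q \<tau> = -1"
    and "Z = ZkN q"
    and "J = jacobson_radical Z"
    and "J2 = ideal_prod Z J J"
    and "J3 = ideal_prod Z J2 J"
  shows
    "(is_basis_family (J_indices q) (J_family q \<omega> \<tau>) J \<and>
      real (ga.dim J) = (real q ^ 2 + real q) / real (gam q) + real (gam q) - 1) \<and>
     (is_basis_family (Psi_mod_Gamma q - {Gamma_set q})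
        (\<lambda>X. on_coset (D_elt q) X + on_coset (T_elt q \<omega>) X) J2 \<and>
      real (ga.dim J2) = (real q + 1) / real (gam q) - 1) \<and>
     J3 = {\<zero>\<^bsub>Z\<^esub>}"
proof -
  interpret hermitian_algebra p r q \<omega> \<tau> "TYPE('k)"
    using assms(1-8) by unfold_locales
  have Z: "Z = ZkN q" by fact
  have J: "J = Rad"
    unfolding assms(10) Z by (rule radical_eq)
  have J2: "J2 = Sq"
    unfolding assms(11) J Z by (rule ideal_prod_Rad)
  have J3: "J3 = {0}"
    unfolding assms(12) J J2 Z by (rule ideal_prod_Sq_Rad)
  show ?thesis
    unfolding J J2 J3 Z Z_ops(1) basis_Rad(2) basis_Sq(2) card_J_indices card_Psi_mod_minus
    using basis_Rad(1) basis_Sq(1) by blast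
qed

end
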